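(* Let $G$ be a countably infinite, connected, amenable graph, and let $\Gamma$ be a closed subgroup of $\mathrm{Aut}(G)$ that acts transitively on (the vertices of) $G$. Then there is a $\Gamma$-invariant random spanning double ray in $G^3$.
   Context: For $k\ge 1$, $G^k$ denotes the graph with vertex set $V(G)$ in which two distinct vertices are adjacent iff their distance in $G$ is at most $k$. Every automorphism of $G$ acts as an automorphism of $G^k$. $\mathrm{Aut}(G)$ carries the topology of pointwise convergence on $V(G)$. A graph $G$ is amenable if for every $\varepsilon>0$ there is a finite nonempty $F\subseteq V(G)$ such that the number of edges of $G$ with exactly one endpoint in $F$ is at most $\varepsilon|F|$. (In particular, a transitive amenable graph is locally finite.) A spanning double ray of a graph $X$ is a connected subgraph of $X$ containing all vertices of $X$ in which every vertex has exactly two neighbours. Spanning subgraphs of $X$ are identified with elements of $2^{E(X)}$, equipped with the $\sigma$-algebra generated by cylinder sets (events depending on finitely many edges). A random spanning double ray of $X$ is a random element of $2^{E(X)}$ that is almost surely the edge set of a spanning double ray. It is $\Gamma$-invariant if its distribution is invariant under the action of $\Gamma$ on $2^{E(X)}$. *)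

theory Defs
  imports "HOL-Algebra.Bij" "HOL-Library.Extended_Nat" "HOL-Probability.Probability"
begin

text \<open>Graphs are simple and undirected: a vertex set together with a set of two-element
  subsets of it.\<close>

definition graph :: "'v set \<Rightarrow> 'v set set \<Rightarrow> bool" where
  "graph V E \<longleftrightarrow> E \<subseteq> {{u, v} |u v. u \<in> V \<and> v \<in> V \<and> u \<noteq> v}"

definition adj_rel :: "'v set set \<Rightarrow> 'v rel" where
  "adj_rel E = {(u, v). {u, v} \<in> E}"

definition graph_connected :: "'v set \<Rightarrow> 'v set set \<Rightarrow> bool" where
  "graph_connected V E \<longleftrightarrow> (\<forall>u\<in>V. \<forall>v\<in>V. (u, v) \<in> (adj_rel E)\<^sup>*)"

text \<open>A pair \<open>(u, v)\<close> lies in \<open>adj_rel E ^^ n\<close> iff there is a walk of length \<open>n\<close> from \<open>u\<close> to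
  \<open>v\<close>. The distance is \<open>\<infinity>\<close> if there is no walk at all.\<close>

definition graph_dist :: "'v set set \<Rightarrow> 'v \<Rightarrow> 'v \<Rightarrow> enat" where
  "graph_dist E u v = (INF n\<in>{n. (u, v) \<in> adj_rel E ^^ n}. enat n)"

text \<open>The edge set of the \<open>k\<close>-th power of \<open>(V, E)\<close>; its vertex set is again \<open>V\<close>.\<close>

definition graph_power :: "'v set \<Rightarrow> 'v set set \<Rightarrow> nat \<Rightarrow> 'v set set" where
  "graph_power V E k =
    {{u, v} |u v. u \<in> V \<and> v \<in> V \<and> u \<noteq> v \<and> graph_dist E u v \<le> enat k}"

definition edge_boundary :: "'v set set \<Rightarrow> 'v set \<Rightarrow> 'v set set" where
  "edge_boundary E F = {e \<in> E. card (e \<inter> F) = 1}"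

text \<open>Finiteness of the boundary must be demanded explicitly, because \<^const>\<open>card\<close> is \<open>0\<close> on
  infinite sets.\<close>

definition graph_amenable :: "'v set \<Rightarrow> 'v set set \<Rightarrow> bool" where
  "graph_amenable V E \<longleftrightarrow>
    (\<forall>\<epsilon>::real. \<epsilon> > 0 \<longrightarrow>
      (\<exists>F. F \<subseteq> V \<and> finite F \<and> F \<noteq> {} \<and> finite (edge_boundary E F) \<and>
           real (card (edge_boundary E F)) \<le> \<epsilon> * real (card F)))"

text \<open>Automorphisms are extensional on \<open>V\<close>, as in \<^const>\<open>BijGroup\<close>; hence they are also points
  of the product space of \<open>V\<close>-many copies of \<open>V\<close>.\<close>

definition graph_auts :: "'v set \<Rightarrow> 'v set set \<Rightarrow> ('v \<Rightarrow> 'v) set" where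
  "graph_auts V E = {g \<in> Bij V. \<forall>u\<in>V. \<forall>v\<in>V. {g u, g v} \<in> E \<longleftrightarrow> {u, v} \<in> E}"

definition graph_aut_group :: "'v set \<Rightarrow> 'v set set \<Rightarrow> ('v \<Rightarrow> 'v) monoid" where
  "graph_aut_group V E = BijGroup V \<lparr>carrier := graph_auts V E\<rparr>"

definition graph_aut_topology :: "'v set \<Rightarrow> 'v set set \<Rightarrow> ('v \<Rightarrow> 'v) topology" where
  "graph_aut_topology V E =
    subtopology (product_topology (\<lambda>_. discrete_topology V) V) (graph_auts V E)"

definition vertex_transitive :: "('v \<Rightarrow> 'v) set \<Rightarrow> 'v set \<Rightarrow> bool" where
  "vertex_transitive \<Gamma> V \<longleftrightarrow> (\<forall>u\<in>V. \<forall>v\<in>V. \<exists>g\<in>\<Gamma>. g u = v)"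

definition spanning_double_ray :: "'v set \<Rightarrow> 'v set set \<Rightarrow> 'v set set \<Rightarrow> bool" where
  "spanning_double_ray V E S \<longleftrightarrow>
    S \<subseteq> E \<and> graph_connected V S \<and> (\<forall>v\<in>V. card {u. {u, v} \<in> S} = 2)"

definition cylinder_events :: "'v set set \<Rightarrow> 'v set set set set" where
  "cylinder_events E =
    {A. A \<subseteq> Pow E \<and>
        (\<exists>F. F \<subseteq> E \<and> finite F \<and>
             (\<forall>S\<in>Pow E. \<forall>T\<in>Pow E. S \<inter> F = T \<inter> F \<longrightarrow> (S \<in> A \<longleftrightarrow> T \<in> A)))}"

text \<open>Only the underlying measurable space of this measure is relevant.\<close>

definition subgraph_space :: "'v set set \<Rightarrow> 'v set set measure" where
  "subgraph_space E = sigma (Pow E) (cylinder_events E)"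

definition subgraph_action :: "('v \<Rightarrow> 'v) \<Rightarrow> 'v set set \<Rightarrow> 'v set set" where
  "subgraph_action g S = (\<lambda>e. g ` e) ` S"

definition random_spanning_double_ray ::
    "'w measure \<Rightarrow> 'v set \<Rightarrow> 'v set set \<Rightarrow> ('w \<Rightarrow> 'v set set) \<Rightarrow> bool" where
  "random_spanning_double_ray M V E R \<longleftrightarrow>
    prob_space M \<and> R \<in> M \<rightarrow>\<^sub>M subgraph_space E \<and>
    (AE x in M. spanning_double_ray V E (R x))"

definition invariant_random_subgraph ::
    "('v \<Rightarrow> 'v) set \<Rightarrow> 'w measure \<Rightarrow> 'v set set \<Rightarrow> ('w \<Rightarrow> 'v set set) \<Rightarrow> bool" where
  "invariant_random_subgraph \<Gamma> M E R \<longleftrightarrow>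
    (\<forall>g\<in>\<Gamma>. distr (distr M (subgraph_space E) R) (subgraph_space E) (subgraph_action g)
            = distr M (subgraph_space E) R)"

subsection \<open>Well-definedness of the action on the space of subgraphs\<close>

lemma graph_graph_power: "graph V (graph_power V E k)"
  unfolding graph_def graph_power_def by blast

lemma adj_rel_subset: "graph V E \<Longrightarrow> (u, v) \<in> adj_rel E \<Longrightarrow> u \<in> V \<and> v \<in> V"
  unfolding graph_def adj_rel_def by (auto simp: doubleton_eq_iff)

lemma graph_auts_relpow:
  assumes "graph V E" "g \<in> graph_auts V E" "u \<in> V"
  shows "v \<in> V \<Longrightarrow> (g u, g v) \<in> adj_rel E ^^ n \<longleftrightarrow> (u, v) \<in> adj_rel E ^^ n"
proof (induction n arbitrary: v)
  case 0
  then show ?case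
    using assms by (auto simp: graph_auts_def Bij_def bij_betw_def inj_on_def)
next
  case (Suc n)
  have bij: "g ` V = V"
    using assms(2) by (auto simp: graph_auts_def Bij_def bij_betw_def)
  have adj: "(g w, g v) \<in> adj_rel E \<longleftrightarrow> (w, v) \<in> adj_rel E" if "w \<in> V" for w
    using assms(2) that Suc.prems by (auto simp: graph_auts_def adj_rel_def)
  have "(g u, g v) \<in> adj_rel E ^^ Suc n \<longleftrightarrow>
      (\<exists>w\<in>V. (g u, g w) \<in> adj_rel E ^^ n \<and> (g w, g v) \<in> adj_rel E)"
  proof
    assume "(g u, g v) \<in> adj_rel E ^^ Suc n"
    then obtain y where y: "(g u, y) \<in> adj_rel E ^^ n" "(y, g v) \<in> adj_rel E"
      by auto
    then have "y \<in> g ` V"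
      using adj_rel_subset[OF assms(1)] bij by simp
    then obtain w where "w \<in> V" "y = g w"
      by blast
    with y show "\<exists>w\<in>V. (g u, g w) \<in> adj_rel E ^^ n \<and> (g w, g v) \<in> adj_rel E"
      by blast
  qed auto
  also have "\<dots> \<longleftrightarrow> (\<exists>w\<in>V. (u, w) \<in> adj_rel E ^^ n \<and> (w, v) \<in> adj_rel E)"
    using Suc.IH adj by blast
  also have "\<dots> \<longleftrightarrow> (u, v) \<in> adj_rel E ^^ Suc n"
    using adj_rel_subset[OF assms(1)] by (auto simp: relcomp_unfold)
  finally show ?case .
qed

lemma graph_power_edge_iff:
  assumes "graph V E"
  shows "{u, v} \<in> graph_power V E k \<longleftrightarrow>
    u \<in> V \<and> v \<in> V \<and> u \<noteq> v \<and> graph_dist E u v \<le> enat k"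
proof -
  have "sym (adj_rel E)"
    by (auto simp: sym_def adj_rel_def insert_commute)
  hence "(x, y) \<in> adj_rel E ^^ n \<Longrightarrow> (y, x) \<in> adj_rel E ^^ n" for x y n
  proof (induction n arbitrary: y)
    case (Suc n)
    then show ?case by (metis relpow_Suc_E relpow_Suc_I2 symE)
  qed auto
  hence "graph_dist E x y = graph_dist E y x" for x y
    unfolding graph_dist_def by metis
  then show ?thesis
    unfolding graph_power_def by (auto simp: doubleton_eq_iff)
qed

lemma graph_auts_graph_power:
  assumes "graph V E"
  shows "graph_auts V E \<subseteq> graph_auts V (graph_power V E k)"
proof
  fix g assume g: "g \<in> graph_auts V E"
  hence bij: "g \<in> Bij V" "bij_betw g V V"
    by (auto simp: graph_auts_def Bij_def)
  have "{g u, g v} \<in> graph_power V E k \<longleftrightarrow> {u, v} \<in> graph_power V E k"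
    if "u \<in> V" "v \<in> V" for u v
    using graph_auts_relpow[OF assms g] that bij
    by (auto simp: graph_power_edge_iff[OF assms] graph_dist_def bij_betw_def inj_on_eq_iff)
  with bij show "g \<in> graph_auts V (graph_power V E k)"
    by (simp add: graph_auts_def)
qed

lemma group_graph_aut_group:
  assumes "graph V E"
  shows "group (graph_aut_group V E)"
proof -
  have "subgroup (graph_auts V E) (BijGroup V)"
  proof (rule group.subgroupI[OF group_BijGroup])
    show "graph_auts V E \<subseteq> carrier (BijGroup V)"
      by (auto simp: graph_auts_def BijGroup_def)
    show "graph_auts V E \<noteq> {}"
      using id_Bij[of V] by (auto simp: graph_auts_def intro!: exI[of _ "\<lambda>x\<in>V. x"])
  next
    fix g assume g: "g \<in> graph_auts V E"
    hence B: "g \<in> Bij V" by (simp add: graph_auts_def)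
    have inv: "inv\<^bsub>BijGroup V\<^esub> g = (\<lambda>x\<in>V. inv_into V g x)"
      using B by (rule inv_BijGroup)
    have "{inv_into V g u, inv_into V g v} \<in> E \<longleftrightarrow> {u, v} \<in> E" if "u \<in> V" "v \<in> V" for u v
    proof -
      have "g ` V = V" using B by (simp add: Bij_def bij_betw_def)
      moreover have "inv_into V g u \<in> V" "inv_into V g v \<in> V"
        using B that by (auto intro: Bij_inv_into_mem)
      moreover from calculation have "{g (inv_into V g u), g (inv_into V g v)} = {u, v}"
        using that by (simp add: f_inv_into_f)
      ultimately show ?thesis
        using g unfolding graph_auts_def mem_Collect_eq by metis
    qed
    then show "inv\<^bsub>BijGroup V\<^esub> g \<in> graph_auts V E"
      unfolding inv using restrict_inv_into_Bij[OF B] by (simp add: graph_auts_def)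
  next
    fix g h assume "g \<in> graph_auts V E" "h \<in> graph_auts V E"
    then show "g \<otimes>\<^bsub>BijGroup V\<^esub> h \<in> graph_auts V E"
      using Bij_imp_funcset[of h V] compose_Bij[of g V h]
      by (auto simp: graph_auts_def BijGroup_def compose_eq Pi_iff)
  qed
  then show ?thesis
    unfolding graph_aut_group_def by (rule group.subgroup_imp_group[OF group_BijGroup])
qed

lemma measurable_subgraph_action:
  assumes "graph V E" "g \<in> graph_auts V E"
  shows "subgraph_action g \<in> subgraph_space E \<rightarrow>\<^sub>M subgraph_space E"
  unfolding subgraph_space_def
proof (rule measurable_measure_of)
  show "cylinder_events E \<subseteq> Pow (Pow E)"
    by (auto simp: cylinder_events_def)
  have img: "g ` e \<in> E" if "e \<in> E" for e
    using assms that by (fastforce simp: graph_def graph_auts_def)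
  have act: "subgraph_action g S \<subseteq> E" if "S \<subseteq> E" for S
    unfolding subgraph_action_def using that by (intro image_subsetI img) (rule subsetD)
  have inj: "inj_on g V"
    using assms(2) by (auto simp: graph_auts_def Bij_def bij_betw_def)
  have sub: "e \<subseteq> V" if "e \<in> E" for e
    using assms(1) that by (auto simp: graph_def)
  show "subgraph_action g \<in> space (sigma (Pow E) (cylinder_events E)) \<rightarrow> Pow E"
    by (auto simp: space_measure_of_conv dest: act)
  fix A assume "A \<in> cylinder_events E"
  then obtain F where F: "F \<subseteq> E" "finite F"
    and *: "\<forall>S\<in>Pow E. \<forall>T\<in>Pow E. S \<inter> F = T \<inter> F \<longrightarrow> (S \<in> A \<longleftrightarrow> T \<in> A)"
    unfolding cylinder_events_def mem_Collect_eq by (elim conjE exE)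
  from * have dep: "S \<in> A \<longleftrightarrow> T \<in> A"
    if "S \<subseteq> E" "T \<subseteq> E" "S \<inter> F = T \<inter> F" for S T
    using that by (meson PowI)
  let ?F = "{e \<in> E. g ` e \<in> F}"
  have "inj_on ((`) g) ?F"
    by (rule inj_on_subset[OF inj_on_image_Pow[OF inj]]) (use sub in blast)
  moreover have "(`) g ` ?F \<subseteq> F" by auto
  ultimately have fin: "finite ?F"
    using F(2) by (meson finite_imageD finite_subset)
  have iff: "subgraph_action g S \<in> A \<longleftrightarrow> subgraph_action g T \<in> A"
    if "S \<subseteq> E" "T \<subseteq> E" "S \<inter> ?F = T \<inter> ?F" for S T
  proof (rule dep)
    show "subgraph_action g S \<subseteq> E" "subgraph_action g T \<subseteq> E"
      using that by (simp_all add: act)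
    have "subgraph_action g R \<inter> F = subgraph_action g (R \<inter> ?F)" if "R \<subseteq> E" for R
      unfolding subgraph_action_def using that by (auto simp: subset_iff)
    with that show "subgraph_action g S \<inter> F = subgraph_action g T \<inter> F"
      by simp
  qed
  have "subgraph_action g -` A \<inter> Pow E \<in> cylinder_events E"
    unfolding cylinder_events_def
  proof (rule CollectI, intro conjI exI[of _ ?F] ballI impI)
    fix S T assume "S \<in> Pow E" "T \<in> Pow E" "S \<inter> ?F = T \<inter> ?F"
    with iff[of S T]
    show "S \<in> subgraph_action g -` A \<inter> Pow E \<longleftrightarrow> T \<in> subgraph_action g -` A \<inter> Pow E"
      by simp
  qed (use fin in auto)
  then show "subgraph_action g -` A \<inter> space (sigma (Pow E) (cylinder_events E))
      \<in> sets (sigma (Pow E) (cylinder_events E))"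
    using \<open>cylinder_events E \<subseteq> Pow (Pow E)\<close>
    by (simp add: space_measure_of_conv sets_measure_of_conv sigma_sets.Basic)
qed

end

theory Submission
  imports Defs
begin

text \<open>
  Choose independently, at each stage \<open>n\<close>, translates of a Foelner set with a density for which a given
  edge is with probability at least \<open>1 - 2\<^sup>-\<^sup>n\<close> contained in a chosen translate and cut by none. The
  edges that survive all stages from \<open>N\<close> on span finite components, and these exhaust the graph as \<open>N\<close>
  grows. Hence the minimal spanning forest that prefers edges with smaller \<open>N\<close> (ties are broken by
  independent labels) is a spanning tree. A Burton--Keane count on Foelner sets shows that the tree
  has almost surely no trifurcation, so it has one or two ends.

  In a one-ended tree every vertex has finitely many descendants. List each descendant set with the
  root first at one colour of the bipartition and last at the other; these lists are compatible, and
  in their union (as in the theorem of Sekanina) successive vertices are at distance at most three. Since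
  every vertex has ancestors of both colours, the order has type \<open>\<int>\<close>. With two ends, the finite bushes
  along the trunk are listed one after the other. The only choices that are not equivariant are the
  colour class and the direction of the trunk; each is taken uniformly among its two values.
\<close>

section \<open>Trees rooted at an end\<close>

text \<open>Invariance comes from making every step a function of independent labels that commutes
  with relabelling. What is equivariant in the end is not one double ray but the family indexed by
  the four sign pairs, up to a translation of the group of signs that depends on the sample.

  With weights alone a minimal spanning forest may be disconnected. Finite components at every level
  repair this: an edge has only finitely many lighter edges within reach, so that replacing a
  rejected edge by lighter ones terminates in tree edges.

  The density is a compromise: translates must cover an edge with high probability and yet rarely
  cut it. Therefore the mean number of chosen translates through a vertex is fixed before the
  boundary ratio of the Foelner set.\<close>

definition consecutive :: "('a \<Rightarrow> 'a \<Rightarrow> bool) \<Rightarrow> 'a \<Rightarrow> 'a \<Rightarrow> bool" where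
  "consecutive prec x y \<longleftrightarrow> prec x y \<and> \<not> (\<exists>w. prec x w \<and> prec w y)"

definition linked :: "('a \<Rightarrow> 'a \<Rightarrow> bool) \<Rightarrow> 'a \<Rightarrow> 'a \<Rightarrow> bool" where
  "linked prec x y \<longleftrightarrow> consecutive prec x y \<or> consecutive prec y x"

text \<open>The order type of the integers, given by intrinsic properties so that no origin has to
  be chosen.\<close>

locale discrete_order =
  fixes prec :: "'a \<Rightarrow> 'a \<Rightarrow> bool"
  assumes irrefl: "\<not> prec x x"
    and trans: "prec x y \<Longrightarrow> prec y z \<Longrightarrow> prec x z"
    and total: "x \<noteq> y \<Longrightarrow> prec x y \<or> prec y x"
    and interval: "finite {w. prec x w \<and> prec w y}"
    and no_max: "\<exists>y. prec x y"
    and no_min: "\<exists>y. prec y x"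
begin

lemma converse_discrete_order: "discrete_order (\<lambda>x y. prec y x)"
proof
  fix x y z
  show "\<not> prec x x" by (rule irrefl)
  show "prec y x \<Longrightarrow> prec z y \<Longrightarrow> prec z x" using trans by blast
  show "x \<noteq> y \<Longrightarrow> prec y x \<or> prec x y" using total by blast
  have "{w. prec w x \<and> prec y w} = {w. prec y w \<and> prec w x}" by blast
  then show "finite {w. prec w x \<and> prec y w}" using interval by simp
qed (use no_max no_min in auto)

text \<open>Induction on the number of elements strictly between \<open>x\<close> and
  \<open>y\<close>: any such element splits the interval into two smaller ones.\<close>

lemma consecutive_chain: "prec x y \<Longrightarrow> (consecutive prec)\<^sup>*\<^sup>* x y"
proof (induction "card {w. prec x w \<and> prec w y}" arbitrary: x y rule: less_induct)
  case less
  show ?case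
  proof (cases "consecutive prec x y")
    case False
    then obtain w where w: "prec x w" "prec w y"
      using less.prems unfolding consecutive_def by blast
    have "{u. prec x u \<and> prec u w} \<subset> {u. prec x u \<and> prec u y}"
      "{u. prec w u \<and> prec u y} \<subset> {u. prec x u \<and> prec u y}"
      using w trans irrefl by blast+
    then have "card {u. prec x u \<and> prec u w} < card {u. prec x u \<and> prec u y}"
      "card {u. prec w u \<and> prec u y} < card {u. prec x u \<and> prec u y}"
      using interval psubset_card_mono by blast+
    then have "(consecutive prec)\<^sup>*\<^sup>* x w" "(consecutive prec)\<^sup>*\<^sup>* w y"
      using less.hyps w by blast+
    then show ?thesis by (rule rtranclp_trans)
  qed auto
qed

lemma consecutive_exists: "\<exists>y. consecutive prec x y"
proof -
  obtain z where "prec x z" using no_max by blast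
  then have "(consecutive prec)\<^sup>*\<^sup>* x z" "x \<noteq> z" using consecutive_chain irrefl by blast+
  then show ?thesis by (metis converse_rtranclpE)
qed

lemma consecutive_unique: "consecutive prec x y \<Longrightarrow> consecutive prec x z \<Longrightarrow> y = z"
  unfolding consecutive_def using total by blast

lemma linked_connected: "(linked prec)\<^sup>*\<^sup>* x y"
proof -
  have up: "(linked prec)\<^sup>*\<^sup>* x y" if "prec x y" for x y
    using consecutive_chain[OF that] by (rule rtranclp_mono[THEN predicate2D, rotated])
      (auto simp: linked_def)
  have "symp (linked prec)" by (auto simp: symp_def linked_def)
  then have "symp (linked prec)\<^sup>*\<^sup>*" by (rule symp_rtranclp)
  then show ?thesis
    using up[of x y] up[of y x] total[of x y] by (metis rtranclp.rtrancl_refl sympD)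
qed

lemma card_linked: "card {y. linked prec x y} = 2"
proof -
  interpret conv: discrete_order "\<lambda>x y. prec y x" by (rule converse_discrete_order)
  have conv: "consecutive (\<lambda>x y. prec y x) a b \<longleftrightarrow> consecutive prec b a" for a b
    unfolding consecutive_def by blast
  obtain s where s: "consecutive prec x s" using consecutive_exists by blast
  obtain p where p: "consecutive prec p x" using conv.consecutive_exists conv by blast
  have "{y. linked prec x y} = {s, p}"
    unfolding linked_def using s p consecutive_unique conv.consecutive_unique conv by blast
  moreover have "s \<noteq> p" using s p trans irrefl unfolding consecutive_def by blast
  ultimately show ?thesis by simp
qed

end

text \<open>\<open>P x y\<close> says that \<open>y\<close> is the parent of \<open>x\<close>. Then \<open>branch P z a x\<close> says that \<open>a\<close> is the member of
  \<open>{z} \<union> children of z\<close> representing the descendant \<open>x\<close> of \<open>z\<close>, and two vertices are compared by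
  their representatives at the vertex where these differ. The core is the trunk of a two-ended tree,
  and is empty if the tree is one-ended. The constants in \<open>key\<close> lie outside the range of \<^const>\<open>arctan\<close>:
  at \<open>z\<close>, the core child comes first and \<open>z\<close> precedes or follows all other children.\<close>

definition branch :: "('a \<Rightarrow> 'a \<Rightarrow> bool) \<Rightarrow> 'a \<Rightarrow> 'a \<Rightarrow> 'a \<Rightarrow> bool" where
  "branch P z a x \<longleftrightarrow> a = z \<and> x = z \<or> P a z \<and> P\<^sup>*\<^sup>* x a"

definition key :: "('a \<Rightarrow> bool) \<Rightarrow> ('a \<Rightarrow> bool) \<Rightarrow> ('a \<Rightarrow> real) \<Rightarrow> 'a \<Rightarrow> 'a \<Rightarrow> real" where
  "key core \<tau> lab z a =
    (if a \<noteq> z then if core a then -3 else arctan (lab a) else if \<tau> z then -2 else 2)"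

definition tree_prec ::
    "('a \<Rightarrow> 'a \<Rightarrow> bool) \<Rightarrow> ('a \<Rightarrow> bool) \<Rightarrow> ('a \<Rightarrow> bool) \<Rightarrow> ('a \<Rightarrow> real) \<Rightarrow> 'a \<Rightarrow> 'a \<Rightarrow> bool" where
  "tree_prec P core \<tau> lab x y \<longleftrightarrow>
    (\<exists>z a b. branch P z a x \<and> branch P z b y \<and> key core \<tau> lab z a < key core \<tau> lab z b)"

text \<open>Parents lead towards one end, because \<open>common_ancestor\<close> makes all ancestral
  lines merge. The axioms on parents and children of core vertices make \<open>core\<close> empty or
  a bi-infinite path; \<open>finite_below\<close> says that whatever hangs off this path is finite,
  and \<open>alternate\<close> that \<tau> is a proper two-colouring.\<close>

locale end_rooted_tree =
  fixes P :: "'a \<Rightarrow> 'a \<Rightarrow> bool" and core \<tau> :: "'a \<Rightarrow> bool" and lab :: "'a \<Rightarrow> real"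
  assumes parent_ex: "\<exists>y. P x y"
    and parent_unique: "P x y \<Longrightarrow> P x z \<Longrightarrow> y = z"
    and acyclic: "\<not> P\<^sup>+\<^sup>+ x x"
    and common_ancestor: "\<exists>z. P\<^sup>*\<^sup>* x z \<and> P\<^sup>*\<^sup>* y z"
    and finite_children: "finite {x. P x y}"
    and core_parent: "core x \<Longrightarrow> P x y \<Longrightarrow> core y"
    and core_child: "core x \<Longrightarrow> \<exists>y. core y \<and> P y x"
    and core_child_unique: "core y \<Longrightarrow> core z \<Longrightarrow> P y x \<Longrightarrow> P z x \<Longrightarrow> y = z"
    and finite_below: "\<not> core x \<Longrightarrow> finite {y. P\<^sup>*\<^sup>* y x}"
    and alternate: "P x y \<Longrightarrow> \<tau> x \<longleftrightarrow> \<not> \<tau> y"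
    and inj_lab: "inj lab"
begin

abbreviation "br \<equiv> branch P"
abbreviation "ky \<equiv> key core \<tau> lab"
abbreviation "prec \<equiv> tree_prec P core \<tau> lab"
abbreviation below :: "'a \<Rightarrow> 'a \<Rightarrow> bool" (infix "\<preceq>" 50) where "x \<preceq> y \<equiv> P\<^sup>*\<^sup>* x y"

section \<open>Ancestors, branches and the order they define\<close>

lemma below_step: "x \<preceq> y \<Longrightarrow> P x z \<Longrightarrow> x = y \<or> z \<preceq> y"
  by (metis converse_rtranclpE parent_unique)

lemma below_comparable: "x \<preceq> y \<Longrightarrow> x \<preceq> z \<Longrightarrow> y \<preceq> z \<or> z \<preceq> y"
proof (induction rule: converse_rtranclp_induct)
  case (step x w)
  then show ?case using below_step by (metis converse_rtranclp_into_rtranclp)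
qed auto

lemma parent_not_below: "P x y \<Longrightarrow> \<not> y \<preceq> x"
  using acyclic by (metis rtranclp_into_tranclp2)

lemma below_antisym: "x \<preceq> y \<Longrightarrow> y \<preceq> x \<Longrightarrow> x = y"
  using acyclic by (metis rtranclpD tranclp_rtranclp_tranclp)

lemma below_strict: "x \<preceq> z \<Longrightarrow> x \<noteq> z \<Longrightarrow> \<exists>c. P c z \<and> x \<preceq> c"
  by (metis rtranclp.cases)

lemma branch_below: "br z a x \<Longrightarrow> x \<preceq> a \<and> a \<preceq> z \<and> x \<preceq> z"
  unfolding branch_def by (auto intro: rtranclp.rtrancl_into_rtrancl)

lemma branch_ex: "x \<preceq> z \<Longrightarrow> \<exists>a. br z a x"
  unfolding branch_def using below_strict by blast

lemma branch_self: "br z z x \<longleftrightarrow> x = z"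
  unfolding branch_def using parent_not_below by blast

lemma branch_child: "P a z \<Longrightarrow> br z a x \<longleftrightarrow> x \<preceq> a"
  unfolding branch_def using parent_not_below by blast

lemma branch_cases [consumes 1]: "br z a x \<Longrightarrow> (a = z \<Longrightarrow> x = z \<Longrightarrow> Q) \<Longrightarrow> (a \<noteq> z \<Longrightarrow> P a z \<Longrightarrow> x \<preceq> a \<Longrightarrow> Q) \<Longrightarrow> Q"
  unfolding branch_def using parent_not_below by blast

lemma branch_unique: assumes "br z a x" "br z b x" shows "a = b"
proof -
  have *: "a = b" if "P a z" "P b z" "a \<preceq> b" for a b
    using below_step[OF that(3,1)] parent_not_below[OF that(2)] by blast
  consider "a = z" "x = z" | "P a z" "x \<preceq> a" using assms(1) unfolding branch_def by blast
  then show ?thesis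
  proof cases
    case 1
    then show ?thesis using assms(2) parent_not_below unfolding branch_def by blast
  next
    case 2
    then show ?thesis
      using assms(2) * below_comparable[of x a b] parent_not_below unfolding branch_def by blast
  qed
qed

text \<open>The way up from \<open>x\<close> to \<open>z\<close> meets \<open>c\<close> no later
  than \<open>a\<close>, so the whole subtree below \<open>c\<close> sits in one branch at
  \<open>z\<close>.\<close>

lemma branch_above: "br z a x \<Longrightarrow> x \<preceq> c \<Longrightarrow> y \<preceq> c \<Longrightarrow> \<not> z \<preceq> c \<Longrightarrow> br z a y"
proof (elim branch_cases)
  assume "P a z" "x \<preceq> a" "x \<preceq> c" "y \<preceq> c" "\<not> z \<preceq> c"
  then have "c \<preceq> a" using below_comparable[of x a c] below_step[of a c z] by auto
  then show "br z a y" unfolding branch_def using \<open>P a z\<close> \<open>y \<preceq> c\<close> by (auto intro: rtranclp_trans)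
qed auto

text \<open>The vertex at which \<open>w\<close> is compared with \<open>x\<close> lies above
  \<open>w\<close>, hence not below \<open>c\<close>; there \<open>x\<close> and \<open>y\<close>
  are in the same branch. So descendant sets are intervals.\<close>

lemma convex_below:
  assumes "x \<preceq> c" "y \<preceq> c" "\<not> w \<preceq> c"
  shows "prec x w \<Longrightarrow> prec y w" "prec w x \<Longrightarrow> prec w y"
proof -
  have *: "br z a y" if "br z a x" "br z b w" for z a b
  proof (rule branch_above[OF that(1) assms(1,2)])
    show "\<not> z \<preceq> c" using branch_below[OF that(2)] assms(3) by (meson rtranclp_trans)
  qed
  show "prec x w \<Longrightarrow> prec y w" "prec w x \<Longrightarrow> prec w y"
    unfolding tree_prec_def using * by blast+
qed

lemma key_inj: "br z a x \<Longrightarrow> br z b y \<Longrightarrow> ky z a = ky z b \<Longrightarrow> a = b"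
proof -
  assume "br z a x" "br z b y" and k: "ky z a = ky z b"
  then have ab: "a = z \<or> P a z" "b = z \<or> P b z" unfolding branch_def by auto
  have "\<bar>arctan (lab a)\<bar> < 2" "\<bar>arctan (lab b)\<bar> < 2"
    using arctan_ubound[of "lab a"] arctan_lbound[of "lab a"] arctan_ubound[of "lab b"]
      arctan_lbound[of "lab b"] pi_less_4 by auto
  then show ?thesis
    using k ab core_child_unique[of a b z] inj_lab
    by (auto simp: key_def arctan_eq_iff inj_eq split: if_splits)
qed

lemma core_key: "br z a x \<Longrightarrow> br z b y \<Longrightarrow> ky z a < ky z b \<Longrightarrow> b \<noteq> z \<Longrightarrow> \<not> core b"
proof 
  assume "ky z a < ky z b" "b \<noteq> z" "core b"
  moreover have "\<bar>arctan (lab a)\<bar> < 2"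
    using arctan_ubound[of "lab a"] arctan_lbound[of "lab a"] pi_less_4 by auto
  ultimately show False by (auto simp: key_def split: if_splits)
qed

lemma key_child:
  assumes "P c z"
  shows "ky z c < ky z z \<longleftrightarrow> core c \<or> \<not> \<tau> z" "ky z z < ky z c \<longleftrightarrow> \<not> core c \<and> \<tau> z"
proof -
  have "c \<noteq> z" using assms parent_not_below by blast
  moreover have "\<bar>arctan (lab c)\<bar> < 2"
    using arctan_ubound[of "lab c"] arctan_lbound[of "lab c"] pi_less_4 by auto
  ultimately show "ky z c < ky z z \<longleftrightarrow> core c \<or> \<not> \<tau> z" "ky z z < ky z c \<longleftrightarrow> \<not> core c \<and> \<tau> z"
    by (auto simp: key_def)
qed

lemma precI: "br z a x \<Longrightarrow> br z b y \<Longrightarrow> ky z a < ky z b \<Longrightarrow> prec x y"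
  unfolding tree_prec_def by blast

lemma precE:
  assumes "prec x y"
  obtains z a b where "br z a x" "br z b y" "ky z a < ky z b"
  using assms unfolding tree_prec_def by blast

lemma prec_child:
  assumes "P c z" "x \<preceq> c"
  shows "core c \<or> \<not> \<tau> z \<Longrightarrow> prec x z" "\<not> core c \<Longrightarrow> \<tau> z \<Longrightarrow> prec z x"
proof -
  have b: "br z c x" "br z z z"
    using assms by (simp_all add: branch_child branch_self)
  show "core c \<or> \<not> \<tau> z \<Longrightarrow> prec x z" "\<not> core c \<Longrightarrow> \<tau> z \<Longrightarrow> prec z x"
    using precI[OF b] precI[OF b(2,1)] key_child[OF assms(1)] by blast+
qed

lemma prec_irrefl: "\<not> prec x x"
  unfolding tree_prec_def using branch_unique by (metis less_irrefl)

text \<open>Climb from \<open>x\<close> towards a common ancestor and stop at the first vertex that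
  also lies above \<open>y\<close>.\<close>

lemma meet_ex: 
  assumes "x \<noteq> y" shows "\<exists>z a b. br z a x \<and> br z b y \<and> a \<noteq> b"
proof -
  obtain w where "x \<preceq> w" "y \<preceq> w" using common_ancestor[of x y] by (elim exE conjE)
  then show ?thesis
  proof (induction rule: rtranclp_induct)
    case base
    obtain a where a: "br x a y" using branch_ex[OF base] by blast
    then have "a \<noteq> x" using assms branch_self[of x y] by auto
    moreover have "br x x x" by (simp add: branch_self)
    ultimately show ?case using a by metis
  next
    case (step v w)
    show ?case
    proof (cases "y \<preceq> v")
      case True
      then show ?thesis using step.IH by blast
    next
      case False
      obtain b where "br w b y" using branch_ex step.prems by blast
      moreover have "br w v x" using step.hyps by (simp add: branch_child)
      moreover have "v \<noteq> b" using False branch_below[OF calculation(1)] by blast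
      ultimately show ?thesis by blast
    qed
  qed
qed

lemma prec_total: "x \<noteq> y \<Longrightarrow> prec x y \<or> prec y x"
proof -
  assume "x \<noteq> y"
  then obtain z a b where z: "br z a x" "br z b y" "a \<noteq> b" using meet_ex by blast
  then have "ky z a < ky z b \<or> ky z b < ky z a" using key_inj[OF z(1,2)] by linarith
  then show ?thesis unfolding tree_prec_def using z by blast
qed

text \<open>Both comparison vertices lie above \<open>y\<close>, so one lies above the other. If
  they differ, everything compared at the lower one is in a single branch of the upper one, which
  therefore decides.\<close>

lemma prec_trans: assumes "prec x y" "prec y w" shows "prec x w"
proof -
  obtain z a b where 1: "br z a x" "br z b y" "ky z a < ky z b"
    using assms(1) by (rule precE)
  obtain z' b' c where 2: "br z' b' y" "br z' c w" "ky z' b' < ky z' c"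
    using assms(2) by (rule precE)
  have y: "y \<preceq> z" "y \<preceq> z'" "x \<preceq> z" "w \<preceq> z'"
    using 1(1,2)[THEN branch_below] 2(1,2)[THEN branch_below] by simp_all
  consider "z = z'" | "z \<noteq> z'" "z \<preceq> z'" | "z \<noteq> z'" "z' \<preceq> z" using below_comparable[OF y(1,2)] by blast
  then show ?thesis
  proof cases
    case eq: 1
    then have "br z b' y" "br z c w" "ky z b' < ky z c" using 2 by simp_all
    moreover have "b = b'" using branch_unique[OF 1(2)] calculation(1) .
    ultimately have "ky z a < ky z c" using 1(3) by simp
    then show ?thesis using precI[OF 1(1)] \<open>br z c w\<close> by simp
  next
    case c: 2
    then have "\<not> z' \<preceq> z" using below_antisym by blast
    then have "br z' b' x" by (rule branch_above[OF 2(1) y(1,3)])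
    then show ?thesis using 2(2,3) by (rule precI)
  next
    case 3
    then have "\<not> z \<preceq> z'" using below_antisym by blast
    then have "br z b w" by (rule branch_above[OF 1(2) y(2,4)])
    with 1(1) show ?thesis using 1(3) by (rule precI)
  qed
qed

section \<open>First and last elements of descendant lists, and the distance bound\<close>

text \<open>If \<tau> fails at \<open>a\<close>, then \<open>a\<close> closes its list. Otherwise
  alternation makes every child of \<open>a\<close> close its own list, so that the last element is
  \<open>a\<close> or one of these children.\<close>

lemma max_below:
  assumes "x \<preceq> a" "\<And>w. w \<preceq> a \<Longrightarrow> \<not> prec x w"
  shows "x = a \<or> P x a \<and> \<tau> a"
proof (cases "x = a")
  case False
  then obtain c where c: "P c a" "x \<preceq> c" using assms(1) below_strict by blast
  have \<tau>: "\<tau> a" "\<not> \<tau> c" using prec_child(1)[OF c] assms(2) alternate c by blast+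
  have "x = c"
  proof (rule ccontr)
    assume "x \<noteq> c"
    then obtain d where "P d c" "x \<preceq> d" using c below_strict by blast
    then have "prec x c" using prec_child(1) \<tau> by blast
    then show False using assms(2) c by blast
  qed
  then show ?thesis using c \<tau> by simp
qed simp

text \<open>The mirror image. The core is excluded since a core child comes first, so that the list
  below a core vertex has no first element.\<close>

lemma min_below:
  assumes "\<not> core b" "y \<preceq> b" "\<And>w. w \<preceq> b \<Longrightarrow> \<not> prec w y"
  shows "y = b \<or> P y b \<and> \<not> \<tau> b"
proof (cases "y = b")
  case False
  then obtain c where c: "P c b" "y \<preceq> c" using assms(2) below_strict by blast
  have nc: "\<not> core c" using assms(1) core_parent c by blast
  have \<tau>: "\<not> \<tau> b" "\<tau> c" using prec_child(2)[OF c nc] assms(3) alternate c by blast+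
  have "y = c"
  proof (rule ccontr)
    assume "y \<noteq> c"
    then obtain d where "P d c" "y \<preceq> d" using c below_strict by blast
    then have "prec c y" using prec_child(2) \<tau> nc core_parent by blast
    then show False using assms(3) c by blast
  qed
  then show ?thesis using c \<tau> by simp
qed simp

text \<open>The branch roots \<open>a\<close> and \<open>b\<close> are at distance at most two,
  through \<open>z\<close>. Each of \<open>x\<close> and \<open>y\<close> may be one step further
  out, which would allow four. But for children \<open>a\<close> and \<open>b\<close> of
  \<open>z\<close>, \<open>x \<noteq> a\<close> needs \<tau> at \<open>a\<close> and
  \<open>y \<noteq> b\<close> needs its negation at \<open>b\<close>, while siblings have the same
  colour.\<close>

lemma consecutive_dist:
  assumes sub: "\<And>x y. P x y \<Longrightarrow> T x y \<and> T y x" and "consecutive prec x y"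
  shows "\<exists>n\<le>3. (T ^^ n) x y"
proof -
  have "prec x y" and no: "\<And>w. prec x w \<Longrightarrow> \<not> prec w y"
    using assms(2) unfolding consecutive_def by blast+
  from \<open>prec x y\<close> obtain z a b where 1: "br z a x" "br z b y" "ky z a < ky z b"
    by (rule precE)
  have no1: "\<not> prec x w" if "br z a w" for w
    using precI[OF that 1(2,3)] no by blast
  have no2: "\<not> prec w y" if "br z b w" for w
    using precI[OF 1(1) that 1(3)] no by blast
  have x: "P a z \<and> (x = a \<or> P x a \<and> \<tau> a)" if "a \<noteq> z"
    using 1(1)
  proof (cases rule: branch_cases)
    case 2
    then show ?thesis using max_below[of x a] no1 by (auto simp: branch_child)
  qed (use that in auto)
  have y: "P b z \<and> (y = b \<or> P y b \<and> \<not> \<tau> b)" if "b \<noteq> z"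
    using 1(2)
  proof (cases rule: branch_cases)
    case 2
    moreover have "\<not> core b" using core_key[OF 1 that] .
    ultimately show ?thesis using min_below[of b y] no2 by (auto simp: branch_child)
  qed (use that in auto)
  have xz: "x = z" if "a = z" using 1(1) that by (simp add: branch_self)
  have yz: "y = z" if "b = z" using 1(2) that by (simp add: branch_self)
  have step: "(T ^^ Suc n) u w" if "T u v" "(T ^^ n) v w" for n u v w
    using that by (rule relpowp_Suc_I2)
  have e: "(T ^^ 1) u v" if "T u v" for u v using that by (simp add: eq_OO)
  have e2: "(T ^^ 2) u w" if "T u v" "T v w" for u v w
    using step[OF that(1) e[OF that(2)]] by (simp add: numeral_2_eq_2)
  have e3: "(T ^^ 3) u w" if "T u v" "T v v'" "T v' w" for u v v' w
    using step[OF that(1) e2[OF that(2,3)]] by (simp add: numeral_3_eq_3 numeral_2_eq_2)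
  have le: "(T ^^ 1) x y \<Longrightarrow> \<exists>n\<le>3. (T ^^ n) x y" "(T ^^ 2) x y \<Longrightarrow> \<exists>n\<le>3. (T ^^ n) x y"
    "(T ^^ 3) x y \<Longrightarrow> \<exists>n\<le>3. (T ^^ n) x y"
    by (rule exI[of _ 1], simp, rule exI[of _ 2], simp, rule exI[of _ 3], simp)
  consider "a = z" "b \<noteq> z" | "a \<noteq> z" "b = z" | "a \<noteq> z" "b \<noteq> z" using 1(3) by fastforce
  then show ?thesis
  proof cases
    case 1
    then have "x = z" "P b z" "y = b \<or> P y b" using xz y by auto
    then have "(T ^^ 1) x y \<or> (T ^^ 2) x y" using sub[of b z] sub[of y b] e e2 by metis
    then show ?thesis using le by blast
  next
    case 2
    then have "y = z" "P a z" "x = a \<or> P x a" using x yz by auto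
    then have "(T ^^ 1) x y \<or> (T ^^ 2) x y" using sub[of a z] sub[of x a] e e2 by metis
    then show ?thesis using le by blast
  next
    case 3
    then have ab: "P a z" "P b z" and "x = a \<or> P x a \<and> \<tau> a" "y = b \<or> P y b \<and> \<not> \<tau> b"
      using x y by simp_all
    moreover have "\<tau> a = \<tau> b" using alternate ab by blast
    ultimately consider "x = a" "y = b" | "x = a" "P y b" | "P x a" "y = b" by blast
    then have "(T ^^ 2) x y \<or> (T ^^ 3) x y"
      using sub[OF ab(1)] sub[OF ab(2)] sub e2[of x z y] e3[of x z b y] e3[of x a z y] by cases blast+
    then show ?thesis using le by blast
  qed
qed

section \<open>The trunk of a two-ended tree and its bushes\<close>

lemma core_above: "x \<preceq> y \<Longrightarrow> core x \<Longrightarrow> core y"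
  by (induction rule: rtranclp_induct) (use core_parent in blast)+

text \<open>Here \<open>t\<close> is the trunk vertex whose bush contains \<open>x\<close>, and
  \<open>s\<close> is its neighbour on the trunk away from the root end.\<close>

lemma first_core:
  assumes "core c"
  shows "\<exists>t s. core t \<and> core s \<and> P s t \<and> x \<preceq> t \<and> \<not> x \<preceq> s"
proof -
  obtain z where "x \<preceq> z" "c \<preceq> z" using common_ancestor by blast
  then have "x \<preceq> z" "core z" using core_above assms by blast+
  then show ?thesis
  proof (induction rule: rtranclp_induct)
    case base
    then show ?case using core_child parent_not_below by blast
  next
    case (step y z)
    show ?case
    proof (cases "core y")
      case False
      obtain s where s: "core s" "P s z" using core_child step.prems by blast
      then have "\<not> x \<preceq> s"
        using False step.hyps branch_unique[of z y x s] branch_child by auto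
      then show ?thesis using s step by (meson rtranclp.rtrancl_into_rtrancl)
    qed (use step in blast)
  qed
qed

lemma prec_core_child:
  assumes "core s" "P s t" "x \<preceq> t" "\<not> x \<preceq> s" "w \<preceq> s"
  shows "prec w x"
proof -
  obtain a where a: "br t a x" using branch_ex assms by blast
  have s: "br t s w" using assms by (simp add: branch_child)
  have "a \<noteq> s" using a assms branch_below by blast
  then have "ky t a \<noteq> ky t s" using key_inj a s by blast
  moreover have "\<not> ky t a < ky t s"
    using core_key[OF a s] assms parent_not_below by blast
  ultimately have "ky t s < ky t a" by linarith
  then show ?thesis by (rule precI[OF s a])
qed

text \<open>Only finitely many trunk vertices lie between \<open>s\<close> and \<open>z\<close>, and
  each carries finitely many finite bushes.\<close>

lemma finite_bushes:
  assumes "s \<preceq> z" "core s"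
  shows "finite ({w. w \<preceq> z} - {w. w \<preceq> s})"
  using assms(1)
proof (induction rule: rtranclp_induct)
  case (step y z)
  have cy: "core y" using core_above[OF step.hyps(1) assms(2)] .
  have "{w. w \<preceq> z} - {w. w \<preceq> s} \<subseteq>
    ({w. w \<preceq> y} - {w. w \<preceq> s}) \<union> {z} \<union> (\<Union>c\<in>{c. P c z} - {y}. {w. w \<preceq> c})"
    using below_strict by blast
  moreover have "finite {w. w \<preceq> c}" if "c \<in> {c. P c z} - {y}" for c
    using that step.hyps cy core_child_unique finite_below by blast
  then have "finite (({w. w \<preceq> y} - {w. w \<preceq> s}) \<union> {z} \<union> (\<Union>c\<in>{c. P c z} - {y}. {w. w \<preceq> c}))"
    using step.IH finite_children by blast
  ultimately show ?case by (rule finite_subset)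
qed auto

text \<open>Of the parent and the grandparent of \<open>x\<close>, one follows all its descendants
  and the other, if the core is empty, precedes all of its own; with a core, everything below a
  lower trunk vertex precedes \<open>x\<close>. Intervals lie in the descendant set of a common
  ancestor, which in the two-ended case is cut off at the trunk.\<close>

lemma discrete_prec: "discrete_order prec"
proof
  fix x y :: 'a
  obtain z where z: "x \<preceq> z" "y \<preceq> z" using common_ancestor by blast
  have sub: "{w. prec x w \<and> prec w y} \<subseteq> {w. w \<preceq> z}"
    using convex_below z prec_irrefl prec_trans by blast
  obtain p where p: "P x p" using parent_ex by blast
  obtain q where q: "P p q" using parent_ex by blast
  have anc: "x \<preceq> x" "x \<preceq> p" using p by auto
  have up: "\<tau> p \<longleftrightarrow> \<not> \<tau> q" using alternate q by blast
  show "\<exists>y. prec x y"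
    using prec_child(1)[OF p anc(1)] prec_child(1)[OF q anc(2)] up by blast
  show "\<exists>y. prec y x"
  proof (cases "\<exists>c. core c")
    case True
    then show ?thesis using first_core[of _ x] prec_core_child by blast
  next
    case False
    then show ?thesis
      using prec_child(2)[OF p anc(1)] prec_child(2)[OF q anc(2)] up by blast
  qed
  show "finite {w. prec x w \<and> prec w y}"
  proof (cases "\<exists>c. core c")
    case False
    then show ?thesis using sub finite_below finite_subset by blast
  next
    case True
    then obtain t s where ts: "core t" "core s" "P s t" "x \<preceq> t" "\<not> x \<preceq> s"
      using first_core[of _ x] by blast
    have "{w. prec x w \<and> prec w y} \<inter> {w. w \<preceq> s} = {}"
      using prec_core_child[OF ts(2-5)] prec_irrefl prec_trans by blast
    moreover obtain u where u: "s \<preceq> u" "z \<preceq> u" using common_ancestor by blast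
    then have "{w. w \<preceq> z} \<subseteq> {w. w \<preceq> u}" by (auto intro: rtranclp_trans)
    ultimately have "{w. prec x w \<and> prec w y} \<subseteq> {w. w \<preceq> u} - {w. w \<preceq> s}"
      using sub by blast
    then show ?thesis using finite_bushes[OF u(1) ts(2)] finite_subset by blast
  qed
qed (use prec_irrefl prec_trans prec_total in blast)+

end

section \<open>Ends of trees\<close>

definition minus_edge :: "('a \<Rightarrow> 'a \<Rightarrow> bool) \<Rightarrow> 'a \<Rightarrow> 'a \<Rightarrow> 'a \<Rightarrow> 'a \<Rightarrow> bool" where
  "minus_edge T x y u v \<longleftrightarrow> T u v \<and> \<not> (u = x \<and> v = y) \<and> \<not> (u = y \<and> v = x)"

definition side :: "('a \<Rightarrow> 'a \<Rightarrow> bool) \<Rightarrow> 'a \<Rightarrow> 'a \<Rightarrow> 'a \<Rightarrow> bool" where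
  "side T x y z \<longleftrightarrow> (minus_edge T x y)\<^sup>*\<^sup>* x z"

definition up :: "('a \<Rightarrow> 'a \<Rightarrow> bool) \<Rightarrow> 'a \<Rightarrow> 'a \<Rightarrow> bool" where
  "up T x y \<longleftrightarrow> T x y \<and> infinite (Collect (side T y x))"

text \<open>By local finiteness an infinite component contains an end. So in a tree
  \<open>up\<close> marks the steps that lead to some end, and the core is the union of all
  bi-infinite paths: empty for one end, a single path for two.\<close>

definition core :: "('a \<Rightarrow> 'a \<Rightarrow> bool) \<Rightarrow> 'a \<Rightarrow> bool" where
  "core T x \<longleftrightarrow> (\<exists>y z. up T x y \<and> up T x z \<and> y \<noteq> z)"

definition trifurcation :: "('a \<Rightarrow> 'a \<Rightarrow> bool) \<Rightarrow> 'a \<Rightarrow> bool" where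
  "trifurcation T x \<longleftrightarrow>
    (\<exists>u v w. up T x u \<and> up T x v \<and> up T x w \<and> u \<noteq> v \<and> u \<noteq> w \<and> v \<noteq> w)"

text \<open>Acyclicity is expressed by saying that every edge is a bridge; \<open>side\<close> is
  the component of one endpoint after the edge is deleted.\<close>

locale tree =
  fixes T :: "'a \<Rightarrow> 'a \<Rightarrow> bool"
  assumes T_sym: "T x y \<Longrightarrow> T y x"
    and T_connected: "T\<^sup>*\<^sup>* x y"
    and T_bridge: "T x y \<Longrightarrow> \<not> side T x y y"
    and T_finite: "finite {y. T x y}"
    and infinite_UNIV: "infinite (UNIV :: 'a set)"
begin

lemma T_irrefl: "\<not> T x x"
  using T_bridge by (auto simp: side_def)

lemma minus_edge_commute: "minus_edge T x y = minus_edge T y x"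
  by (auto simp: minus_edge_def fun_eq_iff)

lemma side_self: "side T x y x"
  by (simp add: side_def)

lemma side_step: "side T x y u \<Longrightarrow> T u v \<Longrightarrow> \<not> (u = x \<and> v = y) \<Longrightarrow> \<not> (u = y \<and> v = x) \<Longrightarrow> side T x y v"
  unfolding side_def by (rule rtranclp.rtrancl_into_rtrancl) (auto simp: minus_edge_def)

lemma side_induct [consumes 1, case_names base step]:
  assumes "side T x y z" "Q x"
    and "\<And>u v. side T x y u \<Longrightarrow> Q u \<Longrightarrow> T u v \<Longrightarrow> \<not> (u = x \<and> v = y) \<Longrightarrow> \<not> (u = y \<and> v = x) \<Longrightarrow> Q v"
  shows "Q z"
  using assms(1) unfolding side_def
proof (induction rule: rtranclp_induct)
  case (step u v)
  then show ?case using assms(3)[of u v] by (auto simp: side_def minus_edge_def)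
qed (fact assms(2))

section \<open>Half-trees and branches at a vertex\<close>

lemma side_cover: "T x y \<Longrightarrow> side T x y z \<or> side T y x z"
  using T_connected[of x z]
proof (induction rule: rtranclp_induct)
  case base
  then show ?case by (simp add: side_self)
next
  case (step u v)
  then have "side T x y u \<or> side T y x u" by blast
  then show ?case using side_step side_self step.hyps by metis
qed

lemma side_disjoint: 
  assumes "T x y" "side T x y z" shows "\<not> side T y x z"
proof
  assume "side T y x z"
  then have "(minus_edge T x y)\<^sup>*\<^sup>* y z" by (simp add: side_def minus_edge_commute)
  moreover have "symp (minus_edge T x y)\<^sup>*\<^sup>*"
    by (rule symp_rtranclp) (auto simp: symp_def minus_edge_def dest: T_sym)
  ultimately have "(minus_edge T x y)\<^sup>*\<^sup>* z y" by (simp add: symp_def)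
  with assms(2) have "side T x y y" unfolding side_def by (rule rtranclp_trans)
  then show False using T_bridge assms(1) by blast
qed

lemma side_not: "T x y \<Longrightarrow> \<not> side T x y z \<longleftrightarrow> side T y x z"
  using side_cover side_disjoint by blast

text \<open>A walk on the side of \<open>a\<close> never meets \<open>x\<close>, so it cannot cross
  the edge between \<open>x\<close> and \<open>y\<close>.\<close>

lemma side_subset_side:
  assumes "T x y" "side T y x a" "\<not> side T a b x" "side T a b z"
  shows "side T y x z"
  using assms(4)
proof (induction rule: side_induct)
  case base
  then show ?case by (rule assms(2))
next
  case (step u v)
  have "side T a b v" using step.hyps by (rule side_step)
  then have "u \<noteq> x" "v \<noteq> x" using step(1) assms(3) by blast+
  then show ?case using step side_step by metis
qed

lemma branch_subset:
  assumes "T x y" "T x y'" "y \<noteq> y'" "side T y' x z" shows "side T x y z"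
  using assms(4)
proof (induction rule: side_induct)
  case base
  then show ?case using side_step[OF side_self[of x y] assms(2)] assms(3) T_irrefl assms(2) by metis
next
  case (step u v)
  have "side T y' x v" using step.hyps by (rule side_step)
  then have "u \<noteq> x" "v \<noteq> x"
    using step(1) side_disjoint[OF assms(2) side_self] by blast+
  then show ?case using step side_step by metis
qed

lemma branch_disjoint:
  "T x y \<Longrightarrow> T x y' \<Longrightarrow> y \<noteq> y' \<Longrightarrow> side T y' x z \<Longrightarrow> \<not> side T y x z"
  using branch_subset side_disjoint by blast

lemma side_branches:
  assumes "side T x y z"
  shows "z = x \<or> (\<exists>y'. T x y' \<and> y' \<noteq> y \<and> side T y' x z)"
  using assms
proof (induction rule: side_induct)
  case (step u v)
  from step.IH show ?case
  proof
    assume "u = x"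
    then show ?thesis using step side_self by blast
  next
    assume "\<exists>y'. T x y' \<and> y' \<noteq> y \<and> side T y' x u"
    then obtain y' where y': "T x y'" "y' \<noteq> y" "side T y' x u" by blast
    then have "u \<noteq> x" using side_disjoint[OF y'(1) side_self] by blast
    then have "v = x \<or> side T y' x v" using side_step[OF y'(3) step.hyps(2)] by blast
    then show ?thesis using y' by blast
  qed
qed simp

lemma branches: "z = x \<or> (\<exists>y. T x y \<and> side T y x z)"
  using T_connected[of x z]
proof (induction rule: rtranclp_induct)
  case (step u v)
  then show ?case using side_step side_self by metis
qed simp

section \<open>Directions that lead to an end\<close>

lemma up_T: "up T x y \<Longrightarrow> T x y"
  by (simp add: up_def)

text \<open>The finitely many branches at \<open>x\<close> cover all other vertices, so one of them
  is infinite.\<close>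

lemma up_ex: "\<exists>y. up T x y"
proof (rule ccontr)
  assume "\<nexists>y. up T x y"
  then have "finite (\<Union>y\<in>{y. T x y}. Collect (side T y x))"
    using T_finite by (auto simp: up_def)
  moreover have "UNIV \<subseteq> insert x (\<Union>y\<in>{y. T x y}. Collect (side T y x))"
    using branches by blast
  ultimately show False using infinite_UNIV by (metis finite_insert finite_subset)
qed

lemma infinite_side: "infinite (Collect (side T x y)) \<Longrightarrow> \<exists>y'. up T x y' \<and> y' \<noteq> y"
proof (rule ccontr)
  assume inf: "infinite (Collect (side T x y))" and "\<nexists>y'. up T x y' \<and> y' \<noteq> y"
  then have "finite (Collect (side T y' x))" if "T x y'" "y' \<noteq> y" for y'
    using that \<open>\<nexists>y'. up T x y' \<and> y' \<noteq> y\<close> by (auto simp: up_def)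
  moreover have "finite {y'. T x y' \<and> y' \<noteq> y}" using T_finite[of x] by simp
  ultimately have "finite (insert x (\<Union>y'\<in>{y'. T x y' \<and> y' \<noteq> y}. Collect (side T y' x)))"
    by blast
  moreover have "Collect (side T x y) \<subseteq> insert x (\<Union>y'\<in>{y'. T x y' \<and> y' \<noteq> y}. Collect (side T y' x))"
    using side_branches by blast
  ultimately show False using inf finite_subset by blast
qed

lemma up_total: "T x y \<Longrightarrow> up T x y \<or> up T y x"
proof (rule ccontr)
  assume "T x y" "\<not> (up T x y \<or> up T y x)"
  then have "finite (Collect (side T x y) \<union> Collect (side T y x))"
    using T_sym by (auto simp: up_def)
  moreover have "Collect (side T x y) \<union> Collect (side T y x) = UNIV"
    using side_cover \<open>T x y\<close> by blast
  ultimately show False using infinite_UNIV by simp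
qed

text \<open>Seen from \<open>y\<close>, the infinite branch towards \<open>z\<close> lies behind
  \<open>x\<close>.\<close>

lemma up_back: "up T x y \<Longrightarrow> up T x z \<Longrightarrow> y \<noteq> z \<Longrightarrow> up T y x"
proof -
  assume *: "up T x y" "up T x z" "y \<noteq> z"
  then have "Collect (side T z x) \<subseteq> Collect (side T x y)" using branch_subset up_T by blast
  then have "infinite (Collect (side T x y))" using *(2) infinite_super unfolding up_def by blast
  then show "up T y x" using *(1) T_sym unfolding up_def by blast
qed

lemma coreI: "up T x y \<Longrightarrow> up T x z \<Longrightarrow> y \<noteq> z \<Longrightarrow> core T x"
  unfolding core_def by blast

lemma core_edge: assumes "up T x y" "up T y x" shows "core T x"
proof -
  have "infinite (Collect (side T x y))" using assms(2) by (simp add: up_def)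
  then obtain z where "up T x z" "z \<noteq> y" using infinite_side by blast
  then show ?thesis using coreI[OF assms(1)] by blast
qed

lemma core_up_sym: assumes "core T x" "up T x y" shows "up T y x"
proof -
  obtain z where "up T x z" "y \<noteq> z" using assms(1) unfolding core_def by blast
  then show ?thesis using up_back[OF assms(2)] by blast
qed

lemma core_up_core: "core T x \<Longrightarrow> up T x y \<Longrightarrow> core T y"
  using core_up_sym core_edge by blast

text \<open>Orient the tree towards a fixed vertex: every vertex then has at most one outgoing edge.\<close>

lemma card_inner_edges:
  assumes "finite K"
  shows "card {(x, y). x \<in> K \<and> y \<in> K \<and> T x y} \<le> 2 * card K"
proof -
  fix r :: 'a
  define S where "S = {(x, y). x \<in> K \<and> y \<in> K \<and> T x y \<and> side T y x r}"
  have "S \<subseteq> K \<times> K" unfolding S_def by blast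
  then have fin: "finite S" using assms by (meson finite_SigmaI finite_subset)
  have "inj_on fst S"
  proof (rule inj_onI)
    fix e e' assume e: "e \<in> S" "e' \<in> S" "fst e = fst e'"
    obtain x y y' where xy: "e = (x, y)" "e' = (x, y')" using e(3) by (cases e, cases e') simp
    then have "T x y" "T x y'" "side T y x r" "side T y' x r" using e(1,2) by (simp_all add: S_def)
    then have "y = y'" using branch_disjoint[of x y y' r] by blast
    then show "e = e'" using xy by simp
  qed
  then have "card S \<le> card K"
    by (rule card_inj_on_le[OF _ _ assms]) (auto simp: S_def)
  moreover have "{(x, y). x \<in> K \<and> y \<in> K \<and> T x y} \<subseteq> S \<union> prod.swap ` S"
  proof clarify
    fix x y assume "x \<in> K" "y \<in> K" "T x y" and no: "(x, y) \<notin> prod.swap ` S"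
    moreover have "(y, x) \<notin> S" using no by (metis imageI swap_simp)
    ultimately have "\<not> side T x y r" by (simp add: S_def T_sym)
    then show "(x, y) \<in> S"
      using side_cover[of x y r] \<open>x \<in> K\<close> \<open>y \<in> K\<close> \<open>T x y\<close> by (simp add: S_def)
  qed
  then have "card {(x, y). x \<in> K \<and> y \<in> K \<and> T x y} \<le> card (S \<union> prod.swap ` S)"
    using fin by (intro card_mono) auto
  moreover have "card (S \<union> prod.swap ` S) \<le> card S + card S"
    using card_Un_le[of S "prod.swap ` S"] card_image_le[OF fin, of prod.swap] by linarith
  ultimately show ?thesis by linarith
qed

text \<open>The edges of the core form a forest of minimum degree two, so the excess of its degrees over
  two on a finite set is at most the number of edges leaving that set.\<close>

lemma card_trifurcation_le:
  assumes "finite K"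
  shows "card {x \<in> K. trifurcation T x} \<le> card {(x, y). x \<in> K \<and> y \<notin> K \<and> T x y}"
proof -
  define C where "C = {x \<in> K. core T x}"
  define I where "I = {(x, y). x \<in> C \<and> y \<in> C \<and> T x y}"
  define X where "X = {(x, y). x \<in> K \<and> y \<notin> K \<and> T x y}"
  have finC: "finite C" using assms by (simp add: C_def)
  have fin_up: "finite {y. up T x y}" for x
    by (rule finite_subset[OF _ T_finite[of x]]) (auto simp: up_def)
  have "I \<subseteq> C \<times> C" unfolding I_def by blast
  then have finI: "finite I" using finC by (meson finite_SigmaI finite_subset)
  have "X \<subseteq> Sigma K (\<lambda>x. {y. T x y})" unfolding X_def by blast
  then have finX: "finite X" using assms T_finite by (meson finite_SigmaI finite_subset)
  have deg: "2 + (if trifurcation T x then 1 else 0) \<le> card {y. up T x y}" if "x \<in> C" for x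
  proof (cases "trifurcation T x")
    case True
    then obtain u v w where "{u, v, w} \<subseteq> {y. up T x y}" "u \<noteq> v" "u \<noteq> w" "v \<noteq> w"
      unfolding trifurcation_def by blast
    then show ?thesis using card_mono[OF fin_up[of x], of "{u, v, w}"] True by simp
  next
    case False
    obtain u v where "{u, v} \<subseteq> {y. up T x y}" "u \<noteq> v"
      using \<open>x \<in> C\<close> unfolding C_def core_def by blast
    then show ?thesis using card_mono[OF fin_up[of x], of "{u, v}"] False by simp
  qed
  have tri_core: "trifurcation T x \<Longrightarrow> core T x" for x
    unfolding trifurcation_def core_def by blast
  have "2 * card C + card {x \<in> K. trifurcation T x} = (\<Sum>x\<in>C. 2 + (if trifurcation T x then 1 else 0))"
  proof -
    have "{x \<in> C. trifurcation T x} = {x \<in> K. trifurcation T x}" using tri_core by (auto simp: C_def)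
    moreover have "(\<Sum>x\<in>C. if trifurcation T x then 1 else 0 :: nat) = card {x \<in> C. trifurcation T x}"
      using sum.inter_filter[OF finC, of "\<lambda>_. 1 :: nat"] by simp
    ultimately show ?thesis by (subst sum.distrib) simp
  qed
  also have "\<dots> \<le> (\<Sum>x\<in>C. card {y. up T x y})" by (rule sum_mono) (rule deg)
  also have "\<dots> = card (Sigma C (\<lambda>x. {y. up T x y}))" using finC fin_up by (simp add: card_SigmaI)
  also have "\<dots> \<le> card (I \<union> X)"
  proof (rule card_mono)
    \<comment> \<open>The core is closed under \<open>up\<close>, so an \<open>up\<close> edge from
      \<open>C\<close> either stays in \<open>C\<close> or leaves \<open>K\<close>.\<close>
    show "Sigma C (\<lambda>x. {y. up T x y}) \<subseteq> I \<union> X"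
      using core_up_core up_T by (auto simp: I_def X_def C_def)
  qed (use finI finX in simp)
  also have "\<dots> \<le> 2 * card C + card X"
    using card_Un_le[of I X] card_inner_edges[OF finC] by (simp add: I_def)
  finally show ?thesis by (simp add: X_def)
qed

end

text \<open>A reference edge \<open>(a, b)\<close> selects one of the two directions of a two-ended core; \<open>coherent\<close> tells
  whether the step from \<open>x\<close> to a core neighbour \<open>y\<close> points the same way as the step from \<open>a\<close> to \<open>b\<close>. Its
  end \<open>a\<close> also selects a colour class. The signs \<open>\<beta>\<close> and \<open>\<gamma>\<close> reverse these choices.\<close>

definition coherent :: "('a \<Rightarrow> 'a \<Rightarrow> bool) \<Rightarrow> 'a \<Rightarrow> 'a \<Rightarrow> 'a \<Rightarrow> 'a \<Rightarrow> bool" where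
  "coherent T a b x y \<longleftrightarrow> (if side T b a x then \<not> side T y x a else side T y x b)"

definition parent :: "('a \<Rightarrow> 'a \<Rightarrow> bool) \<Rightarrow> 'a \<Rightarrow> 'a \<Rightarrow> bool \<Rightarrow> 'a \<Rightarrow> 'a \<Rightarrow> bool" where
  "parent T a b \<beta> x y \<longleftrightarrow> up T x y \<and> (core T x \<longrightarrow> (coherent T a b x y \<longleftrightarrow> \<beta>))"

text \<open>Parity of walks from \<open>a\<close> singles out a class of the bipartition without an
  arbitrary choice, which keeps the definition equivariant and measurable.\<close>

definition colour :: "('a \<Rightarrow> 'a \<Rightarrow> bool) \<Rightarrow> 'a \<Rightarrow> bool \<Rightarrow> 'a \<Rightarrow> bool" where
  "colour T a \<gamma> x \<longleftrightarrow> ((\<exists>n. (T ^^ (2 * n)) a x) \<longleftrightarrow> \<gamma>)"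

text \<open>If there is a trunk, only one of its own edges can orient it, so both directions of the
  edge must lead to an end. Without a trunk the edge merely fixes a colour.\<close>

definition reference_edge :: "('a \<Rightarrow> 'a \<Rightarrow> bool) \<Rightarrow> 'a \<Rightarrow> 'a \<Rightarrow> bool" where
  "reference_edge T a b \<longleftrightarrow> T a b \<and> ((\<exists>x. core T x) \<longrightarrow> up T a b \<and> up T b a)"

definition ray ::
    "('a \<Rightarrow> 'a \<Rightarrow> bool) \<Rightarrow> ('a \<Rightarrow> real) \<Rightarrow> 'a \<Rightarrow> 'a \<Rightarrow> bool \<Rightarrow> bool \<Rightarrow> 'a \<Rightarrow> 'a \<Rightarrow> bool" where
  "ray T lab a b \<beta> \<gamma> =
    linked (tree_prec (parent T a b \<beta>) (core T) (colour T a \<gamma>) lab)"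

locale at_most_two_ended_tree = tree T for T :: "'a \<Rightarrow> 'a \<Rightarrow> bool" +
  assumes no_trifurcation: "\<not> trifurcation T x"
begin

section \<open>Orientation and bipartition determined by a reference edge\<close>

lemma reference_ex: "\<exists>a b. reference_edge T a b"
proof (cases "\<exists>x. core T x")
  case True
  then show ?thesis unfolding reference_edge_def by (metis core_up_sym up_ex up_T)
next
  case False
  then show ?thesis unfolding reference_edge_def by (metis up_ex up_T)
qed

lemma core_two:
  assumes "core T x"
  obtains y z where "y \<noteq> z" "\<And>w. up T x w \<longleftrightarrow> w = y \<or> w = z"
proof -
  obtain y z where "up T x y" "up T x z" "y \<noteq> z" using assms unfolding core_def by blast
  then show ?thesis using that[of y z] no_trifurcation[of x] unfolding trifurcation_def by blast
qed

lemma noncore_up_unique: "\<not> core T x \<Longrightarrow> up T x y \<Longrightarrow> up T x z \<Longrightarrow> y = z"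
  unfolding core_def by blast

context
  fixes a b :: 'a
  assumes ref: "reference_edge T a b"
begin

text \<open>On the side of \<open>b\<close> a coherent step leads away from \<open>a\<close>; on the
  side of \<open>a\<close> it leads towards \<open>b\<close>. If both ends of a step are on one
  side, reversal exchanges towards and away; the reference edge itself is checked
  separately.\<close>

lemma coherent_antisym:
  assumes "core T x" "up T x y"
  shows "coherent T a b y x \<longleftrightarrow> \<not> coherent T a b x y"
proof -
  have ab: "T a b" "T b a" using ref T_sym by (auto simp: reference_edge_def)
  have xy: "T x y" "T y x" using assms up_T T_sym by blast+
  consider "x = a" "y = b" | "x = b" "y = a" | "side T b a x \<longleftrightarrow> side T b a y"
    using side_step xy side_not[OF ab(1)] by metis
  then show ?thesis
  proof cases
    case 1
    then show ?thesis using side_self side_not ab unfolding coherent_def by metis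
  next
    case 2
    then show ?thesis using side_self side_not ab unfolding coherent_def by metis
  next
    case 3
    then show ?thesis using side_not[OF xy(1)] unfolding coherent_def by auto
  qed
qed

text \<open>The branch at \<open>x\<close> that contains \<open>c\<close> contains the whole
  infinite side of \<open>c\<close>, hence leads to an end; without trifurcations it is the one at
  \<open>y\<close> or at \<open>z\<close>.\<close>

lemma one_towards:
  assumes "core T x" "up T x y" "up T x z" "y \<noteq> z" "T c d" "infinite (Collect (side T c d))" "\<not> side T c d x"
  shows "side T y x c \<longleftrightarrow> \<not> side T z x c"
proof -
  have "x \<noteq> c" using assms(7) side_self by blast
  then obtain w where w: "T x w" "side T w x c" using branches by metis
  have "Collect (side T c d) \<subseteq> Collect (side T w x)"
    using side_subset_side[OF w assms(7)] by blast
  then have "up T x w" using assms(6) w finite_subset unfolding up_def by blast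
  then have "w = y \<or> w = z"
    using assms(2-4) no_trifurcation[of x] unfolding trifurcation_def by blast
  then show ?thesis using w branch_disjoint assms up_T by metis
qed

lemma coherent_one:
  assumes "core T x" "up T x y" "up T x z" "y \<noteq> z"
  shows "coherent T a b x z \<longleftrightarrow> \<not> coherent T a b x y"
proof -
  have ab: "T a b" "T b a" "up T a b" "up T b a"
    using ref T_sym assms by (auto simp: reference_edge_def)
  show ?thesis
  proof (cases "side T b a x")
    case True
    then have "side T y x a \<longleftrightarrow> \<not> side T z x a"
      using one_towards[OF assms ab(1)] ab side_not by (metis up_def)
    then show ?thesis using True unfolding coherent_def by auto
  next
    case False
    then have "side T y x b \<longleftrightarrow> \<not> side T z x b"
      using one_towards[OF assms ab(2)] ab by (metis up_def)
    then show ?thesis using False unfolding coherent_def by auto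
  qed
qed

context
  fixes \<beta> :: bool
begin

abbreviation "P \<equiv> parent T a b \<beta>"

lemma parent_ex1: "\<exists>!y. P x y"
proof (cases "core T x")
  case True
  then obtain y z where yz: "y \<noteq> z" "\<And>w. up T x w \<longleftrightarrow> w = y \<or> w = z" by (rule core_two) blast
  then have "coherent T a b x z \<longleftrightarrow> \<not> coherent T a b x y"
    using coherent_one[OF True] by blast
  then show ?thesis unfolding parent_def using yz True by metis
next
  case False
  then show ?thesis unfolding parent_def using up_ex noncore_up_unique by metis
qed

lemma parent_T: "P x y \<Longrightarrow> T x y"
  by (simp add: parent_def up_def)

lemma parent_antisym: "P x y \<Longrightarrow> \<not> P y x"
  using coherent_antisym core_up_core core_edge unfolding parent_def by metis

lemma parent_total: "T x y \<Longrightarrow> P x y \<or> P y x"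
proof -
  have *: "P x y \<or> P y x" if "up T x y" for x y
    using that coherent_antisym[OF _ that] core_up_sym core_up_core unfolding parent_def by metis
  assume "T x y"
  then show ?thesis using up_total * by blast
qed

text \<open>A path of descendants never uses the edge from \<open>x\<close> to its parent. This
  yields both acyclicity and the finiteness of descendant sets off the core.\<close>

lemma below_side: "P\<^sup>*\<^sup>* w x \<Longrightarrow> P x y \<Longrightarrow> side T x y w"
proof (induction rule: converse_rtranclp_induct)
  case base
  show ?case by (rule side_self)
next
  case (step w z)
  then have "side T x y z" "T z w" using parent_T T_sym by blast+
  moreover have "\<not> (z = x \<and> w = y)" using step parent_antisym by blast
  moreover have "\<not> (z = y \<and> w = x)"
    using calculation(1) T_bridge step.prems parent_T by blast
  ultimately show ?case by (rule side_step)
qed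

lemma no_parent_cycle: "\<not> P\<^sup>+\<^sup>+ x x"
proof
  assume "P\<^sup>+\<^sup>+ x x"
  then obtain y where "P x y" "P\<^sup>*\<^sup>* y x" by (metis tranclpD)
  then show False using below_side T_bridge parent_T by metis
qed

lemma parent_common_ancestor: "\<exists>z. P\<^sup>*\<^sup>* x z \<and> P\<^sup>*\<^sup>* y z"
  using T_connected[of x y]
proof (induction rule: rtranclp_induct)
  case (step u v)
  then obtain z where z: "P\<^sup>*\<^sup>* x z" "P\<^sup>*\<^sup>* u z" by blast
  from parent_total[OF step.hyps(2)] show ?case
  proof
    assume uv: "P u v"
    from z(2) show ?thesis
    proof (cases rule: converse_rtranclpE)
      case base
      then show ?thesis using z uv by (metis rtranclp.simps)
    next
      case (step w)
      then have "w = v" using uv parent_ex1 by blast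
      then show ?thesis using z step by blast
    qed
  next
    assume "P v u"
    then show ?thesis using z by (metis converse_rtranclp_into_rtranclp)
  qed
qed blast

lemma noncore_side_finite: "\<not> core T x \<Longrightarrow> P x y \<Longrightarrow> finite (Collect (side T x y))"
  using infinite_side[of x y] unfolding parent_def core_def by blast

text \<open>Follow parents from \<open>x\<close> and from a root \<open>r\<close> until they meet;
  the parity of the total number of steps is the colour. It does not depend on the meeting point
  because the parent map has no cycle.\<close>

lemma bipartition_ex: "\<exists>c :: 'a \<Rightarrow> bool. \<forall>x y. T x y \<longrightarrow> c x = (\<not> c y)"
proof -
  fix r :: 'a
  define f where "f x = (THE y. P x y)" for x
  have f: "P x y \<longleftrightarrow> y = f x" for x y
    unfolding f_def using parent_ex1[of x] by (metis theI')
  have pow: "(P ^^ n) x y \<longleftrightarrow> y = (f ^^ n) x" for n x y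
    by (induction n arbitrary: y) (auto simp: OO_def f)
  have inj: "m = n" if "(f ^^ m) x = (f ^^ n) x" for m n x
  proof -
    have *: "\<not> m < n" if "(f ^^ m) x = (f ^^ n) x" for m n
    proof
      assume "m < n"
      then have "(f ^^ (n - m)) ((f ^^ m) x) = (f ^^ m) x"
        using that by (metis comp_apply funpow_add le_add_diff_inverse2 less_imp_le)
      then have "(P ^^ (n - m)) ((f ^^ m) x) ((f ^^ m) x)" by (simp add: pow)
      then have "P\<^sup>+\<^sup>+ ((f ^^ m) x) ((f ^^ m) x)"
        using \<open>m < n\<close> by (metis tranclp_power zero_less_diff)
      then show False using no_parent_cycle by blast
    qed
    show ?thesis using *[OF that] *[OF that[symmetric]] by simp
  qed
  define c where "c x = (\<exists>m n. even (m + n) \<and> (f ^^ m) x = (f ^^ n) r)" for x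
  have c: "c x \<longleftrightarrow> even (m + n)" if "(f ^^ m) x = (f ^^ n) r" for m n x
  proof
    assume "c x"
    then obtain m' n' where mn: "even (m' + n')" "(f ^^ m') x = (f ^^ n') r" unfolding c_def by blast
    have "(f ^^ (n + m')) x = (f ^^ n) ((f ^^ m') x)" by (simp add: funpow_add)
    also have "\<dots> = (f ^^ n') ((f ^^ n) r)"
      unfolding mn by (metis add.commute comp_apply funpow_add)
    also have "\<dots> = (f ^^ (n' + m)) x" unfolding that[symmetric] by (simp add: funpow_add)
    finally have "n + m' = n' + m" by (rule inj)
    then show "even (m + n)" using mn(1) by presburger
  qed (use that in \<open>auto simp: c_def\<close>)
  have "c x = (\<not> c y)" if "P x y" for x y
  proof -
    obtain z where "P\<^sup>*\<^sup>* y z" "P\<^sup>*\<^sup>* r z" using parent_common_ancestor by blast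
    then obtain m n where mn: "(f ^^ m) y = (f ^^ n) r" by (metis pow rtranclp_power)
    then have "(f ^^ Suc m) x = (f ^^ n) r" using that f by (simp add: funpow_swap1)
    then show ?thesis using c[OF mn] c[of "Suc m" x n] by simp
  qed
  then show ?thesis using parent_total by (intro exI[of _ c]) blast
qed

end

lemma bipartition_unique:
  fixes c d :: "'a \<Rightarrow> bool"
  assumes "\<And>x y. T x y \<Longrightarrow> c x = (\<not> c y)" "\<And>x y. T x y \<Longrightarrow> d x = (\<not> d y)"
  shows "(c x = d x) = (c y = d y)"
  using T_connected[of x y] by (induction rule: rtranclp_induct) (use assms in blast)+

lemma colour_alternates:
  assumes "T x y" shows "colour T r \<gamma> x = (\<not> colour T r \<gamma> y)"
proof -
  obtain c :: "'a \<Rightarrow> bool" where c: "\<And>x y. T x y \<Longrightarrow> c x = (\<not> c y)"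
    using bipartition_ex by blast
  have walk: "(c x = c r) = even n" if "(T ^^ n) r x" for n x
    using that by (induction n arbitrary: x) (use c in auto)
  have "(\<exists>n. (T ^^ (2 * n)) r x) \<longleftrightarrow> c x = c r" for x
  proof
    assume "c x = c r"
    moreover obtain n where "(T ^^ n) r x" using T_connected by (metis rtranclp_power)
    ultimately show "\<exists>n. (T ^^ (2 * n)) r x" using walk by (metis evenE)
  next
    assume "\<exists>n. (T ^^ (2 * n)) r x"
    then obtain n where "(T ^^ (2 * n)) r x" by blast
    then show "c x = c r" using walk by fastforce
  qed
  then show ?thesis using c[OF assms] unfolding colour_def by auto
qed

end

context
  fixes lab :: "'a \<Rightarrow> real"
  assumes inj_lab: "inj lab"
begin

lemma end_rooted:
  assumes ref: "reference_edge T a b"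
  shows "end_rooted_tree (parent T a b \<beta>) (core T) (colour T a \<gamma>) lab"
proof
  let ?P = "parent T a b \<beta>"
  note ex1 = parent_ex1[OF ref, of \<beta>]
  fix x y z
  show "\<exists>y. ?P x y" using ex1 by blast
  show "?P x y \<Longrightarrow> ?P x z \<Longrightarrow> y = z" using ex1 by blast
  show "\<not> ?P\<^sup>+\<^sup>+ x x" by (rule no_parent_cycle[OF ref])
  show "\<exists>z. ?P\<^sup>*\<^sup>* x z \<and> ?P\<^sup>*\<^sup>* y z" by (rule parent_common_ancestor[OF ref])
  show "finite {x. ?P x y}"
    by (rule finite_subset[OF _ T_finite[of y]]) (use parent_T[OF ref] T_sym in blast)
  show "core T x \<Longrightarrow> ?P x y \<Longrightarrow> core T y"
    using core_up_core unfolding parent_def by blast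
  show "core T x \<Longrightarrow> \<exists>y. core T y \<and> ?P y x"
  proof -
    assume x: "core T x"
    then obtain y z where yz: "y \<noteq> z" "\<And>w. up T x w \<longleftrightarrow> w = y \<or> w = z" by (rule core_two) blast
    \<comment> \<open>A core vertex has two \<open>up\<close> neighbours and one parent among them;
      the other is its core child.\<close>
    then obtain w where w: "up T x w" "\<not> ?P x w" using ex1[of x] by metis
    then have "core T w" "?P w x" using parent_total[OF ref] up_T core_up_core x by blast+
    then show ?thesis by blast
  qed
  show "core T y \<Longrightarrow> core T z \<Longrightarrow> ?P y x \<Longrightarrow> ?P z x \<Longrightarrow> y = z"
  proof (rule ccontr)
    assume "core T y" "core T z" and P: "?P y x" "?P z x" and "y \<noteq> z"
    then have x: "core T x" "up T x y" "up T x z"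
      using core_up_core core_up_sym unfolding parent_def by blast+
    obtain w where w: "?P x w" using ex1 by blast
    then have "w = y \<or> w = z"
      using x \<open>y \<noteq> z\<close> no_trifurcation[of x] unfolding trifurcation_def parent_def by blast
    then show False using w P parent_antisym[OF ref] by blast
  qed
  show "\<not> core T x \<Longrightarrow> finite {y. ?P\<^sup>*\<^sup>* y x}"
  proof -
    assume x: "\<not> core T x"
    obtain w where w: "?P x w" using ex1 by blast
    have "{y. ?P\<^sup>*\<^sup>* y x} \<subseteq> Collect (side T x w)" using below_side[OF ref _ w] by blast
    then show ?thesis using noncore_side_finite[OF ref x w] finite_subset by blast
  qed
  show "?P x y \<Longrightarrow> colour T a \<gamma> x \<longleftrightarrow> \<not> colour T a \<gamma> y"
    using colour_alternates[OF ref] parent_T[OF ref] by blast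
qed (rule inj_lab)

lemma ray_double_ray:
  assumes ref: "reference_edge T a b"
  shows "(ray T lab a b \<beta> \<gamma>)\<^sup>*\<^sup>* x y" "card {y. ray T lab a b \<beta> \<gamma> x y} = 2"
    and "ray T lab a b \<beta> \<gamma> x y \<Longrightarrow> \<exists>n\<le>3. (T ^^ n) x y"
    and "ray T lab a b \<beta> \<gamma> x y \<Longrightarrow> ray T lab a b \<beta> \<gamma> y x"
    and "\<not> ray T lab a b \<beta> \<gamma> x x"
proof -
  interpret end_rooted_tree "parent T a b \<beta>" "core T" "colour T a \<gamma>" lab
    by (rule end_rooted[OF ref])
  interpret discrete_order prec by (rule discrete_prec)
  show "(ray T lab a b \<beta> \<gamma>)\<^sup>*\<^sup>* x y" "card {y. ray T lab a b \<beta> \<gamma> x y} = 2"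
    unfolding ray_def by (rule linked_connected, rule card_linked)
  show "ray T lab a b \<beta> \<gamma> x y \<Longrightarrow> ray T lab a b \<beta> \<gamma> y x"
    unfolding ray_def linked_def by blast
  show "\<not> ray T lab a b \<beta> \<gamma> x x"
    unfolding ray_def linked_def consecutive_def using irrefl by blast
  have *: "\<exists>n\<le>3. (T ^^ n) x y" if "consecutive prec x y" for x y
    using consecutive_dist[OF _ that, of T] parent_T[OF ref] T_sym by blast
  have sym: "(T ^^ n) y x" if "(T ^^ n) x y" for n x y
    using that
  proof (induction n arbitrary: y)
    case (Suc n)
    then obtain z where "(T ^^ n) x z" "T z y" by auto
    then show ?case using Suc.IH T_sym by (metis relpowp_Suc_I2)
  qed auto
  show "ray T lab a b \<beta> \<gamma> x y \<Longrightarrow> \<exists>n\<le>3. (T ^^ n) x y"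
    unfolding ray_def linked_def using * sym by blast
qed

text \<open>There are only two orientations of the core and only two bipartitions, so another reference
  edge amounts to a change of the two signs.\<close>

lemma ray_change_reference:
  assumes ref: "reference_edge T a b" and ref': "reference_edge T a' b'"
  shows "\<exists>\<beta>' \<gamma>'. \<forall>\<beta> \<gamma>. ray T lab a' b' \<beta> \<gamma> = ray T lab a b (\<beta> = \<beta>') (\<gamma> = \<gamma>')"
proof -
  \<comment> \<open>\<open>same\<close> records whether the two reference edges agree on a step
    along the trunk. Its value survives reversing the step and turning to the other neighbour, so it
    is constant along ancestral lines, and these merge.\<close>
  define same where "same x y \<longleftrightarrow> (coherent T a' b' x y \<longleftrightarrow> coherent T a b x y)" for x y
  have swap: "same y x = same x y" if "core T x" "up T x y" for x y
    unfolding same_def using coherent_antisym[OF ref that] coherent_antisym[OF ref' that] by blast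
  have at: "same x z = same x y" if "core T x" "up T x y" "up T x z" for x y z
    unfolding same_def using coherent_one[OF ref that] coherent_one[OF ref' that] by blast
  let ?P = "parent T a b True"
  have chain: "core T z \<and> (\<forall>y w. up T x y \<longrightarrow> up T z w \<longrightarrow> same z w = same x y)"
    if "?P\<^sup>*\<^sup>* x z" "core T x" for x z
    using that
  proof (induction rule: rtranclp_induct)
    case base
    then show ?case using at by blast
  next
    case (step u v)
    then have u: "core T u" "up T u v" by (auto simp: parent_def)
    then have v: "core T v" "up T v u" using core_up_core core_up_sym by blast+
    show ?case using step at[OF v(1)] swap u v by blast
  qed
  have const: "same x y = same z w" if "core T x" "up T x y" "core T z" "up T z w" for x y z w
  proof -
    obtain u where u: "?P\<^sup>*\<^sup>* x u" "?P\<^sup>*\<^sup>* z u" using parent_common_ancestor[OF ref] by blast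
    obtain t where "up T u t" using up_ex by blast
    then show ?thesis using chain[OF u(1) that(1)] chain[OF u(2) that(3)] that by blast
  qed
  then obtain \<beta>' where \<beta>': "\<And>x y. core T x \<Longrightarrow> up T x y \<Longrightarrow> same x y = \<beta>'" by metis
  have P: "parent T a' b' \<beta> = parent T a b (\<beta> = \<beta>')" for \<beta>
    using \<beta>' unfolding fun_eq_iff parent_def same_def by blast
  define \<gamma>' where "\<gamma>' = (colour T a' True a = colour T a True a)"
  have "(colour T a' True x = colour T a True x) = \<gamma>'" for x
    unfolding \<gamma>'_def by (rule bipartition_unique[OF ref])
      (use colour_alternates[OF ref] colour_alternates[OF ref'] in blast)+
  then have C: "colour T a' \<gamma> = colour T a (\<gamma> = \<gamma>')" for \<gamma>
    unfolding fun_eq_iff colour_def by blast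
  show ?thesis unfolding ray_def by (intro exI[of _ \<beta>'] exI[of _ \<gamma>'] allI) (simp add: P C)
qed

end

end

section \<open>Minimal spanning trees\<close>

text \<open>Edges enter as \<open>N\<close> grows: \<open>lev N\<close> is increasing in \<open>N\<close>, so \<open>lighter\<close> is the lexicographic order by
  first level and weight.\<close>

definition lighter ::
    "(nat \<Rightarrow> 'a \<Rightarrow> 'a \<Rightarrow> bool) \<Rightarrow> ('a \<Rightarrow> 'a \<Rightarrow> real) \<Rightarrow> 'a \<Rightarrow> 'a \<Rightarrow> 'a \<Rightarrow> 'a \<Rightarrow> bool" where
  "lighter lev w u v x y \<longleftrightarrow>
    (\<exists>N. lev N u v \<and> \<not> lev N x y) \<or> (\<forall>N. lev N u v \<longleftrightarrow> lev N x y) \<and> w u v < w x y"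

text \<open>The free minimal spanning forest: an edge is dropped exactly if it is the heaviest edge
  of some cycle.\<close>

definition min_tree ::
    "('a \<Rightarrow> 'a \<Rightarrow> bool) \<Rightarrow> (nat \<Rightarrow> 'a \<Rightarrow> 'a \<Rightarrow> bool) \<Rightarrow> ('a \<Rightarrow> 'a \<Rightarrow> real) \<Rightarrow> 'a \<Rightarrow> 'a \<Rightarrow> bool" where
  "min_tree adj lev w x y \<longleftrightarrow>
    adj x y \<and> \<not> (\<lambda>u v. adj u v \<and> lighter lev w u v x y)\<^sup>*\<^sup>* x y"

text \<open>Walks use finitely many edges, so acyclicity of an infinite graph can be tested on
  finite sets of edges.\<close>

lemma rtranclp_finite_support:
  assumes "R\<^sup>*\<^sup>* x y"
  shows "\<exists>A. finite A \<and> (\<forall>(a, b)\<in>A. R a b) \<and> (\<lambda>a b. (a, b) \<in> A)\<^sup>*\<^sup>* x y"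
  using assms
proof (induction rule: rtranclp_induct)
  case base
  then show ?case by (intro exI[of _ "{}"]) auto
next
  case (step y z)
  then obtain A where A: "finite A" "\<forall>(a, b)\<in>A. R a b" "(\<lambda>a b. (a, b) \<in> A)\<^sup>*\<^sup>* x y" by blast
  have "(\<lambda>a b. (a, b) \<in> insert (y, z) A)\<^sup>*\<^sup>* x y"
    using A(3) by (rule rtranclp_mono[THEN predicate2D, rotated]) auto
  then have "(\<lambda>a b. (a, b) \<in> insert (y, z) A)\<^sup>*\<^sup>* x z"
    by (rule rtranclp.rtrancl_into_rtrancl) simp
  then show ?case using A step.hyps by (intro exI[of _ "insert (y, z) A"]) auto
qed

lemma rtranclp_add_edge:
  assumes "(\<lambda>a b. Q a b \<or> a = u \<and> b = v \<or> a = v \<and> b = u)\<^sup>*\<^sup>* x z"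
  shows "Q\<^sup>*\<^sup>* x z \<or> Q\<^sup>*\<^sup>* x u \<and> Q\<^sup>*\<^sup>* v z \<or> Q\<^sup>*\<^sup>* x v \<and> Q\<^sup>*\<^sup>* u z"
  using assms
proof (induction rule: rtranclp_induct)
  case (step b c)
  from step.hyps(2) consider "Q b c" | "b = u" "c = v" | "b = v" "c = u" by blast
  then show ?case
  proof cases
    case 1
    then show ?thesis using step.IH by (meson rtranclp.rtrancl_into_rtrancl)
  qed (use step.IH in auto)
qed simp

definition sym_rel :: "('a \<times> 'a) set \<Rightarrow> 'a \<Rightarrow> 'a \<Rightarrow> bool" where
  "sym_rel A u v \<longleftrightarrow> (u, v) \<in> A \<or> (v, u) \<in> A"

text \<open>The finite components in \<open>lev_finite\<close> are what forces the minimal forest to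
  be connected; \<open>w_inj\<close> leaves no ties between distinct edges.\<close>

locale leveled_graph =
  fixes adj :: "'a \<Rightarrow> 'a \<Rightarrow> bool" and lev :: "nat \<Rightarrow> 'a \<Rightarrow> 'a \<Rightarrow> bool" and w :: "'a \<Rightarrow> 'a \<Rightarrow> real"
  assumes adj_sym: "adj x y \<Longrightarrow> adj y x"
    and adj_connected: "adj\<^sup>*\<^sup>* x y"
    and adj_finite: "finite {y. adj x y}"
    and infinite_vertices: "infinite (UNIV :: 'a set)"
    and lev_sym: "lev N x y \<Longrightarrow> lev N y x"
    and lev_mono: "M \<le> N \<Longrightarrow> lev M x y \<Longrightarrow> lev N x y"
    and lev_ex: "adj x y \<Longrightarrow> \<exists>N. lev N x y"
    and lev_finite: "finite {z. (\<lambda>u v. adj u v \<and> lev N u v)\<^sup>*\<^sup>* x z}"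
    and w_sym: "w x y = w y x"
    and w_inj: "adj x y \<Longrightarrow> adj u v \<Longrightarrow> w x y = w u v \<Longrightarrow> x = u \<and> y = v \<or> x = v \<and> y = u"
begin

abbreviation "ltr \<equiv> lighter lev w"
abbreviation "T \<equiv> min_tree adj lev w"

definition lv :: "'a \<Rightarrow> 'a \<Rightarrow> nat" where "lv x y = (LEAST N. lev N x y)"

lemma lev_lv: "adj x y \<Longrightarrow> lev N x y \<longleftrightarrow> lv x y \<le> N"
  unfolding lv_def using lev_ex lev_mono LeastI_ex[of "\<lambda>N. lev N x y"] Least_le by metis

lemma lv_sym: "lv x y = lv y x"
  unfolding lv_def using lev_sym by metis

lemma ltr_lv:
  assumes "adj u v" "adj x y"
  shows "ltr u v x y \<longleftrightarrow> lv u v < lv x y \<or> lv u v = lv x y \<and> w u v < w x y"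
proof -
  have "(\<exists>N. lev N u v \<and> \<not> lev N x y) \<longleftrightarrow> lv u v < lv x y"
    using assms by (auto simp: lev_lv not_le intro: le_less_trans)
  moreover have "(\<forall>N. lev N u v \<longleftrightarrow> lev N x y) \<longleftrightarrow> lv u v = lv x y"
    using assms by (auto simp: lev_lv intro: antisym)
  ultimately show ?thesis by (simp add: lighter_def)
qed

lemma ltr_total:
  "adj u v \<Longrightarrow> adj x y \<Longrightarrow> \<not> ltr x y u v \<Longrightarrow> \<not> (u = x \<and> v = y) \<Longrightarrow> \<not> (u = y \<and> v = x) \<Longrightarrow> ltr u v x y"
  using w_inj[of u v x y] ltr_lv by force

lemma T_adj: "T x y \<Longrightarrow> adj x y"
  by (simp add: min_tree_def)

lemma T_sym: "T x y \<Longrightarrow> T y x"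
proof -
  assume T: "T x y"
  have "ltr u v x y \<longleftrightarrow> ltr u v y x" for u v
    unfolding lighter_def using lev_sym w_sym by metis
  then have eq: "(\<lambda>u v. adj u v \<and> ltr u v x y) = (\<lambda>u v. adj u v \<and> ltr u v y x)" by simp
  have "ltr u v x y \<longleftrightarrow> ltr v u x y" for u v
    unfolding lighter_def using lev_sym w_sym by metis
  then have "symp (\<lambda>u v. adj u v \<and> ltr u v x y)" using adj_sym by (auto simp: symp_def)
  then have "symp (\<lambda>u v. adj u v \<and> ltr u v x y)\<^sup>*\<^sup>*" by (rule symp_rtranclp)
  then have "\<not> (\<lambda>u v. adj u v \<and> ltr u v x y)\<^sup>*\<^sup>* y x"
    using T unfolding min_tree_def by (blast dest: sympD)
  then show "T y x" using T adj_sym[of x y] unfolding min_tree_def eq by blast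
qed

text \<open>The heaviest edge of \<open>A\<close> joins two different components of the other edges.\<close>

lemma finite_acyclic:
  fixes A :: "('a \<times> 'a) set"
  assumes "finite A" "\<And>a b. (a, b) \<in> A \<Longrightarrow> T a b" "(x, y) \<in> A"
  shows "\<not> (minus_edge (sym_rel A) x y)\<^sup>*\<^sup>* x y"
  using assms
proof (induction "card A" arbitrary: A x y rule: less_induct)
  case less
  have symR: "(sym_rel A)\<^sup>*\<^sup>* a b \<Longrightarrow> (sym_rel A)\<^sup>*\<^sup>* b a" for A a b
    by (rule sympD[OF symp_rtranclp]) (auto simp: symp_def sym_rel_def)
  have "asymp_on A (\<lambda>(a, b) (c, d). ltr a b c d)" "transp_on A (\<lambda>(a, b) (c, d). ltr a b c d)"
    using less.prems(2) T_adj by (fastforce simp: asymp_on_def transp_on_def ltr_lv)+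
  moreover have "A \<noteq> {}" using less.prems(3) by blast
  ultimately obtain m where m: "m \<in> A" "\<And>e. e \<in> A \<Longrightarrow> e \<noteq> m \<Longrightarrow> \<not> (case m of (a, b) \<Rightarrow> \<lambda>(c, d). ltr a b c d) e"
    using Finite_Set.bex_max_element[OF less.prems(1)] by metis
  obtain u v where uv: "m = (u, v)" by (cases m)
  define A' where "A' = A - {(u, v), (v, u)}"
  have "card A' < card A"
    using m(1) less.prems(1) by (intro psubset_card_mono) (auto simp: A'_def uv)
  note IH = less.hyps[OF this]
  have Tuv: "T u v" using m(1) less.prems(2) uv by blast
  have R: "sym_rel A = (\<lambda>a b. sym_rel A' a b \<or> a = u \<and> b = v \<or> a = v \<and> b = u)"
    using m(1) by (auto simp: sym_rel_def A'_def uv fun_eq_iff)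
  have "adj a b \<and> ltr a b u v" if "sym_rel A' a b" for a b
  proof -
    have ab: "(a, b) \<in> A \<or> (b, a) \<in> A" "\<not> (a = u \<and> b = v)" "\<not> (a = v \<and> b = u)"
      using that by (auto simp: sym_rel_def A'_def)
    then have T: "T a b" "T b a" using less.prems(2) T_sym by blast+
    have "\<not> ltr u v a b \<or> \<not> ltr u v b a" using ab m(2)[of "(a, b)"] m(2)[of "(b, a)"] by (auto simp: uv)
    moreover have "ltr u v a b = ltr u v b a"
      using ltr_lv T_adj T Tuv lv_sym w_sym by metis
    ultimately have "ltr a b u v" using ltr_total[of a b u v] T_adj T Tuv ab by blast
    then show ?thesis using T T_adj by blast
  qed
  then have "sym_rel A' \<le> (\<lambda>a b. adj a b \<and> ltr a b u v)" by blast
  then have "(sym_rel A')\<^sup>*\<^sup>* \<le> (\<lambda>a b. adj a b \<and> ltr a b u v)\<^sup>*\<^sup>*" by (rule rtranclp_mono)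
  then have nuv: "\<not> (sym_rel A')\<^sup>*\<^sup>* u v" using Tuv unfolding min_tree_def by blast
  then have nvu: "\<not> (sym_rel A')\<^sup>*\<^sup>* v u" using symR[of A' v u] by blast
  show ?case
  proof
    assume path: "(minus_edge (sym_rel A) x y)\<^sup>*\<^sup>* x y"
    show False
    proof (cases "(x, y) = (u, v) \<or> (x, y) = (v, u)")
      case True
      then have "minus_edge (sym_rel A) x y \<le> sym_rel A'" by (subst R) (auto simp: minus_edge_def)
      then have "(sym_rel A')\<^sup>*\<^sup>* x y" using path by (rule rtranclp_mono[THEN predicate2D])
      then show False using True nuv nvu by blast
    next
      case False
      \<comment> \<open>The induction hypothesis applies once the heaviest edge is removed, so the
        path from \<open>x\<close> to \<open>y\<close> must use that edge. The two remaining pieces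
        and the edge between \<open>x\<close> and \<open>y\<close> then join \<open>u\<close> and
        \<open>v\<close> by lighter edges.\<close>
      define Q where "Q = minus_edge (sym_rel A') x y"
      have "\<not> Q\<^sup>*\<^sup>* x y"
        unfolding Q_def by (rule IH) (use less.prems False in \<open>auto simp: A'_def\<close>)
      moreover have "(\<lambda>a b. Q a b \<or> a = u \<and> b = v \<or> a = v \<and> b = u)\<^sup>*\<^sup>* x y"
        using path by (rule rtranclp_mono[THEN predicate2D, rotated]) 
          (subst R, auto simp: Q_def minus_edge_def)
      ultimately have Q: "Q\<^sup>*\<^sup>* x u \<and> Q\<^sup>*\<^sup>* v y \<or> Q\<^sup>*\<^sup>* x v \<and> Q\<^sup>*\<^sup>* u y"
        using rtranclp_add_edge[of Q u v x y] by blast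
      have "Q\<^sup>*\<^sup>* \<le> (sym_rel A')\<^sup>*\<^sup>*" by (rule rtranclp_mono) (auto simp: Q_def minus_edge_def)
      with Q have "(sym_rel A')\<^sup>*\<^sup>* x u \<and> (sym_rel A')\<^sup>*\<^sup>* v y \<or> (sym_rel A')\<^sup>*\<^sup>* x v \<and> (sym_rel A')\<^sup>*\<^sup>* u y"
        by (auto dest: predicate2D)
      moreover have "sym_rel A' x y" using less.prems(3) False by (auto simp: sym_rel_def A'_def)
      then have "(sym_rel A')\<^sup>*\<^sup>* x y" by blast
      ultimately have "(sym_rel A')\<^sup>*\<^sup>* u v \<or> (sym_rel A')\<^sup>*\<^sup>* v u"
        using symR[of A' x u] symR[of A' v y] symR[of A' x v] symR[of A' u y]
        by (meson rtranclp_trans)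
      then show False using nuv nvu by blast
    qed
  qed
qed

lemma T_bridge: assumes "T x y" shows "\<not> side T x y y"
proof
  assume "side T x y y"
  then obtain A where A: "finite A" "\<forall>(a, b)\<in>A. minus_edge T x y a b" "(\<lambda>a b. (a, b) \<in> A)\<^sup>*\<^sup>* x y"
    unfolding side_def using rtranclp_finite_support[of "minus_edge T x y" x y] by blast
  define B where "B = insert (x, y) A"
  have "(minus_edge (sym_rel B) x y)\<^sup>*\<^sup>* x y"
    using A(3)
  proof (rule rtranclp_mono[THEN predicate2D, rotated])
    show "(\<lambda>a b. (a, b) \<in> A) \<le> minus_edge (sym_rel B) x y"
      using A(2) by (auto simp: sym_rel_def B_def minus_edge_def)
  qed
  moreover have "\<not> (minus_edge (sym_rel B) x y)\<^sup>*\<^sup>* x y"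
    by (rule finite_acyclic) (use A assms in \<open>auto simp: B_def minus_edge_def\<close>)
  ultimately show False by blast
qed

text \<open>Induction on the number of lighter edges in the component of \<open>x\<close> at the
  level of the edge, which is finite. A rejected edge is replaced by a path of lighter ones, each
  with a strictly smaller count.\<close>

lemma adj_T_connected: "adj x y \<Longrightarrow> T\<^sup>*\<^sup>* x y"
proof (induction "card {(u, v). adj u v \<and> (\<lambda>u v. adj u v \<and> lev (lv x y) u v)\<^sup>*\<^sup>* x u \<and> ltr u v x y}"
    arbitrary: x y rule: less_induct)
  case less
  define L where "L x y u v \<longleftrightarrow> adj u v \<and> lev (lv x y) u v" for x y u v
  define S where "S x y = {(u, v). adj u v \<and> (L x y)\<^sup>*\<^sup>* x u \<and> ltr u v x y}" for x y
  have hyp: "T\<^sup>*\<^sup>* u v" if "card (S u v) < card (S x y)" "adj u v" for u v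
    using less.hyps[of u v] that unfolding S_def L_def by blast
  have fin: "finite (S x y)"
  proof (rule finite_subset)
    show "S x y \<subseteq> Sigma {z. (L x y)\<^sup>*\<^sup>* x z} (\<lambda>u. {v. adj u v})" unfolding S_def by blast
    show "finite (Sigma {z. (L x y)\<^sup>*\<^sup>* x z} (\<lambda>u. {v. adj u v}))"
      using lev_finite[of "lv x y" x] adj_finite unfolding L_def by blast
  qed
  show ?case
  proof (cases "T x y")
    case False
    then have "(\<lambda>u v. adj u v \<and> ltr u v x y)\<^sup>*\<^sup>* x y" using less.prems by (simp add: min_tree_def)
    then show ?thesis
    proof (induction rule: rtranclp_induct)
      case (step u v)
      then have uv: "adj u v" "ltr u v x y" by auto
      have "(\<lambda>u v. adj u v \<and> ltr u v x y) \<le> L x y"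
        using less.prems by (auto simp: L_def ltr_lv lev_lv)
      then have xu: "(L x y)\<^sup>*\<^sup>* x u" using step.hyps(1) rtranclp_mono by blast
      have "lv u v \<le> lv x y" using uv less.prems by (auto simp: ltr_lv)
      then have "L u v \<le> L x y" by (auto simp: L_def intro: lev_mono)
      then have sub: "S u v \<subseteq> S x y"
        using xu uv less.prems rtranclp_mono[of "L u v" "L x y"]
        by (auto simp: S_def ltr_lv intro: rtranclp_trans)
      have "(u, v) \<in> S x y" "(u, v) \<notin> S u v"
        using xu uv by (auto simp: S_def ltr_lv)
      then have "card (S u v) < card (S x y)" using sub fin by (intro psubset_card_mono) blast+
      then show ?case using step.IH hyp uv by (meson rtranclp_trans)
    qed simp
  qed simp
qed

lemma tree: "tree T"
proof
  fix x y
  show "T x y \<Longrightarrow> T y x" by (rule T_sym)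
  show "T\<^sup>*\<^sup>* x y"
    using adj_connected[of x y] by (induction rule: rtranclp_induct) (use adj_T_connected rtranclp_trans in fast)+
  show "T x y \<Longrightarrow> \<not> side T x y y" by (rule T_bridge)
  show "finite {y. T x y}"
    by (rule finite_subset[OF _ adj_finite[of x]]) (use T_adj in blast)
qed (rule infinite_vertices)

end

section \<open>Covering by translates of Foelner sets\<close>

locale transitive_graph =
  fixes adj :: "'a \<Rightarrow> 'a \<Rightarrow> bool" and G :: "('a \<Rightarrow> 'a) set"
  assumes adj_sym: "adj x y \<Longrightarrow> adj y x"
    and adj_connected: "adj\<^sup>*\<^sup>* x y"
    and infinite_vertices: "infinite (UNIV :: 'a set)"
    and G_adj: "g \<in> G \<Longrightarrow> adj (g x) (g y) \<longleftrightarrow> adj x y"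
    and G_comp: "g \<in> G \<Longrightarrow> h \<in> G \<Longrightarrow> g \<circ> h \<in> G"
    and G_inv: "g \<in> G \<Longrightarrow> \<exists>h\<in>G. g \<circ> h = id \<and> h \<circ> g = id"
    and G_transitive: "\<exists>g\<in>G. g x = y"
begin

definition boundary :: "'a set \<Rightarrow> ('a \<times> 'a) set" where
  "boundary F = {(x, y). x \<in> F \<and> y \<notin> F \<and> adj x y}"

text \<open>Translates are kept as images of one enumeration: lists with the same underlying set
  count separately, and over a countable vertex type there are countably many.\<close>

definition orbit :: "'a list \<Rightarrow> 'a list set" where
  "orbit L0 = (\<lambda>g. map g L0) ` G"

definition walk_ball :: "nat \<Rightarrow> 'a \<Rightarrow> 'a set" where
  "walk_ball D x = {y. \<exists>n\<le>D. (adj ^^ n) x y}"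

lemma G_bij: "g \<in> G \<Longrightarrow> bij g"
  using G_inv o_bij by blast

lemma G_inj: "g \<in> G \<Longrightarrow> g x = g y \<longleftrightarrow> x = y"
  using G_bij by (metis bij_pointE)

lemma map_orbit: "g \<in> G \<Longrightarrow> L \<in> orbit L0 \<Longrightarrow> map g L \<in> orbit L0"
  unfolding orbit_def using G_comp by fastforce

lemma map_orbit_iff: 
  assumes "g \<in> G" shows "map g L \<in> orbit L0 \<longleftrightarrow> L \<in> orbit L0"
proof
  assume L: "map g L \<in> orbit L0"
  obtain h where "h \<in> G" "h \<circ> g = id" using G_inv assms by blast
  then show "L \<in> orbit L0" using map_orbit[OF _ L, of h] by simp
qed (rule map_orbit[OF assms])

lemma orbit_surj: assumes "g \<in> G" "L \<in> orbit L0" obtains M where "M \<in> orbit L0" "L = map g M"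
proof -
  obtain h where "h \<in> G" "g \<circ> h = id" using G_inv assms by blast
  then show thesis using that[of "map h L"] map_orbit[OF _ assms(2), of h] by simp
qed

lemma walk_sym: "(adj ^^ n) x y \<Longrightarrow> (adj ^^ n) y x"
proof (induction n arbitrary: y)
  case (Suc n)
  then obtain z where "(adj ^^ n) x z" "adj z y" by auto
  then show ?case using Suc.IH adj_sym by (metis relpowp_Suc_I2)
qed auto

lemma walk_G: "g \<in> G \<Longrightarrow> (adj ^^ n) x y \<Longrightarrow> (adj ^^ n) (g x) (g y)"
proof (induction n arbitrary: y)
  case (Suc n)
  then obtain z where "(adj ^^ n) x z" "adj z y" by auto
  then have "(adj ^^ n) (g x) (g z)" "adj (g z) (g y)" using Suc G_adj by auto
  then show ?case by auto
qed auto

lemma card_walk_ball_const: "finite (walk_ball D x) \<Longrightarrow> card (walk_ball D y) = card (walk_ball D x)"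
proof -
  assume fin: "finite (walk_ball D x)"
  have sub: "g ` walk_ball D x \<subseteq> walk_ball D (g x)" if "g \<in> G" for g x
    unfolding walk_ball_def using walk_G[OF that] by blast
  obtain g where g: "g \<in> G" "g x = y" using G_transitive by blast
  obtain h where h: "h \<in> G" "g \<circ> h = id" "h \<circ> g = id" using G_inv g by blast
  have hy: "h y = x" using h(3) g(2) by (metis comp_apply id_apply)
  have "walk_ball D y = g ` walk_ball D x"
  proof
    show "g ` walk_ball D x \<subseteq> walk_ball D y" using sub[OF g(1)] g(2) by blast
    have "walk_ball D y = g ` h ` walk_ball D y" using h(2) by (simp add: image_comp)
    also have "\<dots> \<subseteq> g ` walk_ball D x" using sub[OF h(1), of y] hy by blast
    finally show "walk_ball D y \<subseteq> g ` walk_ball D x" .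
  qed
  moreover have "inj_on g (walk_ball D x)" using G_inj g(1) by (auto simp: inj_on_def)
  ultimately show ?thesis by (simp add: card_image)
qed

text \<open>A walk that leaves \<open>K\<close> crosses a boundary edge, whose inner end is then
  close to the start. This serves to count the vertices of \<open>K\<close> near its
  boundary.\<close>

lemma walk_exit:
  assumes "(adj ^^ n) x y" "x \<in> K" "y \<notin> K"
  shows "\<exists>(a, b)\<in>boundary K. x \<in> walk_ball n a"
  using assms
proof (induction n arbitrary: y)
  case (Suc n)
  then obtain z where z: "(adj ^^ n) x z" "adj z y" by auto
  show ?case
  proof (cases "z \<in> K")
    case True
    then have "(z, y) \<in> boundary K" using z Suc.prems by (simp add: boundary_def)
    moreover have "x \<in> walk_ball (Suc n) z" unfolding walk_ball_def using walk_sym[OF z(1)] by (auto intro: exI[of _ n])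
    ultimately show ?thesis by blast
  next
    case False
    then have "\<exists>(a, b)\<in>boundary K. x \<in> walk_ball n a" using Suc z by blast
    then show ?thesis unfolding walk_ball_def using le_SucI by fast
  qed
qed auto

end

locale amenable_graph = transitive_graph +
  assumes amenable: "\<epsilon> > 0 \<Longrightarrow> \<exists>F. finite F \<and> F \<noteq> {} \<and> finite (boundary F) \<and>
    real (card (boundary F)) \<le> \<epsilon> * real (card F)"
begin

text \<open>A vertex of a finite set with finite boundary has finite degree, and transitivity
  carries this to all vertices; the value 1 for \<epsilon> is arbitrary.\<close>

lemma adj_finite: "finite {y. adj x y}"
proof -
  obtain F z where F: "finite F" "z \<in> F" "finite (boundary F)" using amenable[of 1] by auto
  obtain g where g: "g \<in> G" "g x = z" using G_transitive by blast
  have "{y. adj z y} \<subseteq> F \<union> snd ` boundary F"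
    using F(2) by (force simp: boundary_def image_iff)
  then have "finite {y. adj z y}" using F finite_subset by blast
  moreover have "g ` {y. adj x y} \<subseteq> {y. adj z y}" using G_adj g by blast
  moreover have "inj_on g {y. adj x y}" using G_inj g(1) by (auto simp: inj_on_def)
  ultimately show ?thesis using inj_on_finite by blast
qed

lemma finite_walk_ball: "finite (walk_ball D x)"
proof (induction D)
  case 0
  have "walk_ball 0 x \<subseteq> {x}" by (auto simp: walk_ball_def)
  then show ?case using finite_subset by blast
next
  case (Suc D)
  have "walk_ball (Suc D) x \<subseteq> walk_ball D x \<union> (\<Union>z\<in>walk_ball D x. {y. adj z y})"
  proof
    fix y assume "y \<in> walk_ball (Suc D) x"
    then obtain n where n: "n \<le> Suc D" "(adj ^^ n) x y" by (auto simp: walk_ball_def)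
    show "y \<in> walk_ball D x \<union> (\<Union>z\<in>walk_ball D x. {y. adj z y})"
    proof (cases "n = Suc D")
      case True
      then obtain z where "(adj ^^ D) x z" "adj z y" using n by auto
      then show ?thesis unfolding walk_ball_def by blast
    next
      case False
      then show ?thesis using n unfolding walk_ball_def by (simp add: le_Suc_eq) blast
    qed
  qed
  then show ?case using Suc adj_finite finite_subset by blast
qed

text \<open>Let \<open>d\<close> be the number of translates through a vertex and \<open>b\<close>
  the number of pairs of such a translate and an edge from the vertex that leaves it; transitivity
  makes both constant. Counting incidences gives \<open>card LK * card F \<le> card K * d\<close>
  and \<open>card (K - bad) * b \<le> card LK * card (boundary F)\<close>, whence
  \<open>b \<le> \<epsilon> * d\<close>, which bounds the count for each single edge.\<close>

lemma orbit_covering: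
  fixes \<epsilon> :: real
  assumes "\<epsilon> > 0"
  shows "\<exists>L0 d. d > 0 \<and> (\<forall>x. finite {L \<in> orbit L0. x \<in> set L} \<and> card {L \<in> orbit L0. x \<in> set L} = d) \<and>
    (\<forall>x y. adj x y \<longrightarrow> real (card {L \<in> orbit L0. x \<in> set L \<and> y \<notin> set L}) \<le> \<epsilon> * d)"
proof -
  \<comment> \<open>Half of \<epsilon> is given away because up to half of \<open>K\<close> is
    discarded as \<open>bad\<close>.\<close>
  obtain F where F: "finite F" "F \<noteq> {}" "finite (boundary F)" "real (card (boundary F)) \<le> \<epsilon> / 2 * card F"
    using amenable[of "\<epsilon> / 2"] assms by auto
  obtain L0 where L0: "set L0 = F" using F(1) finite_list by blast
  define inc where "inc x = {L \<in> orbit L0. x \<in> set L}" for x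
  define cut where "cut x = {(L, w). L \<in> inc x \<and> w \<notin> set L \<and> adj x w}" for x
  have "\<forall>x y. \<exists>n. (adj ^^ n) x y" using adj_connected by (simp add: rtranclp_power)
  then obtain n where n: "\<And>x y. (adj ^^ n x y) x y" by metis
  define D where "D = Max (case_prod n ` (F \<times> F))"
  have D: "n x y \<le> D" if "x \<in> F" "y \<in> F" for x y
    unfolding D_def using F(1) that by (intro Max_ge) (auto intro!: rev_image_eqI[of "(x, y)"])
  have in_walk_ball: "set L \<subseteq> walk_ball D x" if "L \<in> inc x" for L x
  proof
    fix y assume "y \<in> set L"
    then obtain g u v where g: "g \<in> G" "u \<in> F" "v \<in> F" "x = g u" "y = g v"
      using \<open>L \<in> inc x\<close> L0 by (auto simp: inc_def orbit_def)
    then have "(adj ^^ n u v) x y" using walk_G n by blast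
    then show "y \<in> walk_ball D x" unfolding walk_ball_def using D g by blast
  qed
  have len: "length L = length L0" if "L \<in> orbit L0" for L using that by (auto simp: orbit_def)
  have fin_inc: "finite (inc x)" for x
  proof (rule finite_subset)
    show "inc x \<subseteq> {L. set L \<subseteq> walk_ball D x \<and> length L = length L0}"
      using in_walk_ball len by (auto simp: inc_def)
  qed (rule finite_lists_length_eq[OF finite_walk_ball])
  have fin_cut: "finite (cut x)" for x
    by (rule finite_subset[of _ "inc x \<times> {w. adj x w}"]) (auto simp: cut_def fin_inc adj_finite)
  have transport: "card (inc (g x)) = card (inc x)" "card (cut (g x)) = card (cut x)" if g: "g \<in> G" for g x
  proof -
    have inj: "inj g" using G_bij[OF g] bij_is_inj by blast
    have mem: "g z \<in> set (map g L) \<longleftrightarrow> z \<in> set L" for z L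
      using inj by (simp add: inj_image_mem_iff)
    have "inc (g x) = map g ` inc x"
    proof
      show "map g ` inc x \<subseteq> inc (g x)" using map_orbit[OF g] by (auto simp: inc_def)
      show "inc (g x) \<subseteq> map g ` inc x"
      proof
        fix L assume L: "L \<in> inc (g x)"
        then obtain M where "M \<in> orbit L0" "L = map g M" using orbit_surj[OF g] by (auto simp: inc_def)
        then show "L \<in> map g ` inc x" using L mem by (auto simp: inc_def)
      qed
    qed
    then show "card (inc (g x)) = card (inc x)"
      using inj by (simp add: card_image inj_on_def)
    have "bij_betw (\<lambda>(L, w). (map g L, g w)) (cut x) (cut (g x))"
      unfolding bij_betw_def
    proof
      show "inj_on (\<lambda>(L, w). (map g L, g w)) (cut x)"
        by (rule inj_onI) (auto simp: inj_map_eq_map[OF inj] inj_eq[OF inj])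
      show "(\<lambda>(L, w). (map g L, g w)) ` cut x = cut (g x)"
      proof
        show "(\<lambda>(L, w). (map g L, g w)) ` cut x \<subseteq> cut (g x)"
          using map_orbit[OF g] G_adj[OF g] mem by (auto simp: cut_def inc_def)
        show "cut (g x) \<subseteq> (\<lambda>(L, w). (map g L, g w)) ` cut x"
        proof clarify
          fix L w assume L: "(L, w) \<in> cut (g x)"
          obtain v where v: "w = g v" using G_bij[OF g] by (metis bij_pointE)
          obtain M where M: "M \<in> orbit L0" "L = map g M"
            using L orbit_surj[OF g] by (auto simp: cut_def inc_def)
          have "(M, v) \<in> cut x" using L M v mem G_adj[OF g] by (auto simp: cut_def inc_def)
          then show "(L, w) \<in> (\<lambda>(L, w). (map g L, g w)) ` cut x" using M v by force
        qed
      qed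
    qed
    then show "card (cut (g x)) = card (cut x)" using bij_betw_same_card by metis
  qed
  fix r :: 'a
  define d where "d = card (inc r)"
  define b where "b = card (cut r)"
  define B where "B = card (walk_ball D r)"
  have inc_d: "card (inc x) = d" for x
    using G_transitive[of r x] transport(1)[of _ r] by (auto simp: d_def)
  have cut_b: "card (cut x) = b" for x
    using G_transitive[of r x] transport(2)[of _ r] by (auto simp: b_def)
  have walk_ball_B: "card (walk_ball D x) = B" for x
    unfolding B_def by (rule card_walk_ball_const[OF finite_walk_ball])
  have "r \<in> walk_ball D r" unfolding walk_ball_def by (auto intro: exI[of _ 0])
  then have "B > 0" unfolding B_def card_gt_0_iff using finite_walk_ball by blast
  have "d > 0"
  proof -
    obtain z where z: "z \<in> F" using F by blast
    obtain g where "g \<in> G" "g z = r" using G_transitive by blast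
    then have "map g L0 \<in> inc r" using z L0 by (auto simp: inc_def orbit_def)
    then show ?thesis unfolding d_def using fin_inc card_gt_0_iff by blast
  qed
  have card_F: "card (set L) = card F \<and> card (boundary (set L)) = card (boundary F)" if "L \<in> orbit L0" for L
  proof -
    obtain g where g: "g \<in> G" "L = map g L0" using \<open>L \<in> orbit L0\<close> by (auto simp: orbit_def)
    have inj: "inj g" using G_bij[OF g(1)] bij_is_inj by blast
    have "boundary (g ` F) = map_prod g g ` boundary F"
    proof
      show "map_prod g g ` boundary F \<subseteq> boundary (g ` F)"
        using G_adj[OF g(1)] by (auto simp: boundary_def inj_eq[OF inj])
      show "boundary (g ` F) \<subseteq> map_prod g g ` boundary F"
      proof clarify
        fix x y assume xy: "(x, y) \<in> boundary (g ` F)"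
        obtain u v where "x = g u" "y = g v" using G_bij[OF g(1)] by (metis bij_pointE)
        moreover have "(u, v) \<in> boundary F"
          using xy calculation G_adj[OF g(1)] by (auto simp: boundary_def inj_eq[OF inj])
        ultimately show "(x, y) \<in> map_prod g g ` boundary F" by force
      qed
    qed
    moreover have "inj_on (map_prod g g) (boundary F)" "inj_on g F"
      by (auto simp: inj_on_def inj_eq[OF inj])
    ultimately show ?thesis using g L0 by (simp add: card_image)
  qed
  text \<open>Counting incidences inside a second, much larger Foelner set \<open>K\<close> replaces the mass transport
    principle, for which one would have to know that \<open>G\<close> is unimodular.\<close>
  obtain K where K: "finite K" "K \<noteq> {}" "finite (boundary K)" "real (card (boundary K)) \<le> 1 / (2 * B) * card K"
    using amenable[of "1 / (2 * B)"] \<open>B > 0\<close> by auto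
  define LK where "LK = {L \<in> orbit L0. set L \<subseteq> K}"
  \<comment> \<open>A bad vertex is within \<open>D\<close> steps of the inner end of a boundary
    edge of \<open>K\<close>, since \<open>D\<close> bounds the distances between vertices of one
    translate. So each boundary edge accounts for at most \<open>B\<close> bad vertices, and the
    ratio \<open>1 / (2 * B)\<close> limits them to half of \<open>K\<close>.\<close>
  define bad where "bad = {x \<in> K. \<exists>L\<in>inc x. \<not> set L \<subseteq> K}"
  have fin_LK: "finite LK"
    by (rule finite_subset[OF _ finite_lists_length_eq[OF K(1), of "length L0"]]) (auto simp: LK_def len)
  have fin_bad: "finite bad" using K by (simp add: bad_def)
  have "bad \<subseteq> (\<Union>e\<in>boundary K. walk_ball D (fst e))"
  proof
    fix x assume "x \<in> bad"
    then obtain L y where xy: "x \<in> K" "L \<in> inc x" "y \<in> set L" "y \<notin> K" by (auto simp: bad_def)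
    then obtain m where m: "m \<le> D" "(adj ^^ m) x y" using in_walk_ball by (force simp: walk_ball_def)
    then obtain a c where a: "(a, c) \<in> boundary K" "x \<in> walk_ball m a" using walk_exit xy by blast
    then have "x \<in> walk_ball D a" using m(1) by (auto simp: walk_ball_def intro: order_trans)
    then show "x \<in> (\<Union>e\<in>boundary K. walk_ball D (fst e))" using a by force
  qed
  then have "card bad \<le> card (\<Union>e\<in>boundary K. walk_ball D (fst e))"
    using K finite_walk_ball by (intro card_mono) auto
  also have "\<dots> \<le> (\<Sum>e\<in>boundary K. card (walk_ball D (fst e)))" by (rule card_UN_le[OF K(3)])
  also have "\<dots> = card (boundary K) * B" by (simp add: walk_ball_B)
  finally have "real (card bad) \<le> real (card (boundary K)) * B" by (metis of_nat_le_iff of_nat_mult)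
  also have "\<dots> \<le> 1 / (2 * B) * card K * B" using K(4) by (intro mult_right_mono) auto
  also have "\<dots> = card K / 2" using \<open>B > 0\<close> by simp
  finally have bad_le: "real (card bad) \<le> card K / 2" .
  have "card LK * card F = card (SIGMA L:LK. set L)"
    using fin_LK card_F by (simp add: LK_def)
  also have "\<dots> \<le> card (SIGMA x:K. inc x)"
  proof (rule card_inj_on_le)
    show "inj_on prod.swap (SIGMA L:LK. set L)" by simp
    show "prod.swap ` (SIGMA L:LK. set L) \<subseteq> (SIGMA x:K. inc x)" by (auto simp: LK_def inc_def)
  qed (use K fin_inc in auto)
  also have "\<dots> = card K * d" using K fin_inc inc_d by simp
  finally have LK_le: "card LK * card F \<le> card K * d" .
  have "card (K - bad) * b = card (SIGMA x:K - bad. cut x)"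
    using K fin_cut cut_b by simp
  also have "\<dots> \<le> card (SIGMA L:LK. boundary (set L))"
  proof (rule card_inj_on_le)
    show "inj_on (\<lambda>(x, L, w). (L, x, w)) (SIGMA x:K - bad. cut x)" by (auto simp: inj_on_def)
    show "(\<lambda>(x, L, w). (L, x, w)) ` (SIGMA x:K - bad. cut x) \<subseteq> (SIGMA L:LK. boundary (set L))"
      by (auto simp: LK_def cut_def bad_def inc_def boundary_def)
    have "finite (boundary (set L))" for L
      by (rule finite_subset[of _ "SIGMA x:set L. {y. adj x y}"]) (auto simp: boundary_def adj_finite)
    then show "finite (SIGMA L:LK. boundary (set L))" using fin_LK by blast
  qed
  also have "\<dots> = card LK * card (boundary F)"
  proof -
    have "finite (boundary (set L))" for L
      by (rule finite_subset[of _ "SIGMA x:set L. {y. adj x y}"]) (auto simp: boundary_def adj_finite)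
    then show ?thesis using fin_LK card_F by (simp add: LK_def)
  qed
  finally have "real (card (K - bad)) * b \<le> real (card LK) * card (boundary F)"
    by (metis of_nat_le_iff of_nat_mult)
  also have "\<dots> \<le> real (card LK) * (\<epsilon> / 2 * card F)" using F by (intro mult_left_mono) auto
  also have "\<dots> = \<epsilon> / 2 * real (card LK * card F)" by simp
  also have "\<dots> \<le> \<epsilon> / 2 * real (card K * d)"
    using LK_le assms by (intro mult_left_mono) (auto simp del: of_nat_mult)
  finally have 1: "real (card (K - bad)) * b \<le> \<epsilon> / 2 * card K * d" by simp
  have "card (K - bad) = card K - card bad" "card bad \<le> card K"
    using K by (auto intro!: card_Diff_subset card_mono simp: bad_def)
  then have "real (card K) / 2 \<le> card (K - bad)" using bad_le by (simp add: of_nat_diff)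
  then have "real (card K) / 2 * b \<le> \<epsilon> / 2 * card K * d"
    using 1 by (meson mult_right_mono of_nat_0_le_iff order_trans)
  moreover have "card K > 0" using K by (simp add: card_gt_0_iff)
  ultimately have b_le: "b \<le> \<epsilon> * d" by (simp add: field_simps)
  have "real (card {L \<in> orbit L0. x \<in> set L \<and> y \<notin> set L}) \<le> \<epsilon> * d" if "adj x y" for x y
  proof -
    have "card {L \<in> orbit L0. x \<in> set L \<and> y \<notin> set L} \<le> card (cut x)"
      by (rule card_inj_on_le[of "\<lambda>L. (L, y)"]) (use that fin_cut in \<open>auto simp: inj_on_def cut_def inc_def\<close>)
    then have "real (card {L \<in> orbit L0. x \<in> set L \<and> y \<notin> set L}) \<le> b" using cut_b[of x] by simp
    then show ?thesis using b_le by linarith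
  qed
  then show ?thesis
    using \<open>d > 0\<close> fin_inc[unfolded inc_def] inc_d[unfolded inc_def] by (intro exI[of _ L0] exI[of _ d]) simp
qed

end

section \<open>Equivariance\<close>

text \<open>The right-hand side is built from quantifiers and implications only, so its
  parametricity is automatic.\<close>

lemma rtranclp_impredicative:
  "rtranclp R x y \<longleftrightarrow> (\<forall>P. P x \<longrightarrow> (\<forall>a b. P a \<longrightarrow> R a b \<longrightarrow> P b) \<longrightarrow> P y)"
proof
  assume "R\<^sup>*\<^sup>* x y"
  then show "\<forall>P. P x \<longrightarrow> (\<forall>a b. P a \<longrightarrow> R a b \<longrightarrow> P b) \<longrightarrow> P y"
    by (induction rule: rtranclp_induct) blast+
next
  assume *: "\<forall>P. P x \<longrightarrow> (\<forall>a b. P a \<longrightarrow> R a b \<longrightarrow> P b) \<longrightarrow> P y"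
  show "R\<^sup>*\<^sup>* x y" by (rule *[rule_format]) auto
qed

context
  includes lifting_syntax
  fixes A :: "'a \<Rightarrow> 'b \<Rightarrow> bool"
  assumes A[transfer_rule]: "bi_unique A" "bi_total A"
begin

text \<open>With the graph of an automorphism for \<open>A\<close>, this and the following rules
  state equivariance: each construction commutes with the relabelling of vertices.\<close>

lemma rtranclp_parametric [transfer_rule]:
  "((A ===> A ===> (=)) ===> A ===> A ===> (=)) rtranclp rtranclp"
  unfolding rtranclp_impredicative[abs_def] by transfer_prover

lemma relpowp_parametric [transfer_rule]:
  "((=) ===> (A ===> A ===> (=)) ===> A ===> A ===> (=))
    (compow :: nat \<Rightarrow> ('a \<Rightarrow> 'a \<Rightarrow> bool) \<Rightarrow> _) (compow :: nat \<Rightarrow> ('b \<Rightarrow> 'b \<Rightarrow> bool) \<Rightarrow> _)"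
proof (intro rel_funI, hypsubst)
  fix R :: "'a \<Rightarrow> 'a \<Rightarrow> bool" and S :: "'b \<Rightarrow> 'b \<Rightarrow> bool" and n :: nat and x y x' y'
  assume R: "(A ===> A ===> (=)) R S" and x: "A x y" and "A x' y'"
  from this(3) show "(R ^^ n) x x' = (S ^^ n) y y'"
  proof (induction n arbitrary: x' y')
    case 0
    then show ?case using x A(1) by (auto dest: bi_uniqueDl bi_uniqueDr)
  next
    case (Suc n)
    have RS: "R u x' = S v y'" if "A u v" for u v
      using rel_funD[OF rel_funD[OF R that] Suc.prems] .
    have "(\<exists>u. (R ^^ n) x u \<and> R u x') = (\<exists>v. (S ^^ n) y v \<and> S v y')"
      using Suc.IH RS A(2) unfolding bi_total_def by metis
    then show ?case by auto
  qed
qed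

lemma side_parametric [transfer_rule]:
  "((A ===> A ===> (=)) ===> A ===> A ===> A ===> (=)) side side"
  unfolding side_def minus_edge_def by transfer_prover

lemma up_parametric [transfer_rule]: "((A ===> A ===> (=)) ===> A ===> A ===> (=)) up up"
  unfolding up_def by transfer_prover

lemma core_parametric [transfer_rule]: "((A ===> A ===> (=)) ===> A ===> (=)) core core"
  unfolding core_def by transfer_prover

lemma trifurcation_parametric [transfer_rule]:
  "((A ===> A ===> (=)) ===> A ===> (=)) trifurcation trifurcation"
  unfolding trifurcation_def by transfer_prover

lemma reference_edge_parametric [transfer_rule]:
  "((A ===> A ===> (=)) ===> A ===> A ===> (=)) reference_edge reference_edge"
  unfolding reference_edge_def by transfer_prover

lemma parent_parametric [transfer_rule]:
  "((A ===> A ===> (=)) ===> A ===> A ===> (=) ===> A ===> A ===> (=)) parent parent"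
  unfolding parent_def coherent_def by transfer_prover

lemma colour_parametric [transfer_rule]:
  "((A ===> A ===> (=)) ===> A ===> (=) ===> A ===> (=)) colour colour"
  unfolding colour_def by transfer_prover

lemma tree_prec_parametric [transfer_rule]:
  "((A ===> A ===> (=)) ===> (A ===> (=)) ===> (A ===> (=)) ===> (A ===> (=)) ===> A ===> A ===> (=))
    tree_prec tree_prec"
  unfolding tree_prec_def branch_def key_def by transfer_prover

lemma linked_parametric [transfer_rule]:
  "((A ===> A ===> (=)) ===> A ===> A ===> (=)) linked linked"
  unfolding linked_def consecutive_def by transfer_prover

lemma ray_parametric [transfer_rule]:
  "((A ===> A ===> (=)) ===> (A ===> (=)) ===> A ===> A ===> (=) ===> (=) ===> A ===> A ===> (=)) ray ray"
  unfolding ray_def by transfer_prover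

lemma min_tree_parametric [transfer_rule]:
  "((A ===> A ===> (=)) ===> ((=) ===> A ===> A ===> (=)) ===> (A ===> A ===> (=)) ===> A ===> A ===> (=))
    min_tree min_tree"
  unfolding min_tree_def lighter_def by transfer_prover

end

section \<open>Measurability\<close>

context
  fixes M :: "'w measure"
begin

lemma pred_rtranclp [measurable (raw)]:
  fixes R :: "'w \<Rightarrow> 'a :: countable \<Rightarrow> 'a \<Rightarrow> bool"
  assumes [measurable]: "\<And>x y. Measurable.pred M (\<lambda>\<omega>. R \<omega> x y)"
  shows "Measurable.pred M (\<lambda>\<omega>. (R \<omega>)\<^sup>*\<^sup>* x y)"
proof -
  have "Measurable.pred M (\<lambda>\<omega>. (R \<omega> ^^ n) x y)" for n :: nat
    by (induction n arbitrary: y) (auto simp: OO_def)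
  then show ?thesis unfolding rtranclp_power by measurable
qed

lemma pred_relpowp [measurable (raw)]:
  fixes R :: "'w \<Rightarrow> 'a :: countable \<Rightarrow> 'a \<Rightarrow> bool"
  assumes [measurable]: "\<And>x y. Measurable.pred M (\<lambda>\<omega>. R \<omega> x y)"
  shows "Measurable.pred M (\<lambda>\<omega>. (R \<omega> ^^ n) x y)"
  by (induction n arbitrary: y) (auto simp: OO_def)

text \<open>Over a countable type, finiteness is a countable union over the lists that may cover the
  set.\<close>

lemma pred_finite_Collect [measurable (raw)]:
  fixes Q :: "'w \<Rightarrow> 'a :: countable \<Rightarrow> bool"
  assumes [measurable]: "\<And>x. Measurable.pred M (\<lambda>\<omega>. Q \<omega> x)"
  shows "Measurable.pred M (\<lambda>\<omega>. finite (Collect (Q \<omega>)))"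
proof -
  have "finite (Collect (Q \<omega>)) \<longleftrightarrow> (\<exists>xs. \<forall>x. Q \<omega> x \<longrightarrow> x \<in> set xs)" for \<omega>
  proof
    assume "finite (Collect (Q \<omega>))"
    then obtain xs where "set xs = Collect (Q \<omega>)" using finite_list by blast
    then show "\<exists>xs. \<forall>x. Q \<omega> x \<longrightarrow> x \<in> set xs" by blast
  next
    assume "\<exists>xs. \<forall>x. Q \<omega> x \<longrightarrow> x \<in> set xs"
    then obtain xs where "Collect (Q \<omega>) \<subseteq> set xs" by blast
    then show "finite (Collect (Q \<omega>))" by (rule finite_subset) simp
  qed
  then show ?thesis by simp
qed

context
  fixes T :: "'w \<Rightarrow> 'a :: countable \<Rightarrow> 'a \<Rightarrow> bool"
  assumes T[measurable]: "\<And>x y. Measurable.pred M (\<lambda>\<omega>. T \<omega> x y)"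
begin

lemma pred_side [measurable]: "Measurable.pred M (\<lambda>\<omega>. side (T \<omega>) x y z)"
  unfolding side_def minus_edge_def by measurable

lemma pred_up [measurable]: "Measurable.pred M (\<lambda>\<omega>. up (T \<omega>) x y)"
  unfolding up_def by measurable

lemma pred_core [measurable]: "Measurable.pred M (\<lambda>\<omega>. core (T \<omega>) x)"
  unfolding core_def by measurable

lemma pred_trifurcation [measurable]: "Measurable.pred M (\<lambda>\<omega>. trifurcation (T \<omega>) x)"
  unfolding trifurcation_def by measurable

lemma pred_reference_edge [measurable]: "Measurable.pred M (\<lambda>\<omega>. reference_edge (T \<omega>) a b)"
  unfolding reference_edge_def by measurable

lemma pred_parent [measurable]: "Measurable.pred M (\<lambda>\<omega>. parent (T \<omega>) a b \<beta> x y)"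
  unfolding parent_def coherent_def by measurable

lemma pred_colour [measurable]: "Measurable.pred M (\<lambda>\<omega>. colour (T \<omega>) a \<gamma> x)"
  unfolding colour_def by measurable

lemma pred_ray:
  assumes [measurable]: "\<And>x. (\<lambda>\<omega>. lab \<omega> x) \<in> borel_measurable M"
  shows "Measurable.pred M (\<lambda>\<omega>. ray (T \<omega>) (lab \<omega>) a b \<beta> \<gamma> x y)"
proof -
  have [measurable]: "(\<lambda>\<omega>. key (core (T \<omega>)) (colour (T \<omega>) a \<gamma>) (lab \<omega>) z u) \<in> borel_measurable M" for z u
    unfolding key_def by measurable
  have [measurable]: "Measurable.pred M
      (\<lambda>\<omega>. tree_prec (parent (T \<omega>) a b \<beta>) (core (T \<omega>)) (colour (T \<omega>) a \<gamma>) (lab \<omega>) x y)" for x y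
    unfolding tree_prec_def branch_def by measurable
  show ?thesis unfolding ray_def linked_def consecutive_def by measurable
qed

end

lemma pred_min_tree:
  fixes adj :: "'a :: countable \<Rightarrow> 'a \<Rightarrow> bool"
  assumes [measurable]: "\<And>N x y. Measurable.pred M (\<lambda>\<omega>. lev \<omega> N x y)"
    and [measurable]: "\<And>x y. (\<lambda>\<omega>. w \<omega> x y) \<in> borel_measurable M"
  shows "Measurable.pred M (\<lambda>\<omega>. min_tree adj (lev \<omega>) (w \<omega>) x y)"
  unfolding min_tree_def lighter_def by measurable

end

section \<open>The random spanning tree and its double rays\<close>

definition unif :: "real measure" where
  "unif = uniform_measure lborel {0..1}"

lemma sets_unif [measurable_cong, simp]: "sets unif = sets borel"
  by (simp add: unif_def)

lemma space_unif [simp]: "space unif = UNIV"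
  by (simp add: unif_def)

lemma prob_space_unif: "prob_space unif"
  unfolding unif_def by (rule prob_space_uniform_measure) auto

interpretation unif: prob_space unif
  by (rule prob_space_unif)

lemma measure_unif: "A \<in> sets borel \<Longrightarrow> measure unif A = measure lborel ({0..1} \<inter> A)"
  by (simp add: unif_def measure_uniform_measure)

lemma measure_unif_less: "0 \<le> p \<Longrightarrow> p \<le> 1 \<Longrightarrow> measure unif {..<p} = p"
proof -
  assume p: "0 \<le> p" "p \<le> 1"
  then have "{0..1} \<inter> {..<p} = {0..<p}" by auto
  then show ?thesis using p by (simp add: measure_unif)
qed

lemma measure_unif_ge: "0 \<le> p \<Longrightarrow> p \<le> 1 \<Longrightarrow> measure unif {p..} = 1 - p"
proof -
  assume p: "0 \<le> p" "p \<le> 1"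
  then have "{0..1} \<inter> {p..} = {p..1}" by auto
  then show ?thesis using p by (simp add: measure_unif)
qed

text \<open>Stage \<open>0\<close> labels vertices and edges (as lists of length one and two), stage \<open>Suc n\<close> decides which
  translates of the \<open>n\<close>-th Foelner set are chosen. Indexing by lists makes the automorphisms act on a
  countable type.\<close>

definition labels :: "('a list \<times> nat \<Rightarrow> real) measure" where
  "labels = (\<Pi>\<^sub>M i\<in>UNIV. unif)"

definition relabel :: "('a \<Rightarrow> 'a) \<Rightarrow> ('a list \<times> nat \<Rightarrow> real) \<Rightarrow> 'a list \<times> nat \<Rightarrow> real" where
  "relabel g \<omega> = (\<lambda>(L, n). \<omega> (map g L, n))"

lemma space_labels [simp]: "space labels = UNIV"
  by (simp add: labels_def space_PiM)

interpretation labels: prob_space labels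
  unfolding labels_def by (rule prob_space_PiM) (rule prob_space_unif)

lemma measurable_label [measurable]: "(\<lambda>\<omega>. \<omega> i) \<in> borel_measurable labels"
proof -
  have "(\<lambda>\<omega>. \<omega> i) \<in> measurable labels unif"
    unfolding labels_def by (rule measurable_component_singleton) simp
  then show ?thesis by (simp cong: measurable_cong_sets)
qed

lemma prob_labels:
  assumes "finite J" "\<And>i. i \<in> J \<Longrightarrow> X i \<in> sets borel"
  shows "labels.prob {\<omega>. \<forall>i\<in>J. \<omega> i \<in> X i} = (\<Prod>i\<in>J. measure unif (X i))"
proof -
  interpret product_prob_space "\<lambda>_. unif" "UNIV :: ('a list \<times> nat) set"
    by (intro product_prob_spaceI prob_space_unif)
  have "emeasure labels {\<omega>. \<forall>i\<in>J. \<omega> i \<in> X i} = (\<Prod>i\<in>J. emeasure unif (X i))"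
    using emeasure_PiM_Collect[of J X] assms unfolding labels_def by (simp add: space_PiM)
  then show ?thesis
    by (simp add: labels.emeasure_eq_measure unif.emeasure_eq_measure prod_ennreal prod_nonneg)
qed

lemma distr_relabel:
  assumes "inj g"
  shows "relabel g \<in> measurable labels labels" "distr labels labels (relabel g) = labels"
proof -
  have eq: "relabel g = (\<lambda>\<omega>. \<lambda>i\<in>UNIV. \<omega> (case i of (L, n) \<Rightarrow> (map g L, n)))"
    by (auto simp: relabel_def fun_eq_iff)
  have "inj (\<lambda>i. case i of (L, n :: nat) \<Rightarrow> (map g L, n))"
    using assms by (auto simp: inj_on_def inj_map_eq_map)
  then show "distr labels labels (relabel g) = labels"
    unfolding eq labels_def by (intro distr_PiM_reindex prob_space_unif) auto
  show "relabel g \<in> measurable labels labels"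
    unfolding eq labels_def by (rule measurable_restrict) (auto intro!: measurable_component_singleton)
qed

text \<open>Equal labels in the unit interval fall into the same of \<open>k + 1\<close> intervals
  of length \<open>1 / k\<close>, the last one being there for the value 1. This has probability at
  most \<open>(k + 1) / (k * k) \<le> 2 / k\<close>, for every positive \<open>k\<close>.\<close>

lemma AE_labels_neq:
  assumes "i \<noteq> j"
  shows "AE \<omega> in labels. \<omega> i \<noteq> \<omega> j"
proof -
  define E where "E = {\<omega> :: 'a list \<times> nat \<Rightarrow> real. \<omega> i = \<omega> j}"
  have E[measurable]: "E \<in> sets labels"
  proof -
    have "{\<omega> \<in> space labels. \<omega> i = \<omega> j} \<in> sets labels" by measurable
    then show ?thesis by (simp add: E_def)
  qed
  have bound: "labels.prob E \<le> 2 / k" if "k > 0" for k :: nat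
  proof -
    define I where "I m = {real m / k ..< real (Suc m) / k}" for m
    define C where "C m = {\<omega> :: 'a list \<times> nat \<Rightarrow> real. \<forall>l\<in>{i, j}. \<omega> l \<in> I m}" for m
    define Z where "Z = {\<omega> :: 'a list \<times> nat \<Rightarrow> real. \<forall>l\<in>{i}. \<omega> l \<in> - {0..1}}"
    have [measurable]: "C m \<in> sets labels" for m
    proof -
      have "{\<omega> \<in> space labels. \<omega> i \<in> I m \<and> \<omega> j \<in> I m} \<in> sets labels" unfolding I_def by measurable
      then show ?thesis by (simp add: C_def)
    qed
    have [measurable]: "Z \<in> sets labels"
    proof -
      have "{\<omega> \<in> space labels. \<omega> i \<in> - {0..1}} \<in> sets labels" by measurable
      then show ?thesis by (simp add: Z_def)
    qed
    have "E \<subseteq> Z \<union> (\<Union>m\<le>k. C m)"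
    proof
      fix \<omega> assume \<omega>: "\<omega> \<in> E"
      show "\<omega> \<in> Z \<union> (\<Union>m\<le>k. C m)"
      proof (cases "\<omega> i \<in> {0..1}")
        case True
        define m where "m = nat \<lfloor>\<omega> i * k\<rfloor>"
        have "real m = of_int \<lfloor>\<omega> i * k\<rfloor>" using True by (simp add: m_def)
        then have m: "real m \<le> \<omega> i * k" "\<omega> i * k < real (Suc m)"
          unfolding of_nat_Suc by linarith+
        have "\<omega> i * k \<le> k" using True by (intro mult_left_le_one_le) auto
        then have "m \<le> k" using m(1) by linarith
        moreover have "\<omega> i \<in> I m" using m that unfolding I_def by (simp add: field_simps)
        ultimately show ?thesis using \<omega> by (auto simp: C_def E_def)
      qed (simp add: Z_def)
    qed
    then have "labels.prob E \<le> labels.prob (Z \<union> (\<Union>m\<le>k. C m))"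
      by (intro labels.finite_measure_mono) auto
    also have "\<dots> \<le> labels.prob Z + labels.prob (\<Union>m\<le>k. C m)"
      by (intro measure_Un_le) auto
    also have "labels.prob (\<Union>m\<le>k. C m) \<le> (\<Sum>m\<le>k. labels.prob (C m))"
      by (intro measure_UNION_le) auto
    also have "labels.prob Z = 0"
    proof -
      have "{0..1} \<inter> - {0..1} = ({} :: real set)" by auto
      then show ?thesis unfolding Z_def by (subst prob_labels) (auto simp: measure_unif)
    qed
    also have "(\<Sum>m\<le>k. labels.prob (C m)) \<le> (\<Sum>m\<le>k. (1 / k) * (1 / k))"
    proof (rule sum_mono)
      fix m
      have le: "real m / k \<le> real (Suc m) / k" by (simp add: divide_right_mono)
      then have fm: "I m \<in> fmeasurable lborel" by (simp add: I_def fmeasurable_def)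
      have "measure unif (I m) = measure lborel ({0..1} \<inter> I m)" by (rule measure_unif) (simp add: I_def)
      also have "\<dots> \<le> measure lborel (I m)"
        by (rule measure_mono_fmeasurable[OF Int_lower2 _ fm]) (simp add: I_def)
      also have "\<dots> = 1 / k" using that le by (simp add: I_def diff_divide_distrib[symmetric])
      finally have "measure unif (I m) \<le> 1 / k" .
      then have "measure unif (I m) * measure unif (I m) \<le> (1 / k) * (1 / k)"
        by (intro mult_mono) auto
      moreover have "labels.prob (C m) = measure unif (I m) * measure unif (I m)"
        using assms unfolding C_def by (subst prob_labels) (auto simp: I_def)
      ultimately show "labels.prob (C m) \<le> (1 / k) * (1 / k)" by simp
    qed
    also have "\<dots> \<le> 2 / k" using that by (simp add: field_simps)
    finally show ?thesis by simp
  qed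
  have "labels.prob E \<le> 0"
  proof (rule field_le_epsilon)
    fix e :: real assume "e > 0"
    then obtain k :: nat where "2 / e < k" using reals_Archimedean2 by blast
    moreover have "0 < 2 / e" using \<open>e > 0\<close> by simp
    ultimately have "k > 0" by (intro gr0I) auto
    then have "2 / k < e" using \<open>2 / e < k\<close> \<open>e > 0\<close> by (simp add: field_simps)
    then show "labels.prob E \<le> 0 + e" using bound[OF \<open>k > 0\<close>] by linarith
  qed
  then have "E \<in> null_sets labels"
    using E by (simp add: labels.emeasure_eq_measure measure_le_0_iff null_sets_def)
  then have "AE \<omega> in labels. \<omega> \<notin> E" by (rule AE_not_in)
  then show ?thesis by (simp add: E_def)
qed

section \<open>Random choice of translates\<close>

definition chosen :: "'a list set \<Rightarrow> real \<Rightarrow> nat \<Rightarrow> ('a list \<times> nat \<Rightarrow> real) \<Rightarrow> 'a list \<Rightarrow> bool" where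
  "chosen LL p n \<omega> L \<longleftrightarrow> L \<in> LL \<and> \<omega> (L, Suc n) < p"

definition kept :: "'a list set \<Rightarrow> real \<Rightarrow> nat \<Rightarrow> ('a list \<times> nat \<Rightarrow> real) \<Rightarrow> 'a \<Rightarrow> 'a \<Rightarrow> bool" where
  "kept LL p n \<omega> x y \<longleftrightarrow> (\<exists>L. chosen LL p n \<omega> L \<and> x \<in> set L \<and> y \<in> set L) \<and>
    (\<forall>L. chosen LL p n \<omega> L \<longrightarrow> (x \<in> set L \<longleftrightarrow> y \<in> set L))"

lemma pred_kept [measurable]:
  "Measurable.pred labels (\<lambda>\<omega>. kept LL p n \<omega> x (y :: 'a :: countable))"
  unfolding kept_def chosen_def by measurable

text \<open>A path of kept edges cannot leave a chosen translate, and a vertex in no chosen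
  translate is isolated.\<close>

lemma kept_component_finite:
  assumes "\<And>u v. R u v \<Longrightarrow> kept LL p n \<omega> u v"
  shows "finite {z. R\<^sup>*\<^sup>* x z}"
proof (cases "\<exists>L. chosen LL p n \<omega> L \<and> x \<in> set L")
  case True
  then obtain L where L: "chosen LL p n \<omega> L" "x \<in> set L" by blast
  have "R\<^sup>*\<^sup>* x z \<Longrightarrow> z \<in> set L" for z
    by (induction rule: rtranclp_induct) (use L assms in \<open>auto simp: kept_def\<close>)
  then have "{z. R\<^sup>*\<^sup>* x z} \<subseteq> set L" by blast
  then show ?thesis by (rule finite_subset) simp
next
  case False
  then have "\<not> R x z" for z using assms[of x z] unfolding kept_def by blast
  then have "{z. R\<^sup>*\<^sup>* x z} \<subseteq> {x}" by (auto elim: converse_rtranclpE)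
  then show ?thesis using finite_subset by blast
qed

context amenable_graph
begin

lemma kept_relabel:
  assumes "g \<in> G"
  shows "kept (orbit L0) p n (relabel g \<omega>) x y \<longleftrightarrow> kept (orbit L0) p n \<omega> (g x) (g y)"
proof -
  have mem: "g z \<in> set (map g L) \<longleftrightarrow> z \<in> set L" for z L
    using G_bij[OF assms] by (simp add: bij_is_inj inj_image_mem_iff)
  have ch: "chosen (orbit L0) p n (relabel g \<omega>) L \<longleftrightarrow> chosen (orbit L0) p n \<omega> (map g L)" for L
    using map_orbit_iff[OF assms] by (simp add: chosen_def relabel_def)
  have surj: "\<exists>M. L = map g M" for L
    using G_bij[OF assms] by (metis bij_is_surj ex_map_conv surjD)
  have "(\<exists>L. Q L) \<longleftrightarrow> (\<exists>M. Q (map g M))" "(\<forall>L. Q L) \<longleftrightarrow> (\<forall>M. Q (map g M))" for Q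
    using surj by metis+
  note this(1)[of "\<lambda>L. chosen (orbit L0) p n \<omega> L \<and> g x \<in> set L \<and> g y \<in> set L"]
    this(2)[of "\<lambda>L. chosen (orbit L0) p n \<omega> L \<longrightarrow> (g x \<in> set L \<longleftrightarrow> g y \<in> set L)"]
  then show ?thesis unfolding kept_def ch by (simp only: mem)
qed

end

text \<open>An edge fails to be kept only if no translate through \<open>x\<close> is chosen or a
  chosen one separates \<open>x\<close> from \<open>y\<close>. With \<open>p = c / d\<close> the
  former has probability at most \<open>(1 - c / d) ^ d \<le> exp (- c) \<le> \<delta> / 2\<close>;
  if \<open>c / d\<close> exceeds 1, then \<open>p = 1\<close> and it has probability 0. At most
  \<open>2 * (\<delta> / (4 * c)) * d\<close> translates separate, each chosen with probability at
  most \<open>c / d\<close>, which makes another \<open>\<delta> / 2\<close>.\<close>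

lemma kept_likely:
  fixes \<delta> :: real and adj :: "'b :: countable \<Rightarrow> 'b \<Rightarrow> bool"
  assumes "amenable_graph adj G" "\<delta> > 0"
  shows "\<exists>L0 p. \<forall>n x y. adj x y \<longrightarrow>
    labels.prob {\<omega>. \<not> kept (transitive_graph.orbit G L0) p n \<omega> x y} \<le> \<delta>"
proof -
  interpret amenable_graph adj G by fact
  \<comment> \<open>The maximum keeps \<open>c\<close> positive when \<delta> is large.\<close>
  define c where "c = max 1 (ln (2 / \<delta>))"
  have c: "c > 0" "exp (- c) \<le> \<delta> / 2"
  proof -
    have "exp (- c) \<le> exp (- ln (2 / \<delta>))" by (simp add: c_def)
    also have "\<dots> = \<delta> / 2" using assms by (simp add: exp_minus)
    finally show "exp (- c) \<le> \<delta> / 2" .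
  qed (simp add: c_def)
  have pos: "\<delta> / (4 * c) > 0" using c assms by simp
  obtain L0 d where d: "d > 0" and S: "\<And>x. finite {L \<in> orbit L0. x \<in> set L}"
      "\<And>x. card {L \<in> orbit L0. x \<in> set L} = d"
    and cut: "\<And>x y. adj x y \<Longrightarrow> real (card {L \<in> orbit L0. x \<in> set L \<and> y \<notin> set L}) \<le> \<delta> / (4 * c) * d"
    using orbit_covering[OF pos] by blast
  define p where "p = min 1 (c / d)"
  have p: "0 \<le> p" "p \<le> 1" "p \<le> c / d" using c by (auto simp: p_def)
  have uncovered: "(1 - p) ^ d \<le> \<delta> / 2"
  proof (cases "c / d \<ge> 1")
    case True
    then have "p = 1" by (simp add: p_def)
    then show ?thesis using d assms by (simp add: zero_power)
  next
    case False
    then have "p = c / d" by (simp add: p_def)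
    moreover have "1 - p \<le> exp (- p)" using exp_ge_add_one_self[of "- p"] by simp
    ultimately have "(1 - p) ^ d \<le> exp (- (c / d)) ^ d" using p by (intro power_mono) auto
    also have "\<dots> = exp (- c)" using d by (simp flip: exp_of_nat_mult)
    finally show ?thesis using c by linarith
  qed
  have "labels.prob {\<omega>. \<not> kept (orbit L0) p n \<omega> x y} \<le> \<delta>" if "adj x y" for n x y
  proof -
    define U where "U = {\<omega> :: 'b list \<times> nat \<Rightarrow> real. \<forall>i\<in>(\<lambda>L. (L, Suc n)) ` {L \<in> orbit L0. x \<in> set L}. \<omega> i \<in> {p..}}"
    define C where "C = {L \<in> orbit L0. x \<in> set L \<and> y \<notin> set L} \<union> {L \<in> orbit L0. y \<in> set L \<and> x \<notin> set L}"
    define W where "W L = {\<omega> :: 'b list \<times> nat \<Rightarrow> real. \<forall>i\<in>{(L, Suc n)}. \<omega> i \<in> {..<p}}" for L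
    have finC: "finite C"
      by (rule finite_subset[OF _ finite_UnI[OF S(1)[of x] S(1)[of y]]]) (auto simp: C_def)
    have U: "labels.prob U = (1 - p) ^ d"
    proof -
      have "card ((\<lambda>L. (L, Suc n)) ` {L \<in> orbit L0. x \<in> set L}) = d"
        using S(2)[of x] by (subst card_image) (auto simp: inj_on_def)
      then show ?thesis
        unfolding U_def by (subst prob_labels) (use S(1) p in \<open>auto simp: measure_unif_ge\<close>)
    qed
    have W: "labels.prob (W L) = p" for L
      unfolding W_def by (subst prob_labels) (use p in \<open>auto simp: measure_unif_less\<close>)
    have [measurable]: "U \<in> sets labels"
    proof -
      have "{\<omega> \<in> space labels. \<forall>L. L \<in> orbit L0 \<and> x \<in> set L \<longrightarrow> p \<le> \<omega> (L, Suc n)} \<in> sets labels"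
        by measurable
      moreover have "U = {\<omega> \<in> space labels. \<forall>L. L \<in> orbit L0 \<and> x \<in> set L \<longrightarrow> p \<le> \<omega> (L, Suc n)}"
        by (auto simp: U_def)
      ultimately show ?thesis by simp
    qed
    have [measurable]: "W L \<in> sets labels" for L
    proof -
      have "{\<omega> \<in> space labels. \<omega> (L, Suc n) < p} \<in> sets labels" by measurable
      then show ?thesis by (simp add: W_def)
    qed
    have "{\<omega>. \<not> kept (orbit L0) p n \<omega> x y} \<subseteq> U \<union> (\<Union>L\<in>C. W L)"
    proof
      fix \<omega> assume \<omega>: "\<omega> \<in> {\<omega>. \<not> kept (orbit L0) p n \<omega> x y}"
      show "\<omega> \<in> U \<union> (\<Union>L\<in>C. W L)"
      proof (rule ccontr)
        assume no: "\<omega> \<notin> U \<union> (\<Union>L\<in>C. W L)"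
        then have sep: "x \<in> set L \<longleftrightarrow> y \<in> set L" if "chosen (orbit L0) p n \<omega> L" for L
          using that by (auto simp: C_def W_def chosen_def)
        moreover obtain L where "chosen (orbit L0) p n \<omega> L" "x \<in> set L"
          using no by (auto simp: U_def chosen_def not_le)
        ultimately have "kept (orbit L0) p n \<omega> x y" unfolding kept_def by blast
        then show False using \<omega> by blast
      qed
    qed
    then have "labels.prob {\<omega>. \<not> kept (orbit L0) p n \<omega> x y} \<le> labels.prob (U \<union> (\<Union>L\<in>C. W L))"
      using finC by (intro labels.finite_measure_mono) auto
    also have "\<dots> \<le> labels.prob U + labels.prob (\<Union>L\<in>C. W L)"
      using finC by (intro measure_Un_le) auto
    also have "labels.prob (\<Union>L\<in>C. W L) \<le> (\<Sum>L\<in>C. labels.prob (W L))"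
      using finC by (intro measure_UNION_le) auto
    also have "\<dots> = card C * p" by (simp add: W)
    also have "\<dots> \<le> (\<delta> / (2 * c) * d) * (c / d)"
    proof (rule mult_mono)
      have "card C \<le> card {L \<in> orbit L0. x \<in> set L \<and> y \<notin> set L} + card {L \<in> orbit L0. y \<in> set L \<and> x \<notin> set L}"
        unfolding C_def by (rule card_Un_le)
      then have "real (card C) \<le> \<delta> / (4 * c) * d + \<delta> / (4 * c) * d"
        using cut[OF that] cut[OF adj_sym[OF that]] by linarith
      then show "real (card C) \<le> \<delta> / (2 * c) * d" by (simp add: field_simps)
    qed (use p c d assms in auto)
    also have "\<dots> = \<delta> / 2" using c d by simp
    finally show ?thesis using U uncovered by simp
  qed
  then show ?thesis by blast
qed

text \<open>The bounds are summable in \<open>n\<close>, so by Borel-Cantelli every edge is almost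
  surely kept at all late stages.\<close>

locale percolation = amenable_graph adj G
  for adj :: "'a :: countable \<Rightarrow> 'a \<Rightarrow> bool" and G +
  fixes seed :: "nat \<Rightarrow> 'a list" and density :: "nat \<Rightarrow> real"
  assumes rarely_cut: "adj x y \<Longrightarrow>
    labels.prob {\<omega>. \<not> kept (orbit (seed n)) (density n) n \<omega> x y} \<le> (1 / 2) ^ n"
begin

section \<open>The random spanning tree\<close>

definition level :: "('a list \<times> nat \<Rightarrow> real) \<Rightarrow> nat \<Rightarrow> 'a \<Rightarrow> 'a \<Rightarrow> bool" where
  "level \<omega> N x y \<longleftrightarrow> (\<forall>n\<ge>N. kept (orbit (seed n)) (density n) n \<omega> x y)"

text \<open>The minimum makes the weight independent of the orientation of the edge; if the list
  labels are distinct, distinct edges still get distinct weights.\<close>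

definition weight :: "('a list \<times> nat \<Rightarrow> real) \<Rightarrow> 'a \<Rightarrow> 'a \<Rightarrow> real" where
  "weight \<omega> x y = min (\<omega> ([x, y], 0)) (\<omega> ([y, x], 0))"

definition vertex_label :: "('a list \<times> nat \<Rightarrow> real) \<Rightarrow> 'a \<Rightarrow> real" where
  "vertex_label \<omega> x = \<omega> ([x], 0)"

definition rtree :: "('a list \<times> nat \<Rightarrow> real) \<Rightarrow> 'a \<Rightarrow> 'a \<Rightarrow> bool" where
  "rtree \<omega> = min_tree adj (level \<omega>) (weight \<omega>)"

definition regular :: "('a list \<times> nat \<Rightarrow> real) \<Rightarrow> bool" where
  "regular \<omega> \<longleftrightarrow> (\<forall>x y. adj x y \<longrightarrow> (\<exists>N. level \<omega> N x y)) \<and> inj (\<lambda>L. \<omega> (L, 0))"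

lemma AE_regular: "AE \<omega> in labels. regular \<omega>"
proof -
  have "AE \<omega> in labels. \<exists>N. level \<omega> N x y" if "adj x y" for x y
  proof -
    define A where "A n = {\<omega>. \<not> kept (orbit (seed n)) (density n) n \<omega> x y}" for n
    have [measurable]: "A n \<in> sets labels" for n
    proof -
      have "{\<omega> \<in> space labels. \<not> kept (orbit (seed n)) (density n) n \<omega> x y} \<in> sets labels" by measurable
      then show ?thesis by (simp add: A_def)
    qed
    have "summable (\<lambda>n. labels.prob (A n))"
    proof (rule summable_comparison_test')
      show "summable (\<lambda>n. (1 / 2 :: real) ^ n)" by (simp add: summable_geometric)
      show "norm (labels.prob (A n)) \<le> (1 / 2) ^ n" if "n \<ge> 0" for n
        using rarely_cut[OF \<open>adj x y\<close>] by (simp add: A_def)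
    qed
    then have "AE \<omega> in labels. eventually (\<lambda>n. \<omega> \<in> space labels - A n) sequentially"
      by (intro borel_cantelli_AE1) (auto simp: labels.emeasure_eq_measure)
    then show ?thesis by eventually_elim (auto simp: eventually_sequentially level_def A_def)
  qed
  then have "AE \<omega> in labels. \<forall>x y. adj x y \<longrightarrow> (\<exists>N. level \<omega> N x y)"
    by (simp add: AE_all_countable)
  moreover have "AE \<omega> in labels. \<forall>L L' :: 'a list. L \<noteq> L' \<longrightarrow> \<omega> (L, 0) \<noteq> \<omega> (L', 0)"
    by (auto simp: AE_all_countable intro!: AE_labels_neq)
  ultimately show ?thesis by eventually_elim (auto simp: regular_def inj_def)
qed

lemma rtree_tree:
  assumes "regular \<omega>"
  shows "tree (rtree \<omega>)"
proof -
  have inj: "\<omega> (L, 0) = \<omega> (L', 0) \<longleftrightarrow> L = L'" for L L'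
    using assms unfolding regular_def by (simp add: inj_eq[where f = "\<lambda>L. \<omega> (L, 0)"])
  have "leveled_graph adj (level \<omega>) (weight \<omega>)"
  proof
    fix x y u v M N
    show "adj x y \<Longrightarrow> adj y x" by (rule adj_sym)
    show "adj\<^sup>*\<^sup>* x y" by (rule adj_connected)
    show "finite {y. adj x y}" by (rule adj_finite)
    show "level \<omega> N x y \<Longrightarrow> level \<omega> N y x" unfolding level_def kept_def by blast
    show "M \<le> N \<Longrightarrow> level \<omega> M x y \<Longrightarrow> level \<omega> N x y" unfolding level_def by auto
    show "adj x y \<Longrightarrow> \<exists>N. level \<omega> N x y" using assms unfolding regular_def by blast
    show "finite {z. (\<lambda>u v. adj u v \<and> level \<omega> N u v)\<^sup>*\<^sup>* x z}"
      by (rule kept_component_finite[where n = N]) (auto simp: level_def)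
    show "weight \<omega> x y = weight \<omega> y x" by (simp add: weight_def min.commute)
    show "weight \<omega> x y = weight \<omega> u v \<Longrightarrow> x = u \<and> y = v \<or> x = v \<and> y = u"
      by (auto simp: weight_def min_def inj split: if_splits)
  qed (rule infinite_vertices)
  then show ?thesis unfolding rtree_def by (rule leveled_graph.tree)
qed

lemma rtree_adj: "rtree \<omega> x y \<Longrightarrow> adj x y"
  by (simp add: rtree_def min_tree_def)

lemma pred_rtree [measurable]: "Measurable.pred labels (\<lambda>\<omega>. rtree \<omega> x y)"
  unfolding rtree_def by (rule pred_min_tree) (unfold level_def weight_def, measurable)

definition graph_of :: "('a \<Rightarrow> 'a) \<Rightarrow> 'a \<Rightarrow> 'a \<Rightarrow> bool" where
  "graph_of g x y \<longleftrightarrow> g x = y"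

lemma graph_of_bi:
  assumes "g \<in> G" shows "bi_unique (graph_of g)" "bi_total (graph_of g)"
  using G_bij[OF assms] unfolding bi_unique_def bi_total_def graph_of_def
  by (auto simp: bij_def inj_eq) (metis surjD)

lemma rtree_relabel:
  assumes "g \<in> G"
  shows "rel_fun (graph_of g) (rel_fun (graph_of g) (=)) (rtree (relabel g \<omega>)) (rtree \<omega>)"
proof -
  note [transfer_rule] = graph_of_bi[OF assms]
  have 1: "rel_fun (graph_of g) (rel_fun (graph_of g) (=)) adj adj"
    using G_adj[OF assms] by (simp add: rel_fun_def graph_of_def)
  have 2: "rel_fun (=) (rel_fun (graph_of g) (rel_fun (graph_of g) (=))) (level (relabel g \<omega>)) (level \<omega>)"
    using kept_relabel[OF assms] by (simp add: rel_fun_def graph_of_def level_def)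
  have 3: "rel_fun (graph_of g) (rel_fun (graph_of g) (=)) (weight (relabel g \<omega>)) (weight \<omega>)"
    by (simp add: rel_fun_def graph_of_def weight_def relabel_def)
  show ?thesis
    unfolding rtree_def
    by (rule min_tree_parametric[OF graph_of_bi[OF assms], THEN rel_funD, OF 1, THEN rel_funD, OF 2,
      THEN rel_funD, OF 3])
qed

text \<open>By invariance the density of trifurcations does not depend on the vertex, and on a Foelner set
  it is at most the relative size of the boundary.\<close>

lemma AE_no_trifurcation: "AE \<omega> in labels. \<forall>x. \<not> trifurcation (rtree \<omega>) x"
proof -
  define A where "A x = {\<omega>. trifurcation (rtree \<omega>) x}" for x
  have [measurable]: "A x \<in> sets labels" for x
  proof -
    have "{\<omega> \<in> space labels. trifurcation (rtree \<omega>) x} \<in> sets labels" by measurable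
    then show ?thesis by (simp add: A_def)
  qed
  have relabel: "labels.prob (A (g x)) = labels.prob (A x)" if "g \<in> G" for g x
  proof -
    have "trifurcation (rtree (relabel g \<omega>)) x = trifurcation (rtree \<omega>) (g x)" for \<omega>
      by (rule trifurcation_parametric[OF graph_of_bi[OF that], THEN rel_funD, OF rtree_relabel[OF that],
        THEN rel_funD]) (simp add: graph_of_def)
    then have "relabel g -` A x \<inter> space labels = A (g x)" by (auto simp: A_def)
    moreover have "labels.prob (A x) = labels.prob (relabel g -` A x \<inter> space labels)"
      using distr_relabel[of g] G_bij[OF that] measure_distr[of "relabel g" labels labels "A x"]
      by (simp add: bij_is_inj)
    ultimately show ?thesis by simp
  qed
  have zero: "labels.prob (A x) \<le> 0" for x
  proof (rule field_le_epsilon)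
    fix \<epsilon> :: real assume "\<epsilon> > 0"
    then obtain K where K: "finite K" "K \<noteq> {}" "finite (boundary K)" "real (card (boundary K)) \<le> \<epsilon> * card K"
      using amenable by blast
    have "card K * labels.prob (A x) = (\<Sum>y\<in>K. labels.prob (A y))"
    proof -
      have "labels.prob (A y) = labels.prob (A x)" for y
        using G_transitive[of x y] relabel by metis
      then have "(\<Sum>y\<in>K. labels.prob (A y)) = (\<Sum>y\<in>K. labels.prob (A x))" by (intro sum.cong) auto
      then show ?thesis by simp
    qed
    also have "\<dots> = (\<Sum>y\<in>K. \<integral>\<omega>. indicator (A y) \<omega> \<partial>labels)" by simp
    also have "\<dots> = (\<integral>\<omega>. (\<Sum>y\<in>K. indicator (A y) \<omega>) \<partial>labels)"
      by (rule Bochner_Integration.integral_sum[symmetric]) (auto simp: labels.emeasure_eq_measure)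
    also have "\<dots> \<le> (\<integral>\<omega>. real (card (boundary K)) \<partial>(labels :: ('a list \<times> nat \<Rightarrow> real) measure))"
    proof (rule Bochner_Integration.integral_mono_AE)
      show "AE \<omega> in labels. (\<Sum>y\<in>K. indicator (A y) \<omega>) \<le> real (card (boundary K))"
        using AE_regular
      proof eventually_elim
        case (elim \<omega>)
        then interpret tree "rtree \<omega>" by (rule rtree_tree)
        have "(\<Sum>y\<in>K. indicator (A y) \<omega> :: real) = (\<Sum>y\<in>K. if trifurcation (rtree \<omega>) y then 1 else 0)"
          by (intro sum.cong) (auto simp: A_def)
        also have "\<dots> = card {y \<in> K. trifurcation (rtree \<omega>) y}"
          using sum.inter_filter[OF K(1), of "\<lambda>_. 1 :: real"] by simp
        also have "\<dots> \<le> card {(y, z). y \<in> K \<and> z \<notin> K \<and> rtree \<omega> y z}"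
          using card_trifurcation_le[OF K(1)] by simp
        also have "\<dots> \<le> card (boundary K)"
          unfolding of_nat_le_iff using K(3) rtree_adj by (intro card_mono) (auto simp: boundary_def)
        finally show ?case .
      qed
    qed (auto simp: labels.emeasure_eq_measure)
    also have "\<dots> \<le> \<epsilon> * card K" using K by (simp add: labels.prob_space[simplified])
    finally show "labels.prob (A x) \<le> 0 + \<epsilon>" using K by (simp add: card_gt_0_iff mult.commute)
  qed
  have "AE \<omega> in labels. \<omega> \<notin> A x" for x
  proof (rule AE_not_in)
    show "A x \<in> null_sets labels"
      using zero[of x] by (simp add: labels.emeasure_eq_measure measure_le_0_iff null_sets_def)
  qed
  then show ?thesis by (simp add: AE_all_countable A_def)
qed

definition good :: "('a list \<times> nat \<Rightarrow> real) \<Rightarrow> bool" where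
  "good \<omega> \<longleftrightarrow> at_most_two_ended_tree (rtree \<omega>) \<and> inj (vertex_label \<omega>)"

lemma AE_good: "AE \<omega> in labels. good \<omega>"
  using AE_regular AE_no_trifurcation
proof eventually_elim
  case (elim \<omega>)
  then have "inj (vertex_label \<omega>)" unfolding regular_def inj_def vertex_label_def by blast
  moreover have "at_most_two_ended_tree (rtree \<omega>)"
    unfolding at_most_two_ended_tree_def at_most_two_ended_tree_axioms_def using rtree_tree elim by blast
  ultimately show ?case by (simp add: good_def)
qed

text \<open>Selecting the first reference edge in an enumeration is not equivariant; the error is a change of
  signs by \<open>ray_change_reference\<close>.\<close>

definition first_edge :: "('a list \<times> nat \<Rightarrow> real) \<Rightarrow> 'a \<Rightarrow> 'a \<Rightarrow> bool" where
  "first_edge \<omega> a b \<longleftrightarrow> reference_edge (rtree \<omega>) a b \<and>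
    (\<forall>c d. reference_edge (rtree \<omega>) c d \<longrightarrow> to_nat (a, b) \<le> to_nat (c, d))"

definition rray :: "('a list \<times> nat \<Rightarrow> real) \<Rightarrow> bool \<Rightarrow> bool \<Rightarrow> 'a \<Rightarrow> 'a \<Rightarrow> bool" where
  "rray \<omega> \<beta> \<gamma> x y \<longleftrightarrow>
    (\<exists>a b. first_edge \<omega> a b \<and> ray (rtree \<omega>) (vertex_label \<omega>) a b \<beta> \<gamma> x y)"

lemma pred_rray [measurable]: "Measurable.pred labels (\<lambda>\<omega>. rray \<omega> \<beta> \<gamma> x y)"
proof -
  have [measurable]: "Measurable.pred labels (\<lambda>\<omega>. ray (rtree \<omega>) (vertex_label \<omega>) a b \<beta> \<gamma> x y)" for a b
    by (rule pred_ray) (unfold vertex_label_def, measurable)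
  show ?thesis unfolding rray_def first_edge_def by measurable
qed

lemma first_edge_ex1:
  assumes "good \<omega>"
  obtains a b where "reference_edge (rtree \<omega>) a b"
    and "rray \<omega> = ray (rtree \<omega>) (vertex_label \<omega>) a b"
proof -
  interpret at_most_two_ended_tree "rtree \<omega>" using assms by (simp add: good_def)
  obtain a0 b0 where "reference_edge (rtree \<omega>) a0 b0" using reference_ex by blast
  then obtain e where e: "case_prod (reference_edge (rtree \<omega>)) e"
    "\<And>f. case_prod (reference_edge (rtree \<omega>)) f \<Longrightarrow> to_nat e \<le> to_nat f"
    using ex_has_least_nat[of "case_prod (reference_edge (rtree \<omega>))" "(a0, b0)" to_nat] by auto
  obtain a b where ab: "e = (a, b)" by (cases e)
  have "first_edge \<omega> c d \<longleftrightarrow> (c, d) = (a, b)" for c d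
  proof
    assume "first_edge \<omega> c d"
    then have "reference_edge (rtree \<omega>) c d" "to_nat (c, d) \<le> to_nat (a, b)"
      using e(1) ab by (simp_all add: first_edge_def)
    moreover have "to_nat (a, b) \<le> to_nat (c, d)" using e(2)[of "(c, d)"] ab calculation(1) by simp
    ultimately have "to_nat (c, d) = to_nat (a, b)" by (rule_tac order_antisym)
    then show "(c, d) = (a, b)" by (rule injD[OF inj_to_nat])
  next
    assume "(c, d) = (a, b)"
    then show "first_edge \<omega> c d" using e ab by (simp add: first_edge_def)
  qed
  then have "rray \<omega> = ray (rtree \<omega>) (vertex_label \<omega>) a b"
    unfolding rray_def fun_eq_iff by auto
  then show thesis using that e ab by auto
qed

lemma rray_double_ray:
  assumes "good \<omega>"
  shows "(rray \<omega> \<beta> \<gamma>)\<^sup>*\<^sup>* x y" "card {y. rray \<omega> \<beta> \<gamma> x y} = 2"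
    and "rray \<omega> \<beta> \<gamma> x y \<Longrightarrow> \<exists>n\<le>3. (adj ^^ n) x y"
    and "rray \<omega> \<beta> \<gamma> x y \<Longrightarrow> rray \<omega> \<beta> \<gamma> y x"
    and "\<not> rray \<omega> \<beta> \<gamma> x x"
proof -
  interpret at_most_two_ended_tree "rtree \<omega>" using assms by (simp add: good_def)
  obtain a b where ab: "reference_edge (rtree \<omega>) a b"
    "rray \<omega> = ray (rtree \<omega>) (vertex_label \<omega>) a b"
    using first_edge_ex1[OF assms] by blast
  have inj: "inj (vertex_label \<omega>)" using assms by (simp add: good_def)
  note r = ray_double_ray[OF inj ab(1), folded ab(2)]
  show "(rray \<omega> \<beta> \<gamma>)\<^sup>*\<^sup>* x y" "card {y. rray \<omega> \<beta> \<gamma> x y} = 2" by (rule r(1), rule r(2))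
  show "rray \<omega> \<beta> \<gamma> x y \<Longrightarrow> rray \<omega> \<beta> \<gamma> y x" by (rule r(4))
  show "\<not> rray \<omega> \<beta> \<gamma> x x" by (rule r(5))
  have mono: "(rtree \<omega> ^^ n) u v \<Longrightarrow> (adj ^^ n) u v" for n u v
    by (rule relpowp_mono) (rule rtree_adj)
  show "rray \<omega> \<beta> \<gamma> x y \<Longrightarrow> \<exists>n\<le>3. (adj ^^ n) x y" using r(3) mono by blast
qed

text \<open>The automorphism carries the first edge of the relabelled tree to a reference edge of
  the original one, but perhaps not to its first. The change of signs that this causes depends on
  the sample.\<close>

lemma rray_relabel:
  assumes g: "g \<in> G" and good: "good \<omega>" "good (relabel g \<omega>)"
  shows "\<exists>\<beta>' \<gamma>'. \<forall>\<beta> \<gamma> x y. rray (relabel g \<omega>) \<beta> \<gamma> x y = rray \<omega> (\<beta> = \<beta>') (\<gamma> = \<gamma>') (g x) (g y)"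
proof -
  interpret at_most_two_ended_tree "rtree \<omega>" using good by (simp add: good_def)
  have inj: "inj (vertex_label \<omega>)" using good by (simp add: good_def)
  obtain a b where ab: "reference_edge (rtree \<omega>) a b"
    "rray \<omega> = ray (rtree \<omega>) (vertex_label \<omega>) a b"
    using first_edge_ex1[OF good(1)] by blast
  obtain c d where cd: "reference_edge (rtree (relabel g \<omega>)) c d"
    "rray (relabel g \<omega>) = ray (rtree (relabel g \<omega>)) (vertex_label (relabel g \<omega>)) c d"
    using first_edge_ex1[OF good(2)] by blast
  note A = graph_of_bi[OF g] and T = rtree_relabel[OF g, of \<omega>]
  have A1: "graph_of g x (g x)" for x by (simp add: graph_of_def)
  have lab: "rel_fun (graph_of g) (=) (vertex_label (relabel g \<omega>)) (vertex_label \<omega>)"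
    by (simp add: rel_fun_def graph_of_def vertex_label_def relabel_def)
  have "reference_edge (rtree \<omega>) (g c) (g d)"
    using cd(1) reference_edge_parametric[OF A, THEN rel_funD, OF T, THEN rel_funD, OF A1,
      THEN rel_funD, OF A1] by blast
  then obtain \<beta>' \<gamma>' where sign: "\<And>\<beta> \<gamma>. ray (rtree \<omega>) (vertex_label \<omega>) (g c) (g d) \<beta> \<gamma> = rray \<omega> (\<beta> = \<beta>') (\<gamma> = \<gamma>')"
    using ray_change_reference[OF inj ab(1)] unfolding ab(2) by metis
  have "rray (relabel g \<omega>) \<beta> \<gamma> x y = ray (rtree \<omega>) (vertex_label \<omega>) (g c) (g d) \<beta> \<gamma> (g x) (g y)" for \<beta> \<gamma> x y
    unfolding cd(2)
    by (rule ray_parametric[OF A, THEN rel_funD, OF T, THEN rel_funD, OF lab, THEN rel_funD, OF A1,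
      THEN rel_funD, OF A1, THEN rel_funD, OF refl, THEN rel_funD, OF refl, THEN rel_funD, OF A1,
      THEN rel_funD, OF A1])
  then show ?thesis using sign by auto
qed

lemma AE_rray_relabel:
  assumes "g \<in> G"
  shows "AE \<omega> in labels. \<exists>\<beta>' \<gamma>'. \<forall>\<beta> \<gamma> x y.
    rray (relabel g \<omega>) \<beta> \<gamma> x y = rray \<omega> (\<beta> = \<beta>') (\<gamma> = \<gamma>') (g x) (g y)"
proof -
  have "inj g" using G_bij[OF assms] bij_is_inj by blast
  then have "AE \<omega> in distr labels labels (relabel g). good \<omega>" using distr_relabel AE_good by metis
  then have "AE \<omega> in labels. good (relabel g \<omega>)"
    using AE_distrD distr_relabel(1)[OF \<open>inj g\<close>] by blast
  with AE_good show ?thesis by eventually_elim (rule rray_relabel[OF assms])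
qed

end

section \<open>Transport to the vertex set\<close>

lemma pred_mem_subgraph:
  "Measurable.pred (subgraph_space E) (\<lambda>S. e \<in> S)"
proof -
  have sp: "space (subgraph_space E) = Pow E"
    by (simp add: subgraph_space_def space_measure_of_conv)
  have "{S \<in> Pow E. e \<in> S} \<in> cylinder_events E"
  proof (cases "e \<in> E")
    case True
    then show ?thesis unfolding cylinder_events_def by (auto intro!: exI[of _ "{e}"])
  next
    case False
    then have "{S \<in> Pow E. e \<in> S} = {}" by blast
    then show ?thesis unfolding cylinder_events_def by auto
  qed
  moreover have "cylinder_events E \<subseteq> Pow (Pow E)" by (auto simp: cylinder_events_def)
  ultimately have "{S \<in> Pow E. e \<in> S} \<in> sets (subgraph_space E)"
    by (simp add: subgraph_space_def sets_measure_of_conv sigma_sets.Basic)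
  then show ?thesis by (simp add: pred_def sp)
qed

text \<open>A cylinder event depends only on the trace on a finite set \<open>F\<close>, so its
  preimage is a finite union, over the admissible traces, of finite intersections.\<close>

lemma measurable_into_subgraph_space:
  assumes "\<And>\<omega>. f \<omega> \<subseteq> E" and [measurable]: "\<And>e. e \<in> E \<Longrightarrow> Measurable.pred M (\<lambda>\<omega>. e \<in> f \<omega>)"
  shows "f \<in> measurable M (subgraph_space E)"
  unfolding subgraph_space_def
proof (rule measurable_measure_of)
  show "cylinder_events E \<subseteq> Pow (Pow E)" by (auto simp: cylinder_events_def)
  show "f \<in> space M \<rightarrow> Pow E" using assms(1) by blast
  fix A assume "A \<in> cylinder_events E"
  then obtain F where A: "A \<subseteq> Pow E" and F: "F \<subseteq> E" "finite F"
    and dep: "\<And>S T. S \<subseteq> E \<Longrightarrow> T \<subseteq> E \<Longrightarrow> S \<inter> F = T \<inter> F \<Longrightarrow> S \<in> A \<longleftrightarrow> T \<in> A"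
    unfolding cylinder_events_def mem_Collect_eq by (metis PowI)
  have "f \<omega> \<in> A \<longleftrightarrow> (\<exists>F'\<in>Pow F \<inter> A. \<forall>e\<in>F. e \<in> f \<omega> \<longleftrightarrow> e \<in> F')" for \<omega>
  proof
    assume "f \<omega> \<in> A"
    then have "f \<omega> \<inter> F \<in> A" using dep[of "f \<omega>" "f \<omega> \<inter> F"] assms(1)[of \<omega>] by blast
    then show "\<exists>F'\<in>Pow F \<inter> A. \<forall>e\<in>F. e \<in> f \<omega> \<longleftrightarrow> e \<in> F'" by (intro bexI[of _ "f \<omega> \<inter> F"]) auto
  next
    assume "\<exists>F'\<in>Pow F \<inter> A. \<forall>e\<in>F. e \<in> f \<omega> \<longleftrightarrow> e \<in> F'"
    then obtain F' where "F' \<subseteq> F" "F' \<in> A" "\<forall>e\<in>F. e \<in> f \<omega> \<longleftrightarrow> e \<in> F'" by blast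
    then have "f \<omega> \<inter> F = F' \<inter> F" "F' \<in> A" "F' \<subseteq> E" using F by blast+
    then show "f \<omega> \<in> A" using dep[OF assms(1)] by blast
  qed
  then have "f -` A \<inter> space M = {\<omega> \<in> space M. \<exists>F'\<in>Pow F \<inter> A. \<forall>e\<in>F. e \<in> f \<omega> \<longleftrightarrow> e \<in> F'}" by blast
  moreover have "Measurable.pred M (\<lambda>\<omega>. \<exists>F'\<in>Pow F \<inter> A. \<forall>e\<in>F. e \<in> f \<omega> \<longleftrightarrow> e \<in> F')"
    using F by (intro pred_intros_finite pred_intros_logic measurable_const assms(2)) auto
  ultimately show "f -` A \<inter> space M \<in> sets M" by (simp add: pred_def)
qed

lemma rtrancl_adj_rel_image:
  assumes "S \<subseteq> {{u, v} |u v. u \<in> V \<and> v \<in> V \<and> u \<noteq> v}" "inj h" "range h = V"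
  shows "(h x, h y) \<in> (adj_rel S)\<^sup>* \<longleftrightarrow> (\<lambda>m n. {h m, h n} \<in> S)\<^sup>*\<^sup>* x y"
proof
  have "\<exists>n. z = h n \<and> (\<lambda>m n. {h m, h n} \<in> S)\<^sup>*\<^sup>* x n" if "(h x, z) \<in> (adj_rel S)\<^sup>*" for z
    using that
  proof (induction rule: rtrancl_induct)
    case (step u v)
    then obtain m where m: "u = h m" "(\<lambda>m n. {h m, h n} \<in> S)\<^sup>*\<^sup>* x m" by blast
    have "{u, v} \<in> S" using step.hyps by (simp add: adj_rel_def)
    then have "v \<in> V" using assms(1) by (auto simp: doubleton_eq_iff)
    then obtain n where "v = h n" using assms(3) by blast
    then show ?case using m \<open>{u, v} \<in> S\<close>
      by (auto intro!: exI[of _ n] intro: rtranclp.rtrancl_into_rtrancl)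
  qed auto
  then show "(h x, h y) \<in> (adj_rel S)\<^sup>* \<Longrightarrow> (\<lambda>m n. {h m, h n} \<in> S)\<^sup>*\<^sup>* x y"
    using assms(2) by (metis injD)
  show "(\<lambda>m n. {h m, h n} \<in> S)\<^sup>*\<^sup>* x y \<Longrightarrow> (h x, h y) \<in> (adj_rel S)\<^sup>*"
    by (induction rule: rtranclp_induct) (auto simp: adj_rel_def intro: rtrancl_into_rtrancl)
qed

lemma spanning_double_ray_image:
  assumes "graph V E" "inj h" "range h = V" "S \<subseteq> E"
  shows "spanning_double_ray V E S \<longleftrightarrow>
    (\<forall>x y. (\<lambda>m n. {h m, h n} \<in> S)\<^sup>*\<^sup>* x y) \<and> (\<forall>n. card {m. {h m, h n} \<in> S} = 2)"
proof -
  have S: "S \<subseteq> {{u, v} |u v. u \<in> V \<and> v \<in> V \<and> u \<noteq> v}" using assms(1,4) by (auto simp: graph_def)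
  have "{u. {u, h n} \<in> S} = h ` {m. {h m, h n} \<in> S}" for n
  proof -
    have "u \<in> range h" if "{u, h n} \<in> S" for u
      using S that assms(3) by (auto simp: doubleton_eq_iff)
    then show ?thesis by blast
  qed
  then have card: "card {u. {u, h n} \<in> S} = card {m. {h m, h n} \<in> S}" for n
    using assms(2) by (simp add: card_image inj_on_def)
  have "(\<forall>v\<in>V. card {u. {u, v} \<in> S} = 2) \<longleftrightarrow> (\<forall>n. card {m. {h m, h n} \<in> S} = 2)"
    unfolding assms(3)[symmetric] by (simp add: card)
  moreover have "graph_connected V S \<longleftrightarrow> (\<forall>x y. (\<lambda>m n. {h m, h n} \<in> S)\<^sup>*\<^sup>* x y)"
    unfolding graph_connected_def assms(3)[symmetric] by (simp add: rtrancl_adj_rel_image[OF S assms(2,3)])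
  ultimately show ?thesis unfolding spanning_double_ray_def using assms(4) by blast
qed

text \<open>Degree two is rewritten with two witnesses, so that only countable quantifiers remain.
  The event has to be measurable for the almost sure statement on a product space to be checked one
  sign pair at a time.\<close>

lemma pred_spanning_double_ray:
  fixes h :: "nat \<Rightarrow> 'v"
  assumes "graph V E" "inj h" "range h = V"
  shows "Measurable.pred (subgraph_space E) (spanning_double_ray V E)"
proof -
  note [measurable] = pred_mem_subgraph
  have "Measurable.pred (subgraph_space E) (\<lambda>S.
      (\<forall>x y. (\<lambda>m n. {h m, h n} \<in> S)\<^sup>*\<^sup>* x y) \<and> (\<forall>n. \<exists>a b. a \<noteq> b \<and> (\<forall>m. {h m, h n} \<in> S \<longleftrightarrow> m = a \<or> m = b)))"
    by measurable
  moreover have "(\<exists>a b. a \<noteq> b \<and> (\<forall>m. Q m \<longleftrightarrow> m = a \<or> m = b)) \<longleftrightarrow> card (Collect Q) = 2" for Q :: "nat \<Rightarrow> bool"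
    unfolding card_2_iff by (auto simp: set_eq_iff)
  ultimately have *: "Measurable.pred (subgraph_space E) (\<lambda>S.
      (\<forall>x y. (\<lambda>m n. {h m, h n} \<in> S)\<^sup>*\<^sup>* x y) \<and> (\<forall>n. card {m. {h m, h n} \<in> S} = 2))" by simp
  have eq: "spanning_double_ray V E S \<longleftrightarrow>
      (\<forall>x y. (\<lambda>m n. {h m, h n} \<in> S)\<^sup>*\<^sup>* x y) \<and> (\<forall>n. card {m. {h m, h n} \<in> S} = 2)"
    if "S \<in> space (subgraph_space E)" for S
    by (rule spanning_double_ray_image[OF assms])
      (use that in \<open>simp add: subgraph_space_def space_measure_of_conv\<close>)
  show ?thesis by (rule measurable_cong[THEN iffD2, OF eq *])
qed

lemma subgroup_graph_aut_group:
  assumes "graph V E" "subgroup \<Gamma> (graph_aut_group V E)"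
  shows "\<Gamma> \<subseteq> graph_auts V E"
    and "g \<in> \<Gamma> \<Longrightarrow> k \<in> \<Gamma> \<Longrightarrow> \<exists>l\<in>\<Gamma>. \<forall>v\<in>V. l v = g (k v)"
    and "g \<in> \<Gamma> \<Longrightarrow> \<exists>k\<in>\<Gamma>. \<forall>v\<in>V. k (g v) = v \<and> g (k v) = v"
proof -
  interpret group "graph_aut_group V E" by (rule group_graph_aut_group[OF assms(1)])
  interpret subgroup \<Gamma> "graph_aut_group V E" by fact
  show sub: "\<Gamma> \<subseteq> graph_auts V E" using subset by (simp add: graph_aut_group_def)
  have mult: "(g \<otimes>\<^bsub>graph_aut_group V E\<^esub> k) v = g (k v)" if "g \<in> \<Gamma>" "k \<in> \<Gamma>" "v \<in> V" for g k v
  proof -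
    have "g \<in> Bij V" "k \<in> Bij V" using sub that by (auto simp: graph_auts_def)
    then show ?thesis using that(3) by (simp add: graph_aut_group_def BijGroup_def compose_def)
  qed
  show "\<exists>l\<in>\<Gamma>. \<forall>v\<in>V. l v = g (k v)" if "g \<in> \<Gamma>" "k \<in> \<Gamma>"
    using mult[OF that] m_closed[OF that] by blast
  show "\<exists>k\<in>\<Gamma>. \<forall>v\<in>V. k (g v) = v \<and> g (k v) = v" if g: "g \<in> \<Gamma>"
  proof (intro bexI ballI conjI)
    have one: "\<one>\<^bsub>graph_aut_group V E\<^esub> v = v" if "v \<in> V" for v
      using that by (simp add: graph_aut_group_def BijGroup_def)
    show inv: "inv\<^bsub>graph_aut_group V E\<^esub> g \<in> \<Gamma>" using g by (rule m_inv_closed)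
    fix v assume "v \<in> V"
    then show "(inv\<^bsub>graph_aut_group V E\<^esub> g) (g v) = v" "g ((inv\<^bsub>graph_aut_group V E\<^esub> g) v) = v"
      using mult[OF inv g] mult[OF g inv] one l_inv r_inv mem_carrier[OF g] by metis+
  qed
qed

text \<open>An enumeration \<open>h\<close> of \<open>V\<close> moves the construction to the
  natural numbers, a countable type. The law of the random subgraph serves as \<open>M\<close>, with
  the identity as \<open>R\<close>, since the sample points have to be sets of vertex sets.\<close>

theorem theorem2:
  fixes V :: "'v set" and E :: "'v set set" and \<Gamma> :: "('v \<Rightarrow> 'v) set"
  assumes "graph V E"
    and "countable V"
    and "infinite V"
    and "graph_connected V E"
    and "graph_amenable V E"
    and "subgroup \<Gamma> (graph_aut_group V E)"
    and "closedin (graph_aut_topology V E) \<Gamma>"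
    and "vertex_transitive \<Gamma> V"
  shows "\<exists>(M :: 'v set set measure) (R :: 'v set set \<Rightarrow> 'v set set).
           random_spanning_double_ray M V (graph_power V E 3) R \<and>
           invariant_random_subgraph \<Gamma> M (graph_power V E 3) R"
proof -
  define h where "h = from_nat_into V"
  have bij: "bij_betw h UNIV V"
    unfolding h_def by (rule bij_betw_from_nat_into[OF assms(2,3)])
  have h: "inj h" "range h = V" using bij by (auto simp: bij_betw_def)
  have hV: "h n \<in> V" for n using h by blast
  note \<Gamma> = subgroup_graph_aut_group[OF assms(1,6)]
  have aut: "bij_betw g V V" "\<And>u v. u \<in> V \<Longrightarrow> v \<in> V \<Longrightarrow> {g u, g v} \<in> E \<longleftrightarrow> {u, v} \<in> E" if "g \<in> \<Gamma>" for g
    using \<Gamma>(1) that by (auto simp: graph_auts_def Bij_def)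
  define conj where "conj g n = inv_into UNIV h (g (h n))" for g n
  have conj: "h (conj g n) = g (h n)" if "g \<in> \<Gamma>" for g n
  proof -
    have "g (h n) \<in> range h" using aut(1)[OF that] hV h(2) by (auto simp: bij_betw_def)
    then show ?thesis unfolding conj_def by (rule f_inv_into_f)
  qed
  define adj where "adj m n \<longleftrightarrow> {h m, h n} \<in> E" for m n
  define G where "G = conj ` \<Gamma>"
  have E_sub: "E \<subseteq> {{u, v} |u v. u \<in> V \<and> v \<in> V \<and> u \<noteq> v}" using assms(1) by (simp add: graph_def)
  interpret transitive_graph adj G
  proof
    fix x y :: nat and g k :: "nat \<Rightarrow> nat"
    show "adj x y \<Longrightarrow> adj y x" by (simp add: adj_def insert_commute)
    show "adj\<^sup>*\<^sup>* x y"
      using assms(4) hV rtrancl_adj_rel_image[OF E_sub h] unfolding graph_connected_def adj_def by blast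
    show "infinite (UNIV :: nat set)" by simp
    show "\<exists>g\<in>G. g x = y"
    proof -
      obtain a where a: "a \<in> \<Gamma>" "a (h x) = h y"
        using assms(8) hV unfolding vertex_transitive_def by blast
      then have "conj a x = y" using conj h(1) by (metis injD)
      then show ?thesis using a(1) by (auto simp: G_def)
    qed
    assume "g \<in> G"
    then obtain a where a: "a \<in> \<Gamma>" "g = conj a" by (auto simp: G_def)
    show "adj (g x) (g y) \<longleftrightarrow> adj x y" using aut(2)[OF a(1) hV hV] conj[OF a(1)] by (simp add: adj_def a)
    show "\<exists>k\<in>G. g \<circ> k = id \<and> k \<circ> g = id"
    proof -
      obtain b where b: "b \<in> \<Gamma>" "\<And>v. v \<in> V \<Longrightarrow> b (a v) = v \<and> a (b v) = v" using \<Gamma>(3)[OF a(1)] by blast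
      have "h (conj a (conj b n)) = h n" "h (conj b (conj a n)) = h n" for n
        using conj a b hV by simp_all
      then have "conj a \<circ> conj b = id" "conj b \<circ> conj a = id" using h(1) by (auto simp: fun_eq_iff inj_eq)
      then show ?thesis using b(1) a by (auto simp: G_def)
    qed
    assume "k \<in> G"
    then obtain b where b: "b \<in> \<Gamma>" "k = conj b" by (auto simp: G_def)
    obtain c where c: "c \<in> \<Gamma>" "\<And>v. v \<in> V \<Longrightarrow> c v = a (b v)" using \<Gamma>(2)[OF a(1) b(1)] by blast
    have "h (g (k n)) = h (conj c n)" for n using conj a b c hV by simp
    then have "g \<circ> k = conj c" using h(1) by (auto simp: fun_eq_iff inj_eq)
    then show "g \<circ> k \<in> G" using c(1) by (simp add: G_def)
  qed
  have am: "amenable_graph adj G"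
  proof
    fix \<epsilon> :: real assume "\<epsilon> > 0"
    then obtain F where F: "F \<subseteq> V" "finite F" "F \<noteq> {}" "finite (edge_boundary E F)"
      "real (card (edge_boundary E F)) \<le> \<epsilon> * real (card F)"
      using assms(5) unfolding graph_amenable_def by blast
    define F' where "F' = h -` F"
    have F': "F = h ` F'" using F(1) h(2) by (auto simp: F'_def)
    have inj: "inj_on (\<lambda>(m, n). {h m, h n}) (boundary F')"
      by (rule inj_onI) (auto simp: boundary_def doubleton_eq_iff inj_eq[OF h(1)])
    have sub: "(\<lambda>(m, n). {h m, h n}) ` boundary F' \<subseteq> edge_boundary E F"
    proof clarify
      fix m n assume mn: "(m, n) \<in> boundary F'"
      then have "{h m, h n} \<inter> F = {h m}" by (auto simp: boundary_def F'_def)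
      then show "{h m, h n} \<in> edge_boundary E F" using mn by (simp add: edge_boundary_def boundary_def adj_def)
    qed
    have "finite (boundary F')" by (rule inj_on_finite[OF inj sub F(4)])
    moreover have "card (boundary F') \<le> card (edge_boundary E F)" by (rule card_inj_on_le[OF inj sub F(4)])
    moreover have "inj_on h F'" using h(1) by (rule inj_on_subset) simp
    then have "card F' = card F" "finite F'" "F' \<noteq> {}"
      using F(2,3) F' by (simp_all add: card_image finite_image_iff)
    ultimately show "\<exists>F. finite F \<and> F \<noteq> {} \<and> finite (boundary F) \<and> real (card (boundary F)) \<le> \<epsilon> * real (card F)"
      using F(5) by (intro exI[of _ F']) auto
  qed
  have "\<exists>L0 p. \<forall>m x y. adj x y \<longrightarrow> labels.prob {\<omega>. \<not> kept (orbit L0) p m \<omega> x y} \<le> (1 / 2) ^ n" for n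
    by (rule kept_likely[OF am]) simp
  then obtain seed density where seed: "\<And>n m x y. adj x y \<Longrightarrow>
      labels.prob {\<omega>. \<not> kept (orbit (seed n)) (density n) m \<omega> x y} \<le> (1 / 2) ^ n"
    by metis
  interpret percolation adj G seed density
    by (intro percolation.intro am percolation_axioms.intro seed)
  define E3 where "E3 = graph_power V E 3"
  \<comment> \<open>Restricting to \<open>E3\<close> keeps the values inside \<open>E3\<close> also
    for samples that are not good; for good ones nothing is lost.\<close>
  define Rs where "Rs c \<omega> = {e \<in> E3. \<exists>x y. e = {h x, h y} \<and> rray \<omega> (fst c) (snd c) x y}" for c \<omega>
  have sp: "space (subgraph_space E3) = Pow E3"
    by (simp add: subgraph_space_def space_measure_of_conv)
  have Rs[measurable]: "Rs c \<in> measurable labels (subgraph_space E3)" for c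
  proof (rule measurable_into_subgraph_space)
    show "Rs c \<omega> \<subseteq> E3" for \<omega> by (auto simp: Rs_def)
    fix e assume "e \<in> E3"
    then have "e \<in> Rs c \<omega> \<longleftrightarrow> (\<exists>x y. e = {h x, h y} \<and> rray \<omega> (fst c) (snd c) x y)" for \<omega>
      by (simp add: Rs_def)
    then show "Measurable.pred labels (\<lambda>\<omega>. e \<in> Rs c \<omega>)" by simp
  qed
  have Rs_iff: "{h x, h y} \<in> Rs c \<omega> \<longleftrightarrow> rray \<omega> (fst c) (snd c) x y" if "good \<omega>" for c \<omega> x y
  proof -
    note r = rray_double_ray[OF that]
    have "{h x, h y} \<in> E3" if xy: "rray \<omega> (fst c) (snd c) x y" for x y
    proof -
      obtain n where n: "n \<le> 3" "(adj ^^ n) x y" using r(3) xy by blast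
      have "(adj ^^ n) x y \<Longrightarrow> (h x, h y) \<in> adj_rel E ^^ n" for n y
      proof (induction n arbitrary: y)
        case (Suc n)
        then obtain z where z: "(adj ^^ n) x z" "adj z y" by auto
        have "(h z, h y) \<in> adj_rel E" using z(2) by (simp add: adj_def adj_rel_def)
        with Suc.IH[OF z(1)] show ?case by auto
      qed auto
      then have "graph_dist E (h x) (h y) \<le> enat n"
        unfolding graph_dist_def using n(2) by (intro INF_lower) auto
      also have "\<dots> \<le> enat 3" using n(1) by simp
      finally show ?thesis
        using r(5) xy h(1) hV by (auto simp: E3_def graph_power_edge_iff[OF assms(1)] inj_eq)
    qed
    then show ?thesis using r(4) h(1) by (auto simp: Rs_def doubleton_eq_iff inj_eq)
  qed
  have Rs_ray: "spanning_double_ray V E3 (Rs c \<omega>)" if "good \<omega>" for c \<omega>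
  proof -
    note r = rray_double_ray[OF that]
    have sub: "Rs c \<omega> \<subseteq> E3" by (auto simp: Rs_def)
    have "{m. rray \<omega> (fst c) (snd c) m n} = {m. rray \<omega> (fst c) (snd c) n m}" for n using r(4) by blast
    then show ?thesis
      unfolding spanning_double_ray_image[OF graph_graph_power[of V E 3, folded E3_def] h sub] Rs_iff[OF that]
      using r(1,2) by (intro conjI allI) simp_all
  qed
  have Rs_shift: "\<exists>\<beta>' \<gamma>'. \<forall>\<beta> \<gamma>. subgraph_action g (Rs (\<beta>, \<gamma>) (relabel (conj g) \<omega>)) = Rs (\<beta> = \<beta>', \<gamma> = \<gamma>') \<omega>"
    if g: "g \<in> \<Gamma>" and eq: "\<exists>\<beta>' \<gamma>'. \<forall>\<beta> \<gamma> x y. rray (relabel (conj g) \<omega>) \<beta> \<gamma> x y =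
      rray \<omega> (\<beta> = \<beta>') (\<gamma> = \<gamma>') (conj g x) (conj g y)" for g \<omega>
  proof -
    obtain \<beta>' \<gamma>' where eq: "\<And>\<beta> \<gamma> x y. rray (relabel (conj g) \<omega>) \<beta> \<gamma> x y =
      rray \<omega> (\<beta> = \<beta>') (\<gamma> = \<gamma>') (conj g x) (conj g y)" using eq by blast
    have "g \<in> graph_auts V E3"
      using graph_auts_graph_power[OF assms(1), of 3] \<Gamma>(1) g unfolding E3_def by blast
    then have E3: "{h (conj g x), h (conj g y)} \<in> E3 \<longleftrightarrow> {h x, h y} \<in> E3" for x y
      unfolding conj[OF g] graph_auts_def using hV by blast
    have "conj g \<in> G" using g by (simp add: G_def)
    then have surj: "\<exists>x. y = conj g x" for y using G_bij by (metis bij_pointE)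
    have "subgraph_action g (Rs (\<beta>, \<gamma>) (relabel (conj g) \<omega>)) = Rs (\<beta> = \<beta>', \<gamma> = \<gamma>') \<omega>" for \<beta> \<gamma>
    proof
      show "subgraph_action g (Rs (\<beta>, \<gamma>) (relabel (conj g) \<omega>)) \<subseteq> Rs (\<beta> = \<beta>', \<gamma> = \<gamma>') \<omega>"
      proof
        fix e' assume "e' \<in> subgraph_action g (Rs (\<beta>, \<gamma>) (relabel (conj g) \<omega>))"
        then obtain x y where xy: "{h x, h y} \<in> E3" "rray (relabel (conj g) \<omega>) \<beta> \<gamma> x y" "e' = g ` {h x, h y}"
          unfolding subgraph_action_def Rs_def by auto
        then have "e' = {h (conj g x), h (conj g y)}" by (simp add: conj[OF g])
        moreover have "e' \<in> E3" using calculation xy(1) E3 by simp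
        moreover have "rray \<omega> (\<beta> = \<beta>') (\<gamma> = \<gamma>') (conj g x) (conj g y)" using xy(2) eq by simp
        ultimately show "e' \<in> Rs (\<beta> = \<beta>', \<gamma> = \<gamma>') \<omega>" unfolding Rs_def by auto
      qed
      show "Rs (\<beta> = \<beta>', \<gamma> = \<gamma>') \<omega> \<subseteq> subgraph_action g (Rs (\<beta>, \<gamma>) (relabel (conj g) \<omega>))"
      proof
        fix e assume "e \<in> Rs (\<beta> = \<beta>', \<gamma> = \<gamma>') \<omega>"
        then obtain x y where e: "e \<in> E3" "e = {h x, h y}" "rray \<omega> (\<beta> = \<beta>') (\<gamma> = \<gamma>') x y"
          by (auto simp: Rs_def)
        obtain u v where uv: "x = conj g u" "y = conj g v" using surj by blast
        have "{h u, h v} \<in> E3" using e(1) unfolding e(2) uv E3 .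
        moreover have "rray (relabel (conj g) \<omega>) \<beta> \<gamma> u v" using e(3) unfolding uv eq .
        ultimately have "{h u, h v} \<in> Rs (\<beta>, \<gamma>) (relabel (conj g) \<omega>)" unfolding Rs_def by auto
        moreover have "e = g ` {h u, h v}" unfolding e(2) uv by (simp add: conj[OF g])
        ultimately show "e \<in> subgraph_action g (Rs (\<beta>, \<gamma>) (relabel (conj g) \<omega>))"
          unfolding subgraph_action_def by blast
      qed
    qed
    then show ?thesis by blast
  qed
  text \<open>An automorphism permutes the four sign pairs, so a uniform pair of signs restores invariance.\<close>
  define coin where "coin = measure_pmf (pmf_of_set (UNIV :: (bool \<times> bool) set))"
  define N where "N = coin \<Otimes>\<^sub>M (labels :: (nat list \<times> nat \<Rightarrow> real) measure)"
  define f where "f = (\<lambda>(c, \<omega>). Rs c \<omega>)"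
  interpret coin: prob_space coin unfolding coin_def by (rule measure_pmf.prob_space_axioms)
  interpret N: pair_prob_space coin "labels :: (nat list \<times> nat \<Rightarrow> real) measure" ..
  have f[measurable]: "f \<in> measurable N (subgraph_space E3)"
  proof -
    have "f \<in> measurable (count_space UNIV \<Otimes>\<^sub>M labels) (subgraph_space E3)"
      unfolding f_def by (rule measurable_pair_measure_countable1) auto
    moreover have "sets N = sets (count_space UNIV \<Otimes>\<^sub>M labels)"
      unfolding N_def coin_def by (intro sets_pair_measure_cong) auto
    ultimately show ?thesis by (simp cong: measurable_cong_sets)
  qed
  define M where "M = distr N (subgraph_space E3) f"
  have law: "emeasure M A = (\<Sum>c\<in>UNIV. emeasure labels {\<omega>. Rs c \<omega> \<in> A}) * ennreal (1 / 4)"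
    if A[measurable]: "A \<in> sets (subgraph_space E3)" for A
  proof -
    have "emeasure M A = emeasure N (f -` A \<inter> space N)" unfolding M_def by (rule emeasure_distr[OF f A])
    also have "\<dots> = (\<integral>\<^sup>+c. emeasure labels (Pair c -` (f -` A \<inter> space N)) \<partial>coin)"
      unfolding N_def by (rule labels.emeasure_pair_measure_alt) (use measurable_sets[OF f A] in \<open>simp add: N_def\<close>)
    also have "\<dots> = (\<integral>\<^sup>+c. emeasure labels {\<omega>. Rs c \<omega> \<in> A} \<partial>coin)"
      by (intro nn_integral_cong arg_cong[where f = "emeasure labels"])
        (auto simp: f_def N_def space_pair_measure coin_def)
    also have "\<dots> = (\<Sum>c\<in>UNIV. emeasure labels {\<omega>. Rs c \<omega> \<in> A} * ennreal (1 / 4))"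
      unfolding coin_def by (subst nn_integral_measure_pmf_finite) (auto simp: card_UNIV_bool UNIV_Times_UNIV[symmetric] card_cartesian_product simp del: UNIV_Times_UNIV)
    finally show ?thesis by (simp add: sum_distrib_right)
  qed
  have "random_spanning_double_ray M V E3 (\<lambda>S. S)"
    unfolding random_spanning_double_ray_def
  proof (intro conjI)
    show "prob_space M" unfolding M_def by (rule prob_space.prob_space_distr[OF _ f]) (simp add: N_def N.prob_space_axioms)
    show "(\<lambda>S. S) \<in> measurable M (subgraph_space E3)"
      unfolding M_def by simp
    have "AE x in N. spanning_double_ray V E3 (f x)"
    proof -
      have "AE \<omega> in labels. spanning_double_ray V E3 (f (c, \<omega>))" for c
        using AE_good by eventually_elim (simp add: f_def Rs_ray)
      then have "AE c in coin. AE \<omega> in labels. spanning_double_ray V E3 (f (c, \<omega>))" by simp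
      moreover have "Measurable.pred N (\<lambda>x. spanning_double_ray V E3 (f x))"
        using pred_spanning_double_ray[OF graph_graph_power[of V E 3] h] f
        unfolding E3_def by (rule measurable_compose[rotated])
      ultimately show ?thesis unfolding N_def by (intro N.AE_pair_measure) (auto simp: pred_def N_def)
    qed
    then show "AE x in M. spanning_double_ray V E3 x"
      unfolding M_def using pred_spanning_double_ray[OF graph_graph_power[of V E 3] h]
      by (subst AE_distr_iff[OF f]) (auto simp: pred_def E3_def)
  qed
  moreover have "invariant_random_subgraph \<Gamma> M E3 (\<lambda>S. S)"
    unfolding invariant_random_subgraph_def
  proof
    fix g assume g: "g \<in> \<Gamma>"
    have gG: "conj g \<in> G" using g by (simp add: G_def)
    have inj: "inj (conj g)" using G_bij[OF gG] bij_is_inj by blast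
    have act[measurable]: "subgraph_action g \<in> measurable (subgraph_space E3) (subgraph_space E3)"
      unfolding E3_def using graph_auts_graph_power[OF assms(1), of 3] \<Gamma>(1) g
      by (intro measurable_subgraph_action[OF graph_graph_power]) blast
    have M: "distr M (subgraph_space E3) (\<lambda>S. S) = M"
      unfolding M_def by (subst distr_distr) (auto simp: comp_def)
    have "distr M (subgraph_space E3) (subgraph_action g) = M"
    proof (rule measure_eqI)
      show "sets (distr M (subgraph_space E3) (subgraph_action g)) = sets M" by (simp add: M_def)
      fix A assume "A \<in> sets (distr M (subgraph_space E3) (subgraph_action g))"
      then have A[measurable]: "A \<in> sets (subgraph_space E3)" by simp
      define B where "B = subgraph_action g -` A \<inter> space (subgraph_space E3)"
      have B[measurable]: "B \<in> sets (subgraph_space E3)" unfolding B_def by measurable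
      have pre[measurable]: "{\<omega>. Rs c \<omega> \<in> C} \<in> sets labels" if [measurable]: "C \<in> sets (subgraph_space E3)" for c C
      proof -
        have "{\<omega> \<in> space labels. Rs c \<omega> \<in> C} \<in> sets labels" by measurable
        then show ?thesis by simp
      qed
      have relabel: "emeasure labels {\<omega>. Rs c \<omega> \<in> B} = emeasure labels {\<omega>. Rs c (relabel (conj g) \<omega>) \<in> B}" for c
        using emeasure_distr[OF distr_relabel(1)[OF inj] pre[OF B, of c]] distr_relabel(2)[OF inj]
        by (simp add: vimage_def)
      have pre': "{\<omega>. Rs c (relabel (conj g) \<omega>) \<in> B} \<in> sets labels" for c
        using measurable_sets[OF distr_relabel(1)[OF inj] pre[OF B, of c]] by (simp add: vimage_def)
      have "(\<Sum>c\<in>UNIV. emeasure labels {\<omega>. Rs c \<omega> \<in> B}) =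
          (\<Sum>c\<in>UNIV. \<integral>\<^sup>+\<omega>. indicator {\<omega>. Rs c (relabel (conj g) \<omega>) \<in> B} \<omega> \<partial>labels)"
        unfolding relabel using pre' by simp
      \<comment> \<open>The four terms are summed under the integral because the permutation of the
        sign pairs depends on \<omega>; the terms need not match one by one.\<close>
      also have "\<dots> = (\<integral>\<^sup>+\<omega>. (\<Sum>c\<in>UNIV. indicator {\<omega>. Rs c (relabel (conj g) \<omega>) \<in> B} \<omega>) \<partial>labels)"
        by (rule nn_integral_sum[symmetric]) (use pre' in auto)
      also have "\<dots> = (\<integral>\<^sup>+\<omega>. (\<Sum>c\<in>UNIV. indicator {\<omega>. Rs c \<omega> \<in> A} \<omega>) \<partial>labels)"
      proof (rule nn_integral_cong_AE)
        show "AE \<omega> in labels. (\<Sum>c\<in>UNIV. indicator {\<omega>. Rs c (relabel (conj g) \<omega>) \<in> B} \<omega> :: ennreal) =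
            (\<Sum>c\<in>UNIV. indicator {\<omega>. Rs c \<omega> \<in> A} \<omega>)"
          using AE_rray_relabel[OF gG]
        proof eventually_elim
          case (elim \<omega>)
          obtain \<beta>' \<gamma>' where eq: "\<And>\<beta> \<gamma>. subgraph_action g (Rs (\<beta>, \<gamma>) (relabel (conj g) \<omega>)) = Rs (\<beta> = \<beta>', \<gamma> = \<gamma>') \<omega>"
            using Rs_shift[OF g elim] by blast
          \<comment> \<open>Comparing with a fixed truth value is an involution, so
            \<open>?\<sigma>\<close> is its own inverse.\<close>
          let ?\<sigma> = "\<lambda>(\<beta>, \<gamma>). (\<beta> = \<beta>', \<gamma> = \<gamma>')"
          have "Rs c (relabel (conj g) \<omega>) \<in> B \<longleftrightarrow> Rs (?\<sigma> c) \<omega> \<in> A" for c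
            using eq[of "fst c" "snd c"] by (auto simp: B_def sp Rs_def[of c "relabel (conj g) \<omega>"] split: prod.split)
          then have "(\<Sum>c\<in>UNIV. indicator {\<omega>. Rs c (relabel (conj g) \<omega>) \<in> B} \<omega> :: ennreal) =
              (\<Sum>c\<in>UNIV. indicator {\<omega>. Rs (?\<sigma> c) \<omega> \<in> A} \<omega>)"
            by (intro sum.cong) (auto simp: indicator_def)
          also have "\<dots> = (\<Sum>c\<in>UNIV. indicator {\<omega>. Rs c \<omega> \<in> A} \<omega>)"
            by (rule sum.reindex_bij_witness[of _ ?\<sigma> ?\<sigma>]) auto
          finally show ?case .
        qed
      qed
      also have "\<dots> = (\<Sum>c\<in>UNIV. \<integral>\<^sup>+\<omega>. indicator {\<omega>. Rs c \<omega> \<in> A} \<omega> \<partial>labels)"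
        by (rule nn_integral_sum) (use pre[OF A] in auto)
      also have "\<dots> = (\<Sum>c\<in>UNIV. emeasure labels {\<omega>. Rs c \<omega> \<in> A})" using pre[OF A] by simp
      finally have "emeasure M B = emeasure M A" by (simp add: law)
      moreover have "emeasure (distr M (subgraph_space E3) (subgraph_action g)) A = emeasure M B"
        unfolding B_def M_def by (subst emeasure_distr) auto
      ultimately show "emeasure (distr M (subgraph_space E3) (subgraph_action g)) A = emeasure M A" by simp
    qed
    then show "distr (distr M (subgraph_space E3) (\<lambda>S. S)) (subgraph_space E3) (subgraph_action g) =
        distr M (subgraph_space E3) (\<lambda>S. S)"
      unfolding M .
  qed
  ultimately show ?thesis unfolding E3_def by blast
qed

end
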